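(* Let $(M,\nabla,\langle\cdot,\cdot\rangle)$ be an affine-Riemann manifold. If $\mathrm{tr}_{\langle,\rangle}(\gamma^* )=0$ then, for every vector field $X$ on $M$, $\mathrm{tr}_{\langle,\rangle}(D_X(\gamma^* ))=0$. In particular, if $\mathrm{tr}_{\langle,\rangle}(\gamma^* )=0$ then the Chern Ricci form $\rho^C$ of the canonical Hermitian structure $(TM,J_1,g_1)$ vanishes.
   Context: An affine-Riemann manifold $(M,\nabla,\langle\cdot,\cdot\rangle)$ is a manifold with a flat torsionless connection $\nabla$ and a Riemannian metric. $D$ is the Levi-Civita connection of the metric; the difference tensor is $\gamma_XY=D_XY-\nabla_XY$ and $\gamma^*$ is defined by $\langle\gamma^*_XY,Z\rangle=\langle Y,\gamma_XZ\rangle$; $D_X(\gamma^* )(Y,Z)=D_X(\gamma^*_YZ)-\gamma^*_{D_XY}Z-\gamma^*_YD_XZ$. For a local orthonormal frame $(E_i)$, $\mathrm{tr}_{\langle,\rangle}(\gamma^* )=\sum_i\gamma^*_{E_i}E_i$ and $\mathrm{tr}_{\langle,\rangle}(D_X(\gamma^* ))=\sum_iD_X(\gamma^* )(E_i,E_i)$. Canonical Hermitian structure: $\pi_1:TM\to M$ is the projection; for a vector field $X$ on $M$, $X^h$ is the horizontal lift with respect to $\nabla$ and $X^v$ the vertical lift; $J_1X^h=X^v$, $J_1X^v=-X^h$; $g_1(X^h,Y^h)=g_1(X^v,Y^v)=\langle X,Y\rangle\circ\pi_1$, $g_1(X^h,Y^v)=0$. For a Hermitian manifold $(N,J,g)$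 of real dimension $2n$ with $\omega=g(J\cdot,\cdot)$ and Levi-Civita connection $\nabla^{LC}$, the Chern connection is $g(\nabla^C_XY,Z)=g(\nabla^{LC}_XY,Z)-\frac12d\omega(JX,Y,Z)$ (the unique connection preserving $J$ and $g$ whose torsion has trivial $(1,1)$-component). With $R^C(X,Y)=\nabla^C_{[X,Y]}-\nabla^C_X\nabla^C_Y+\nabla^C_Y\nabla^C_X$, its Ricci form is $\rho^C(X,Y)=\frac12\sum_{i=1}^{2n}g(R^C(X,Y)E_i,JE_i)$ for a local $g$-orthonormal frame. *)

theory Defs
  imports "HOL-Analysis.Analysis" "HOL-Library.Function_Algebras"
begin

section \<open>Smooth manifolds\<close>

text \<open>Both notions are meant for open \<open>S\<close>.\<close>

primrec Ck_on :: "nat \<Rightarrow> 'a::euclidean_space set \<Rightarrow> ('a \<Rightarrow> 'b::real_normed_vector) \<Rightarrow> bool" where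
  "Ck_on 0 S f \<longleftrightarrow> continuous_on S f"
| "Ck_on (Suc k) S f \<longleftrightarrow>
     f differentiable_on S \<and> (\<forall>v. Ck_on k S (\<lambda>x. frechet_derivative f (at x) v))"

definition smooth_on :: "'a::euclidean_space set \<Rightarrow> ('a \<Rightarrow> 'b::real_normed_vector) \<Rightarrow> bool" where
  "smooth_on S f \<longleftrightarrow> (\<forall>k. Ck_on k S f)"

text \<open>An atlas is an indexed family of charts \<open>(cdom i, chart i)\<close>, \<open>i \<in> idx\<close>, modelled on the
  Euclidean space \<open>'e\<close>. The underlying set and its topology are determined by the atlas.\<close>

record ('i, 'm, 'e) atlas =
  idx :: "'i set"
  cdom :: "'i \<Rightarrow> 'm set"
  chart :: "'i \<Rightarrow> 'm \<Rightarrow> 'e"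

definition carrier_of :: "('i, 'm, 'e) atlas \<Rightarrow> 'm set" where
  "carrier_of M = (\<Union>i\<in>idx M. cdom M i)"

definition charts_at :: "('i, 'm, 'e) atlas \<Rightarrow> 'm \<Rightarrow> 'i set" where
  "charts_at M p = {i \<in> idx M. p \<in> cdom M i}"

definition param :: "('i, 'm, 'e) atlas \<Rightarrow> 'i \<Rightarrow> 'e \<Rightarrow> 'm" where
  "param M i = inv_into (cdom M i) (chart M i)"

definition transition :: "('i, 'm, 'e) atlas \<Rightarrow> 'i \<Rightarrow> 'i \<Rightarrow> 'e \<Rightarrow> 'e" where
  "transition M i j = chart M j \<circ> param M i"

definition mopen :: "('i, 'm, 'e::euclidean_space) atlas \<Rightarrow> 'm set \<Rightarrow> bool" where
  "mopen M U \<longleftrightarrow> U \<subseteq> carrier_of M \<and> (\<forall>i\<in>idx M. open (chart M i ` (U \<inter> cdom M i)))"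

definition smooth_manifold :: "('i, 'm, 'e::euclidean_space) atlas \<Rightarrow> bool" where
  "smooth_manifold M \<longleftrightarrow>
     (\<forall>i\<in>idx M. inj_on (chart M i) (cdom M i) \<and> open (chart M i ` cdom M i)) \<and>
     (\<forall>i\<in>idx M. \<forall>j\<in>idx M.
        open (chart M i ` (cdom M i \<inter> cdom M j)) \<and>
        smooth_on (chart M i ` (cdom M i \<inter> cdom M j)) (transition M i j)) \<and>
     Hausdorff_space (topology (mopen M)) \<and> second_countable (topology (mopen M))"

definition smooth_fun :: "('i, 'm, 'e::euclidean_space) atlas \<Rightarrow> 'm set \<Rightarrow> ('m \<Rightarrow> real) \<Rightarrow> bool" where
  "smooth_fun M U f \<longleftrightarrow> (\<forall>i\<in>idx M. smooth_on (chart M i ` (U \<inter> cdom M i)) (f \<circ> param M i))"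

section \<open>Tangent vectors and vector fields\<close>

text \<open>A tangent vector at \<open>p\<close> is the family of its components \<open>v i\<close> in all the charts around \<open>p\<close>,
  related by the derivatives of the transition maps (and \<open>0\<close> at all other indices). Vectors and
  vector fields are added and subtracted pointwise; the component of a vector field \<open>X\<close> at \<open>p\<close> in
  the chart \<open>i\<close> is \<open>X p i\<close>.\<close>

definition dtrans :: "('i, 'm, 'e::euclidean_space) atlas \<Rightarrow> 'i \<Rightarrow> 'i \<Rightarrow> 'm \<Rightarrow> 'e \<Rightarrow> 'e" where
  "dtrans M i j p = frechet_derivative (transition M i j) (at (chart M i p))"

definition tangent_space :: "('i, 'm, 'e::euclidean_space) atlas \<Rightarrow> 'm \<Rightarrow> ('i \<Rightarrow> 'e) set" where
  "tangent_space M p =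
     {v. (\<forall>i\<in>charts_at M p. \<forall>j\<in>charts_at M p. v j = dtrans M i j p (v i)) \<and>
         (\<forall>i. i \<notin> charts_at M p \<longrightarrow> v i = 0)}"

definition vscale :: "real \<Rightarrow> ('i \<Rightarrow> 'e::real_vector) \<Rightarrow> 'i \<Rightarrow> 'e" (infixr "\<cdot>" 75) where
  "a \<cdot> v = (\<lambda>i. a *\<^sub>R v i)"

definition vector_field ::
    "('i, 'm, 'e::euclidean_space) atlas \<Rightarrow> 'm set \<Rightarrow> ('m \<Rightarrow> 'i \<Rightarrow> 'e) \<Rightarrow> bool" where
  "vector_field M U X \<longleftrightarrow>
     (\<forall>p\<in>U. X p \<in> tangent_space M p) \<and>
     (\<forall>i\<in>idx M. smooth_on (chart M i ` (U \<inter> cdom M i)) (\<lambda>x. X (param M i x) i))"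

text \<open>The function \<open>X f\<close>; the chart used is immaterial when \<open>X p\<close> is a tangent vector.\<close>

definition dir_deriv ::
    "('i, 'm, 'e::euclidean_space) atlas \<Rightarrow> ('m \<Rightarrow> 'i \<Rightarrow> 'e) \<Rightarrow> ('m \<Rightarrow> real) \<Rightarrow> 'm \<Rightarrow> real" where
  "dir_deriv M X f p =
     (let i = (SOME i. i \<in> charts_at M p)
      in frechet_derivative (f \<circ> param M i) (at (chart M i p)) (X p i))"

definition lie_bracket ::
    "('i, 'm, 'e::euclidean_space) atlas \<Rightarrow> ('m \<Rightarrow> 'i \<Rightarrow> 'e) \<Rightarrow> ('m \<Rightarrow> 'i \<Rightarrow> 'e) \<Rightarrow> 'm \<Rightarrow> 'i \<Rightarrow> 'e" where
  "lie_bracket M X Y p i =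
     (if i \<in> charts_at M p
      then frechet_derivative (\<lambda>x. Y (param M i x) i) (at (chart M i p)) (X p i)
         - frechet_derivative (\<lambda>x. X (param M i x) i) (at (chart M i p)) (Y p i)
      else 0)"

section \<open>Connections and Riemannian metrics\<close>

text \<open>A connection acts on vector fields defined on arbitrary open sets, compatibly with
  restriction.\<close>

definition connection ::
    "('i, 'm, 'e::euclidean_space) atlas \<Rightarrow>
     (('m \<Rightarrow> 'i \<Rightarrow> 'e) \<Rightarrow> ('m \<Rightarrow> 'i \<Rightarrow> 'e) \<Rightarrow> 'm \<Rightarrow> 'i \<Rightarrow> 'e) \<Rightarrow> bool" where
  "connection M nab \<longleftrightarrow>
     (\<forall>U X X' Y Y' f. mopen M U \<and> vector_field M U X \<and> vector_field M U X' \<and>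
        vector_field M U Y \<and> vector_field M U Y' \<and> smooth_fun M U f \<longrightarrow>
        vector_field M U (nab X Y) \<and>
        ((\<forall>p\<in>U. X p = X' p \<and> Y p = Y' p) \<longrightarrow> (\<forall>p\<in>U. nab X Y p = nab X' Y' p)) \<and>
        (\<forall>p\<in>U.
           nab (X + X') Y p = nab X Y p + nab X' Y p \<and>
           nab (\<lambda>q. f q \<cdot> X q) Y p = f p \<cdot> nab X Y p \<and>
           nab X (Y + Y') p = nab X Y p + nab X Y' p \<and>
           nab X (\<lambda>q. f q \<cdot> Y q) p = dir_deriv M X f p \<cdot> Y p + f p \<cdot> nab X Y p))"

definition torsion_free ::
    "('i, 'm, 'e::euclidean_space) atlas \<Rightarrow>
     (('m \<Rightarrow> 'i \<Rightarrow> 'e) \<Rightarrow> ('m \<Rightarrow> 'i \<Rightarrow> 'e) \<Rightarrow> 'm \<Rightarrow> 'i \<Rightarrow> 'e) \<Rightarrow> bool" where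
  "torsion_free M nab \<longleftrightarrow>
     (\<forall>U X Y. mopen M U \<and> vector_field M U X \<and> vector_field M U Y \<longrightarrow>
        (\<forall>p\<in>U. nab X Y p - nab Y X p = lie_bracket M X Y p))"

definition curvature ::
    "('i, 'm, 'e::euclidean_space) atlas \<Rightarrow>
     (('m \<Rightarrow> 'i \<Rightarrow> 'e) \<Rightarrow> ('m \<Rightarrow> 'i \<Rightarrow> 'e) \<Rightarrow> 'm \<Rightarrow> 'i \<Rightarrow> 'e) \<Rightarrow>
     ('m \<Rightarrow> 'i \<Rightarrow> 'e) \<Rightarrow> ('m \<Rightarrow> 'i \<Rightarrow> 'e) \<Rightarrow> ('m \<Rightarrow> 'i \<Rightarrow> 'e) \<Rightarrow> 'm \<Rightarrow> 'i \<Rightarrow> 'e" where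
  "curvature M nab X Y Z =
     nab (lie_bracket M X Y) Z - nab X (nab Y Z) + nab Y (nab X Z)"

definition flat ::
    "('i, 'm, 'e::euclidean_space) atlas \<Rightarrow>
     (('m \<Rightarrow> 'i \<Rightarrow> 'e) \<Rightarrow> ('m \<Rightarrow> 'i \<Rightarrow> 'e) \<Rightarrow> 'm \<Rightarrow> 'i \<Rightarrow> 'e) \<Rightarrow> bool" where
  "flat M nab \<longleftrightarrow>
     (\<forall>U X Y Z. mopen M U \<and> vector_field M U X \<and> vector_field M U Y \<and> vector_field M U Z \<longrightarrow>
        (\<forall>p\<in>U. curvature M nab X Y Z p = 0))"

definition riemannian_metric ::
    "('i, 'm, 'e::euclidean_space) atlas \<Rightarrow> ('m \<Rightarrow> ('i \<Rightarrow> 'e) \<Rightarrow> ('i \<Rightarrow> 'e) \<Rightarrow> real) \<Rightarrow> bool" where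
  "riemannian_metric M g \<longleftrightarrow>
     (\<forall>p\<in>carrier_of M. \<forall>u\<in>tangent_space M p. \<forall>v\<in>tangent_space M p. \<forall>w\<in>tangent_space M p.
        g p u v = g p v u \<and>
        (\<forall>a b. g p (a \<cdot> u + b \<cdot> v) w = a * g p u w + b * g p v w) \<and>
        (u \<noteq> 0 \<longrightarrow> 0 < g p u u)) \<and>
     (\<forall>U X Y. mopen M U \<and> vector_field M U X \<and> vector_field M U Y \<longrightarrow>
        smooth_fun M U (\<lambda>p. g p (X p) (Y p)))"

definition levi_civita ::
    "('i, 'm, 'e::euclidean_space) atlas \<Rightarrow> ('m \<Rightarrow> ('i \<Rightarrow> 'e) \<Rightarrow> ('i \<Rightarrow> 'e) \<Rightarrow> real) \<Rightarrow>
     (('m \<Rightarrow> 'i \<Rightarrow> 'e) \<Rightarrow> ('m \<Rightarrow> 'i \<Rightarrow> 'e) \<Rightarrow> 'm \<Rightarrow> 'i \<Rightarrow> 'e) \<Rightarrow> bool" where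
  "levi_civita M g D \<longleftrightarrow>
     connection M D \<and> torsion_free M D \<and>
     (\<forall>U X Y Z. mopen M U \<and> vector_field M U X \<and> vector_field M U Y \<and> vector_field M U Z \<longrightarrow>
        (\<forall>p\<in>U. dir_deriv M X (\<lambda>q. g q (Y q) (Z q)) p
               = g p (D X Y p) (Z p) + g p (Y p) (D X Z p)))"

definition orthonormal_frame ::
    "('i, 'm, 'e::euclidean_space) atlas \<Rightarrow> ('m \<Rightarrow> ('i \<Rightarrow> 'e) \<Rightarrow> ('i \<Rightarrow> 'e) \<Rightarrow> real) \<Rightarrow>
     'm set \<Rightarrow> (nat \<Rightarrow> 'm \<Rightarrow> 'i \<Rightarrow> 'e) \<Rightarrow> bool" where
  "orthonormal_frame M g U E \<longleftrightarrow>
     mopen M U \<and> (\<forall>k<DIM('e). vector_field M U (E k)) \<and>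
     (\<forall>p\<in>U. \<forall>k<DIM('e). \<forall>l<DIM('e). g p (E k p) (E l p) = (if k = l then 1 else 0))"

section \<open>Affine-Riemann manifolds\<close>

definition affine_riemann ::
    "('i, 'm, 'e::euclidean_space) atlas \<Rightarrow>
     (('m \<Rightarrow> 'i \<Rightarrow> 'e) \<Rightarrow> ('m \<Rightarrow> 'i \<Rightarrow> 'e) \<Rightarrow> 'm \<Rightarrow> 'i \<Rightarrow> 'e) \<Rightarrow>
     ('m \<Rightarrow> ('i \<Rightarrow> 'e) \<Rightarrow> ('i \<Rightarrow> 'e) \<Rightarrow> real) \<Rightarrow> bool" where
  "affine_riemann M nab g \<longleftrightarrow>
     smooth_manifold M \<and> connection M nab \<and> flat M nab \<and> torsion_free M nab \<and>
     riemannian_metric M g"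

definition difference_tensor ::
    "(('m \<Rightarrow> 'i \<Rightarrow> 'e::euclidean_space) \<Rightarrow> ('m \<Rightarrow> 'i \<Rightarrow> 'e) \<Rightarrow> 'm \<Rightarrow> 'i \<Rightarrow> 'e) \<Rightarrow>
     (('m \<Rightarrow> 'i \<Rightarrow> 'e) \<Rightarrow> ('m \<Rightarrow> 'i \<Rightarrow> 'e) \<Rightarrow> 'm \<Rightarrow> 'i \<Rightarrow> 'e) \<Rightarrow>
     ('m \<Rightarrow> 'i \<Rightarrow> 'e) \<Rightarrow> ('m \<Rightarrow> 'i \<Rightarrow> 'e) \<Rightarrow> 'm \<Rightarrow> 'i \<Rightarrow> 'e" where
  "difference_tensor D nab X Y = D X Y - nab X Y"

text \<open>\<open>Ts X\<close> is the adjoint of \<open>T X\<close>; since \<open>g\<close> is nondegenerate, this determines \<open>Ts X Y\<close> on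
  every open set where \<open>X\<close> and \<open>Y\<close> are defined.\<close>

definition adjoint_tensor ::
    "('i, 'm, 'e::euclidean_space) atlas \<Rightarrow> ('m \<Rightarrow> ('i \<Rightarrow> 'e) \<Rightarrow> ('i \<Rightarrow> 'e) \<Rightarrow> real) \<Rightarrow>
     (('m \<Rightarrow> 'i \<Rightarrow> 'e) \<Rightarrow> ('m \<Rightarrow> 'i \<Rightarrow> 'e) \<Rightarrow> 'm \<Rightarrow> 'i \<Rightarrow> 'e) \<Rightarrow>
     (('m \<Rightarrow> 'i \<Rightarrow> 'e) \<Rightarrow> ('m \<Rightarrow> 'i \<Rightarrow> 'e) \<Rightarrow> 'm \<Rightarrow> 'i \<Rightarrow> 'e) \<Rightarrow> bool" where
  "adjoint_tensor M g T Ts \<longleftrightarrow>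
     (\<forall>U X Y. mopen M U \<and> vector_field M U X \<and> vector_field M U Y \<longrightarrow>
        vector_field M U (Ts X Y) \<and>
        (\<forall>Z. vector_field M U Z \<longrightarrow>
           (\<forall>p\<in>U. g p (Ts X Y p) (Z p) = g p (Y p) (T X Z p))))"

definition cov_deriv ::
    "(('m \<Rightarrow> 'i \<Rightarrow> 'e::euclidean_space) \<Rightarrow> ('m \<Rightarrow> 'i \<Rightarrow> 'e) \<Rightarrow> 'm \<Rightarrow> 'i \<Rightarrow> 'e) \<Rightarrow>
     ('m \<Rightarrow> 'i \<Rightarrow> 'e) \<Rightarrow>
     (('m \<Rightarrow> 'i \<Rightarrow> 'e) \<Rightarrow> ('m \<Rightarrow> 'i \<Rightarrow> 'e) \<Rightarrow> 'm \<Rightarrow> 'i \<Rightarrow> 'e) \<Rightarrow>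
     ('m \<Rightarrow> 'i \<Rightarrow> 'e) \<Rightarrow> ('m \<Rightarrow> 'i \<Rightarrow> 'e) \<Rightarrow> 'm \<Rightarrow> 'i \<Rightarrow> 'e" where
  "cov_deriv D X T Y Z = D X (T Y Z) - T (D X Y) Z - T Y (D X Z)"

definition frame_trace ::
    "(nat \<Rightarrow> 'm \<Rightarrow> 'i \<Rightarrow> 'e::euclidean_space) \<Rightarrow>
     (('m \<Rightarrow> 'i \<Rightarrow> 'e) \<Rightarrow> ('m \<Rightarrow> 'i \<Rightarrow> 'e) \<Rightarrow> 'm \<Rightarrow> 'i \<Rightarrow> 'e) \<Rightarrow> 'm \<Rightarrow> 'i \<Rightarrow> 'e" where
  "frame_trace E T = (\<Sum>k<DIM('e). T (E k) (E k))"

text \<open>The metric trace of \<open>T\<close> is identically zero.\<close>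

definition trace_vanishes ::
    "('i, 'm, 'e::euclidean_space) atlas \<Rightarrow> ('m \<Rightarrow> ('i \<Rightarrow> 'e) \<Rightarrow> ('i \<Rightarrow> 'e) \<Rightarrow> real) \<Rightarrow>
     (('m \<Rightarrow> 'i \<Rightarrow> 'e) \<Rightarrow> ('m \<Rightarrow> 'i \<Rightarrow> 'e) \<Rightarrow> 'm \<Rightarrow> 'i \<Rightarrow> 'e) \<Rightarrow> bool" where
  "trace_vanishes M g T \<longleftrightarrow>
     (\<forall>U E. orthonormal_frame M g U E \<longrightarrow> (\<forall>p\<in>U. frame_trace E T p = 0))"

section \<open>The tangent bundle and its canonical Hermitian structure\<close>

definition tangent_bundle ::
    "('i, 'm, 'e::euclidean_space) atlas \<Rightarrow> ('i, 'm \<times> ('i \<Rightarrow> 'e), 'e \<times> 'e) atlas" where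
  "tangent_bundle M =
     \<lparr>idx = idx M,
      cdom = (\<lambda>i. {(p, v). p \<in> cdom M i \<and> v \<in> tangent_space M p}),
      chart = (\<lambda>i (p, v). (chart M i p, v i))\<rparr>"

text \<open>The vector field on \<open>cdom M i\<close> with constant components \<open>a\<close> in the chart \<open>i\<close>.\<close>

definition const_field :: "('i, 'm, 'e::euclidean_space) atlas \<Rightarrow> 'i \<Rightarrow> 'e \<Rightarrow> 'm \<Rightarrow> 'i \<Rightarrow> 'e" where
  "const_field M i a p j =
     (if i \<in> charts_at M p \<and> j \<in> charts_at M p then dtrans M i j p a else 0)"

text \<open>The Christoffel symbols \<open>\<Gamma>(a, b)\<close> in the chart \<open>i\<close>, as a bilinear map.\<close>

definition christoffel ::
    "('i, 'm, 'e::euclidean_space) atlas \<Rightarrow>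
     (('m \<Rightarrow> 'i \<Rightarrow> 'e) \<Rightarrow> ('m \<Rightarrow> 'i \<Rightarrow> 'e) \<Rightarrow> 'm \<Rightarrow> 'i \<Rightarrow> 'e) \<Rightarrow>
     'i \<Rightarrow> 'm \<Rightarrow> 'e \<Rightarrow> 'e \<Rightarrow> 'e" where
  "christoffel M nab i p a b = nab (const_field M i a) (const_field M i b) p i"

text \<open>In induced coordinates \<open>(x, y)\<close> of the tangent bundle, the horizontal lift is
  \<open>(X, - \<Gamma>(X, y))\<close> and the vertical lift is \<open>(0, X)\<close>.\<close>

definition hlift ::
    "('i, 'm, 'e::euclidean_space) atlas \<Rightarrow>
     (('m \<Rightarrow> 'i \<Rightarrow> 'e) \<Rightarrow> ('m \<Rightarrow> 'i \<Rightarrow> 'e) \<Rightarrow> 'm \<Rightarrow> 'i \<Rightarrow> 'e) \<Rightarrow>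
     ('m \<Rightarrow> 'i \<Rightarrow> 'e) \<Rightarrow> 'm \<times> ('i \<Rightarrow> 'e) \<Rightarrow> 'i \<Rightarrow> 'e \<times> 'e" where
  "hlift M nab X = (\<lambda>(p, v) i.
     if i \<in> charts_at M p then (X p i, - christoffel M nab i p (X p i) (v i)) else 0)"

definition vlift ::
    "('i, 'm, 'e::euclidean_space) atlas \<Rightarrow> ('m \<Rightarrow> 'i \<Rightarrow> 'e) \<Rightarrow>
     'm \<times> ('i \<Rightarrow> 'e) \<Rightarrow> 'i \<Rightarrow> 'e \<times> 'e" where
  "vlift M X = (\<lambda>(p, v) i. if i \<in> charts_at M p then (0, X p i) else 0)"

definition canonical_hermitian ::
    "('i, 'm, 'e::euclidean_space) atlas \<Rightarrow>
     (('m \<Rightarrow> 'i \<Rightarrow> 'e) \<Rightarrow> ('m \<Rightarrow> 'i \<Rightarrow> 'e) \<Rightarrow> 'm \<Rightarrow> 'i \<Rightarrow> 'e) \<Rightarrow>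
     ('m \<Rightarrow> ('i \<Rightarrow> 'e) \<Rightarrow> ('i \<Rightarrow> 'e) \<Rightarrow> real) \<Rightarrow>
     ('m \<times> ('i \<Rightarrow> 'e) \<Rightarrow> ('i \<Rightarrow> 'e \<times> 'e) \<Rightarrow> 'i \<Rightarrow> 'e \<times> 'e) \<Rightarrow>
     ('m \<times> ('i \<Rightarrow> 'e) \<Rightarrow> ('i \<Rightarrow> 'e \<times> 'e) \<Rightarrow> ('i \<Rightarrow> 'e \<times> 'e) \<Rightarrow> real) \<Rightarrow> bool" where
  "canonical_hermitian M nab g J\<^sub>1 g\<^sub>1 \<longleftrightarrow>
     (\<forall>\<xi>\<in>carrier_of (tangent_bundle M).
        \<forall>u\<in>tangent_space (tangent_bundle M) \<xi>. \<forall>v\<in>tangent_space (tangent_bundle M) \<xi>.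
        \<forall>w\<in>tangent_space (tangent_bundle M) \<xi>. \<forall>a b.
          J\<^sub>1 \<xi> (a \<cdot> u + b \<cdot> v) = a \<cdot> J\<^sub>1 \<xi> u + b \<cdot> J\<^sub>1 \<xi> v \<and>
          g\<^sub>1 \<xi> u v = g\<^sub>1 \<xi> v u \<and>
          g\<^sub>1 \<xi> (a \<cdot> u + b \<cdot> v) w = a * g\<^sub>1 \<xi> u w + b * g\<^sub>1 \<xi> v w) \<and>
     (\<forall>U X Y. mopen M U \<and> vector_field M U X \<and> vector_field M U Y \<longrightarrow>
        (\<forall>\<xi>\<in>carrier_of (tangent_bundle M). fst \<xi> \<in> U \<longrightarrow>
           J\<^sub>1 \<xi> (hlift M nab X \<xi>) = vlift M X \<xi> \<and>
           J\<^sub>1 \<xi> (vlift M X \<xi>) = - hlift M nab X \<xi> \<and>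
           g\<^sub>1 \<xi> (hlift M nab X \<xi>) (hlift M nab Y \<xi>) = g (fst \<xi>) (X (fst \<xi>)) (Y (fst \<xi>)) \<and>
           g\<^sub>1 \<xi> (vlift M X \<xi>) (vlift M Y \<xi>) = g (fst \<xi>) (X (fst \<xi>)) (Y (fst \<xi>)) \<and>
           g\<^sub>1 \<xi> (hlift M nab X \<xi>) (vlift M Y \<xi>) = 0))"

section \<open>The Chern connection and its Ricci form\<close>

definition fundamental_form ::
    "('m \<Rightarrow> ('i \<Rightarrow> 'e) \<Rightarrow> 'i \<Rightarrow> 'e) \<Rightarrow> ('m \<Rightarrow> ('i \<Rightarrow> 'e) \<Rightarrow> ('i \<Rightarrow> 'e) \<Rightarrow> real) \<Rightarrow>
     'm \<Rightarrow> ('i \<Rightarrow> 'e) \<Rightarrow> ('i \<Rightarrow> 'e) \<Rightarrow> real" where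
  "fundamental_form J g p u v = g p (J p u) v"

text \<open>The exterior derivative of a 2-form, normalised without the factor \<open>1/3\<close>; this is the
  normalisation for which the formula below yields a connection preserving \<open>J\<close>.\<close>

definition ext_deriv ::
    "('i, 'm, 'e::euclidean_space) atlas \<Rightarrow> ('m \<Rightarrow> ('i \<Rightarrow> 'e) \<Rightarrow> ('i \<Rightarrow> 'e) \<Rightarrow> real) \<Rightarrow>
     ('m \<Rightarrow> 'i \<Rightarrow> 'e) \<Rightarrow> ('m \<Rightarrow> 'i \<Rightarrow> 'e) \<Rightarrow> ('m \<Rightarrow> 'i \<Rightarrow> 'e) \<Rightarrow> 'm \<Rightarrow> real" where
  "ext_deriv M \<omega> X Y Z p =
     dir_deriv M X (\<lambda>q. \<omega> q (Y q) (Z q)) p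
     + dir_deriv M Y (\<lambda>q. \<omega> q (Z q) (X q)) p
     + dir_deriv M Z (\<lambda>q. \<omega> q (X q) (Y q)) p
     - \<omega> p (lie_bracket M X Y p) (Z p)
     - \<omega> p (lie_bracket M Y Z p) (X p)
     - \<omega> p (lie_bracket M Z X p) (Y p)"

definition chern_connection ::
    "('i, 'm, 'e::euclidean_space) atlas \<Rightarrow> ('m \<Rightarrow> ('i \<Rightarrow> 'e) \<Rightarrow> 'i \<Rightarrow> 'e) \<Rightarrow>
     ('m \<Rightarrow> ('i \<Rightarrow> 'e) \<Rightarrow> ('i \<Rightarrow> 'e) \<Rightarrow> real) \<Rightarrow>
     (('m \<Rightarrow> 'i \<Rightarrow> 'e) \<Rightarrow> ('m \<Rightarrow> 'i \<Rightarrow> 'e) \<Rightarrow> 'm \<Rightarrow> 'i \<Rightarrow> 'e) \<Rightarrow> bool" where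
  "chern_connection N J g C \<longleftrightarrow>
     connection N C \<and>
     (\<exists>LC. levi_civita N g LC \<and>
       (\<forall>U X Y Z. mopen N U \<and> vector_field N U X \<and> vector_field N U Y \<and> vector_field N U Z \<longrightarrow>
         (\<forall>p\<in>U. g p (C X Y p) (Z p) =
            g p (LC X Y p) (Z p)
            - 1 / 2 * ext_deriv N (fundamental_form J g) (\<lambda>q. J q (X q)) Y Z p)))"

text \<open>The Ricci form computed in the orthonormal frame \<open>E\<close>.\<close>

definition ricci_form ::
    "('i, 'm, 'e::euclidean_space) atlas \<Rightarrow> ('m \<Rightarrow> ('i \<Rightarrow> 'e) \<Rightarrow> 'i \<Rightarrow> 'e) \<Rightarrow>
     ('m \<Rightarrow> ('i \<Rightarrow> 'e) \<Rightarrow> ('i \<Rightarrow> 'e) \<Rightarrow> real) \<Rightarrow>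
     (('m \<Rightarrow> 'i \<Rightarrow> 'e) \<Rightarrow> ('m \<Rightarrow> 'i \<Rightarrow> 'e) \<Rightarrow> 'm \<Rightarrow> 'i \<Rightarrow> 'e) \<Rightarrow>
     (nat \<Rightarrow> 'm \<Rightarrow> 'i \<Rightarrow> 'e) \<Rightarrow> ('m \<Rightarrow> 'i \<Rightarrow> 'e) \<Rightarrow> ('m \<Rightarrow> 'i \<Rightarrow> 'e) \<Rightarrow> 'm \<Rightarrow> real" where
  "ricci_form N J g C E X Y p =
     1 / 2 * (\<Sum>k<DIM('e). g p (curvature N C X Y (E k) p) (J p (E k p)))"

definition ricci_form_vanishes ::
    "('i, 'm, 'e::euclidean_space) atlas \<Rightarrow> ('m \<Rightarrow> ('i \<Rightarrow> 'e) \<Rightarrow> 'i \<Rightarrow> 'e) \<Rightarrow>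
     ('m \<Rightarrow> ('i \<Rightarrow> 'e) \<Rightarrow> ('i \<Rightarrow> 'e) \<Rightarrow> real) \<Rightarrow>
     (('m \<Rightarrow> 'i \<Rightarrow> 'e) \<Rightarrow> ('m \<Rightarrow> 'i \<Rightarrow> 'e) \<Rightarrow> 'm \<Rightarrow> 'i \<Rightarrow> 'e) \<Rightarrow> bool" where
  "ricci_form_vanishes N J g C \<longleftrightarrow>
     (\<forall>U E X Y. orthonormal_frame N g U E \<and> vector_field N U X \<and> vector_field N U Y \<longrightarrow>
        (\<forall>p\<in>U. ricci_form N J g C E X Y p = 0))"

end

theory Submission
  imports Defs
begin

text \<open>
  The coefficients of \<open>D\<^sub>X E\<^sub>k\<close> in an orthonormal frame are antisymmetric for every metric
  connection \<open>D\<close>, so differentiating the frame does not contribute to a trace. This gives the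
  first claim.

  For the second claim put \<open>S = \<gamma> + \<gamma>\<^sup>*\<close> and \<open>A = \<nabla> + S/2\<close>; then \<open>S\<^sub>X\<close> is symmetric, measures the
  failure of \<open>\<nabla>\<close> to be metric, and \<open>A\<close> is a metric connection. As \<open>\<nabla>\<close> is flat and torsion-free, the
  brackets of lifts are \<open>[X\<^sup>h, Y\<^sup>h] = [X, Y]\<^sup>h\<close>, \<open>[X\<^sup>h, Y\<^sup>v] = (\<nabla>\<^sub>X Y)\<^sup>v\<close> and \<open>[X\<^sup>v, Y\<^sup>v] = 0\<close>.
  Inserting them into the Koszul formula, one finds that the Chern connection \<open>C\<close> satisfies
  \<open>C(X\<^sup>h, Y\<^sup>h) = A(X, Y)\<^sup>h\<close>, \<open>C(X\<^sup>h, Y\<^sup>v) = A(X, Y)\<^sup>v\<close>, \<open>C(X\<^sup>v, Y\<^sup>h) = S(X, Y)\<^sup>v/2\<close> and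
  \<open>C(X\<^sup>v, Y\<^sup>v) = - S(X, Y)\<^sup>h/2\<close>. Hence the Ricci form can only be nonzero on pairs \<open>(X\<^sup>h, Y\<^sup>v)\<close>,
  where it is a multiple of the trace of \<open>S\<^sub>W - [A\<^sub>X, S\<^sub>Y]\<close> with \<open>W = \<nabla>\<^sub>X Y\<close>. Since \<open>A\<close> is metric,
  the trace of \<open>[A\<^sub>X, S\<^sub>Y]\<close> is the derivative of \<open>tr S\<^sub>Y\<close>, and \<open>tr S\<^sub>Z = 2 \<langle>tr \<gamma>\<^sup>*, Z\<rangle> = 0\<close> for
  all \<open>Z\<close>.
\<close>

section \<open>Calculus of smooth functions\<close>

lemma frechet_derivative_cong_open:
  assumes "open S" "x \<in> S" "\<And>y. y \<in> S \<Longrightarrow> f y = g y"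
  shows "frechet_derivative f (at x) = frechet_derivative g (at x)"
proof -
  have "(f has_derivative f') (at x) \<longleftrightarrow> (g has_derivative f') (at x)" for f'
    using assms has_derivative_transform_within_open[of f f' x UNIV S g]
      has_derivative_transform_within_open[of g f' x UNIV S f] by auto
  then show ?thesis by (simp add: frechet_derivative_def)
qed

lemma Ck_on_subset: "Ck_on k S f \<Longrightarrow> T \<subseteq> S \<Longrightarrow> Ck_on k T f"
  by (induction k arbitrary: f) (auto intro: continuous_on_subset differentiable_on_subset)

lemma Ck_on_cong:
  assumes "open S" "\<And>x. x \<in> S \<Longrightarrow> f x = g x" "Ck_on k S f"
  shows "Ck_on k S g"
  using assms(2,3)
proof (induction k arbitrary: f g)
  case 0
  then show ?case by (simp cong: continuous_on_cong_simp)
next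
  case (Suc k)
  have "g differentiable_on S"
    using Suc.prems differentiable_transform_within[of f _ S 1 g]
    by (auto simp: differentiable_on_def)
  moreover have "Ck_on k S (\<lambda>x. frechet_derivative g (at x) v)" for v
  proof (rule Suc.IH[of "\<lambda>x. frechet_derivative f (at x) v"])
    show "frechet_derivative f (at x) v = frechet_derivative g (at x) v" if "x \<in> S" for x
      using frechet_derivative_cong_open[OF assms(1) that, of f g] Suc.prems(1) by simp
  qed (use Suc.prems in simp)
  ultimately show ?case by simp
qed

lemma Ck_on_SucD: "Ck_on (Suc k) S f \<Longrightarrow> Ck_on k S f"
proof (induction k arbitrary: f)
  case 0
  then show ?case by (auto intro: differentiable_imp_continuous_on)
qed simp

lemma Ck_on_SucI:
  assumes S: "open S"
    and D: "\<And>x. x \<in> S \<Longrightarrow> (f has_derivative f' x) (at x)"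
    and C: "\<And>v. Ck_on k S (\<lambda>x. f' x v)"
  shows "Ck_on (Suc k) S f"
proof -
  have "f differentiable_on S"
    using D by (meson differentiableI differentiable_at_imp_differentiable_on)
  moreover have "Ck_on k S (\<lambda>x. frechet_derivative f (at x) v)" for v
    by (rule Ck_on_cong[OF S _ C[of v]]) (metis D frechet_derivative_at)
  ultimately show ?thesis by simp
qed

lemma Ck_on_Suc_has_derivative:
  assumes "open S" "Ck_on (Suc k) S f" "x \<in> S"
  shows "(f has_derivative frechet_derivative f (at x)) (at x)"
proof -
  have "f differentiable at x"
    using assms by (simp add: differentiable_on_eq_differentiable_at)
  then show ?thesis
    by (simp add: frechet_derivative_works)
qed

lemma Ck_on_const: "open S \<Longrightarrow> Ck_on k S (\<lambda>x. c)"
proof (induction k arbitrary: c)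
  case (Suc k)
  show ?case
    by (rule Ck_on_SucI[where f' = "\<lambda>x v. 0"]) (use Suc in auto)
qed simp

lemma Ck_on_bounded_linear:
  assumes "open S" "bounded_linear h"
  shows "Ck_on k S f \<Longrightarrow> Ck_on k S (\<lambda>x. h (f x))"
proof (induction k arbitrary: f)
  case 0
  then show ?case
    using assms(2) by (auto intro: bounded_linear.continuous_on)
next
  case (Suc k)
  show ?case
  proof (rule Ck_on_SucI[OF assms(1), where f' = "\<lambda>x v. h (frechet_derivative f (at x) v)"])
    show "((\<lambda>x. h (f x)) has_derivative (\<lambda>v. h (frechet_derivative f (at x) v))) (at x)"
      if "x \<in> S" for x
      using bounded_linear.has_derivative[OF assms(2) Ck_on_Suc_has_derivative[OF assms(1)
          Suc.prems that]] .
  qed (use Suc in auto)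
qed

lemma Ck_on_add:
  assumes "open S"
  shows "Ck_on k S f \<Longrightarrow> Ck_on k S g \<Longrightarrow> Ck_on k S (\<lambda>x. f x + g x)"
proof (induction k arbitrary: f g)
  case 0
  then show ?case by (auto intro: continuous_on_add)
next
  case (Suc k)
  show ?case
    by (rule Ck_on_SucI[OF assms(1),
          where f' = "\<lambda>x v. frechet_derivative f (at x) v + frechet_derivative g (at x) v"])
      (use Suc in \<open>auto intro!: has_derivative_add Ck_on_Suc_has_derivative[OF assms, of k] simp
          del: Ck_on.simps
        simp: Ck_on.simps(2)[of k S f] Ck_on.simps(2)[of k S g]\<close>)
qed

lemma Ck_on_sum:
  assumes "open S"
  shows "(\<And>i. i \<in> I \<Longrightarrow> Ck_on k S (f i)) \<Longrightarrow> Ck_on k S (\<lambda>x. \<Sum>i\<in>I. f i x)"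
  by (induction I rule: infinite_finite_induct) (auto intro: Ck_on_const Ck_on_add assms)

lemma Ck_on_bilinear:
  assumes "open S" "bounded_bilinear h"
  shows "Ck_on k S f \<Longrightarrow> Ck_on k S g \<Longrightarrow> Ck_on k S (\<lambda>x. h (f x) (g x))"
proof (induction k arbitrary: f g)
  case 0
  then show ?case
    using assms(2) by (auto intro: bounded_bilinear.continuous_on)
next
  case (Suc k)
  note fg = Suc.prems
  show ?case
  proof (rule Ck_on_SucI[OF assms(1), where f' = "\<lambda>x v. h (f x) (frechet_derivative g (at x) v)
      + h (frechet_derivative f (at x) v) (g x)"])
    show "((\<lambda>x. h (f x) (g x)) has_derivative (\<lambda>v. h (f x) (frechet_derivative g (at x) v)
      + h (frechet_derivative f (at x) v) (g x))) (at x)" if "x \<in> S" for x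
      using bounded_bilinear.FDERIV[OF assms(2) Ck_on_Suc_has_derivative[OF assms(1) fg(1) that]
          Ck_on_Suc_has_derivative[OF assms(1) fg(2) that]] .
    show "Ck_on k S (\<lambda>x. h (f x) (frechet_derivative g (at x) v)
      + h (frechet_derivative f (at x) v) (g x))" for v
      using fg Ck_on_SucD[OF fg(1)] Ck_on_SucD[OF fg(2)]
      by (intro Ck_on_add assms Suc.IH) auto
  qed
qed

lemma frechet_derivative_sum_Basis:
  fixes f :: "'a::euclidean_space \<Rightarrow> 'b::real_normed_vector"
  assumes "f differentiable at x"
  shows "frechet_derivative f (at x) v = (\<Sum>b\<in>Basis. (v \<bullet> b) *\<^sub>R frechet_derivative f (at x) b)"
  using linear_sum[OF linear_frechet_derivative[OF assms], of "\<lambda>b. (v \<bullet> b) *\<^sub>R b" Basis]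
    linear_scale[OF linear_frechet_derivative[OF assms]]
  by (simp add: euclidean_representation)

lemma Ck_on_compose:
  fixes f :: "'b::euclidean_space \<Rightarrow> 'c::real_normed_vector" and h :: "'a::euclidean_space \<Rightarrow> 'b"
  assumes "open S" "open T" "h ` S \<subseteq> T"
  shows "Ck_on k T f \<Longrightarrow> Ck_on k S h \<Longrightarrow> Ck_on k S (\<lambda>x. f (h x))"
proof (induction k arbitrary: f)
  case 0
  then show ?case
    using assms(3) by (auto intro: continuous_on_compose2)
next
  case (Suc k)
  note fh = Suc.prems
  have f_deriv: "(f has_derivative frechet_derivative f (at (h x))) (at (h x))" if "x \<in> S" for x
    using Ck_on_Suc_has_derivative[OF assms(2) fh(1)] that assms(3) by auto
  show ?case
  proof (rule Ck_on_SucI[OF assms(1), where f' = "\<lambda>x v. \<Sum>b\<in>Basis.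
      (frechet_derivative h (at x) v \<bullet> b) *\<^sub>R frechet_derivative f (at (h x)) b"])
    fix x assume x: "x \<in> S"
    have "f differentiable at (h x)"
      using f_deriv[OF x] by (rule differentiableI)
    then have "(\<lambda>v. \<Sum>b\<in>Basis. (frechet_derivative h (at x) v \<bullet> b) *\<^sub>R frechet_derivative f (at
        (h x)) b)
        = (\<lambda>v. frechet_derivative f (at (h x)) (frechet_derivative h (at x) v))"
      by (subst (2) frechet_derivative_sum_Basis) auto
    then show "((\<lambda>x. f (h x)) has_derivative (\<lambda>v. \<Sum>b\<in>Basis.
      (frechet_derivative h (at x) v \<bullet> b) *\<^sub>R frechet_derivative f (at (h x)) b)) (at x)"
      using diff_chain_at[OF Ck_on_Suc_has_derivative[OF assms(1) fh(2) x] f_deriv[OF x]]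
      by (simp add: o_def)
  next
    fix v
    show "Ck_on k S (\<lambda>x. \<Sum>b\<in>Basis.
      (frechet_derivative h (at x) v \<bullet> b) *\<^sub>R frechet_derivative f (at (h x)) b)"
      using fh Ck_on_SucD[OF fh(2)]
      by (intro Ck_on_sum assms Ck_on_bilinear[OF _ bounded_bilinear_scaleR]
          Ck_on_bounded_linear[OF _ bounded_linear_inner_left] Suc.IH) auto
  qed
qed

lemma Ck_on_powr:
  fixes f :: "'a::euclidean_space \<Rightarrow> real"
  assumes "open S" "\<And>x. x \<in> S \<Longrightarrow> f x > 0"
  shows "Ck_on k S f \<Longrightarrow> Ck_on k S (\<lambda>x. f x powr a)"
proof (induction k arbitrary: a)
  case 0
  then show ?case
    using assms(2) by (fastforce intro!: continuous_intros)
next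
  case (Suc k)
  show ?case
  proof (rule Ck_on_SucI[OF assms(1), where f'
      = "\<lambda>x v. a * f x powr (a - 1) * frechet_derivative f (at x) v"])
    fix x assume x: "x \<in> S"
    have "((\<lambda>y. y powr a) has_derivative (\<lambda>h. a * f x powr (a - 1) * h)) (at (f x))"
      using has_real_derivative_powr[OF assms(2)[OF x], of a]
      by (simp add: has_field_derivative_def)
    then show "((\<lambda>x. f x powr a) has_derivative (\<lambda>v. a * f x powr (a - 1) * frechet_derivative f
        (at x) v)) (at x)"
      using diff_chain_at[OF Ck_on_Suc_has_derivative[OF assms(1) Suc.prems x]]
      by (fastforce simp: o_def)
  next
    fix v
    show "Ck_on k S (\<lambda>x. a * f x powr (a - 1) * frechet_derivative f (at x) v)"
      using Suc Ck_on_SucD[OF Suc.prems]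
      by (intro Ck_on_bilinear[OF assms(1) bounded_bilinear_mult] Ck_on_const assms Suc.IH) auto
  qed
qed

lemma smooth_on_subset: "smooth_on S f \<Longrightarrow> T \<subseteq> S \<Longrightarrow> smooth_on T f"
  by (auto simp: smooth_on_def intro: Ck_on_subset)

lemma smooth_on_cong: "open S \<Longrightarrow> smooth_on S f \<Longrightarrow> (\<And>x. x \<in> S \<Longrightarrow> f x = g x) \<Longrightarrow> smooth_on S g"
  unfolding smooth_on_def by (metis Ck_on_cong)

lemma smooth_on_const: "open S \<Longrightarrow> smooth_on S (\<lambda>x. c)"
  by (auto simp: smooth_on_def intro: Ck_on_const)

lemma smooth_on_bounded_linear: "open S \<Longrightarrow> bounded_linear h \<Longrightarrow> smooth_on S f \<Longrightarrow>
    smooth_on S (\<lambda>x. h (f x))"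
  by (auto simp: smooth_on_def intro: Ck_on_bounded_linear)

lemma smooth_on_add: "open S \<Longrightarrow> smooth_on S f \<Longrightarrow> smooth_on S g \<Longrightarrow> smooth_on S (\<lambda>x. f x + g x)"
  by (auto simp: smooth_on_def intro: Ck_on_add)

lemma smooth_on_sum: "open S \<Longrightarrow> (\<And>i. i \<in> I \<Longrightarrow> smooth_on S (f i)) \<Longrightarrow> smooth_on S (\<lambda>x. \<Sum>i\<in>I. f i x)"
  by (auto simp: smooth_on_def intro: Ck_on_sum)

lemma smooth_on_bilinear:
  "open S \<Longrightarrow> bounded_bilinear h \<Longrightarrow> smooth_on S f \<Longrightarrow> smooth_on S g \<Longrightarrow> smooth_on S (\<lambda>x. h (f x) (g x))"
  by (auto simp: smooth_on_def intro: Ck_on_bilinear)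

lemmas smooth_on_scaleR = smooth_on_bilinear[OF _ bounded_bilinear_scaleR]
lemmas smooth_on_mult = smooth_on_bilinear[OF _ bounded_bilinear_mult]

lemma smooth_on_uminus: "open S \<Longrightarrow> smooth_on S f \<Longrightarrow> smooth_on S (\<lambda>x. - f x)"
  using smooth_on_bounded_linear[OF _ bounded_linear_minus[OF bounded_linear_ident]] by blast

lemma smooth_on_diff: "open S \<Longrightarrow> smooth_on S f \<Longrightarrow> smooth_on S g \<Longrightarrow> smooth_on S (\<lambda>x. f x - g x)"
  using smooth_on_add[OF _ _ smooth_on_uminus] by simp

lemma smooth_on_inner_left: "open S \<Longrightarrow> smooth_on S f \<Longrightarrow> smooth_on S (\<lambda>x. f x \<bullet> b)"
  using smooth_on_bounded_linear[OF _ bounded_linear_inner_left] .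

lemma smooth_on_compose:
  fixes f :: "'b::euclidean_space \<Rightarrow> 'c::real_normed_vector" and h :: "'a::euclidean_space \<Rightarrow> 'b"
  shows "open S \<Longrightarrow> open T \<Longrightarrow> h ` S \<subseteq> T \<Longrightarrow> smooth_on T f \<Longrightarrow> smooth_on S h \<Longrightarrow> smooth_on S (\<lambda>x. f (h x))"
  unfolding smooth_on_def using Ck_on_compose[of S T h _ f] by blast

lemma smooth_on_powr:
  fixes f :: "'a::euclidean_space \<Rightarrow> real"
  shows "open S \<Longrightarrow> smooth_on S f \<Longrightarrow> (\<And>x. x \<in> S \<Longrightarrow> f x > 0) \<Longrightarrow> smooth_on S (\<lambda>x. f x powr a)"
  unfolding smooth_on_def using Ck_on_powr[of S f] by blast

lemma smooth_on_ident: "open S \<Longrightarrow> smooth_on S (\<lambda>x. x)"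
proof -
  assume S: "open S"
  have "Ck_on k S (\<lambda>x. x)" for k
    by (cases k) (auto simp: S intro: Ck_on_SucI[where f' = "\<lambda>x v. v"] Ck_on_const)
  then show ?thesis by (simp add: smooth_on_def)
qed

lemma smooth_on_fst: "open S \<Longrightarrow> smooth_on S fst"
  using smooth_on_bounded_linear[OF _ bounded_linear_fst smooth_on_ident] .

lemma smooth_on_snd: "open S \<Longrightarrow> smooth_on S snd"
  using smooth_on_bounded_linear[OF _ bounded_linear_snd smooth_on_ident] .

lemma smooth_on_Pair:
  assumes "open S" "smooth_on S f" "smooth_on S g"
  shows "smooth_on S (\<lambda>x. (f x, g x))"
proof -
  have "smooth_on S (\<lambda>x. (f x, 0) + (0, g x))"
    by (intro smooth_on_add smooth_on_bounded_linear[where h = "\<lambda>y. (y, 0)"]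
        smooth_on_bounded_linear[where h = "\<lambda>y. (0, y)"] assms bounded_linear_Pair
        bounded_linear_ident bounded_linear_zero)
  then show ?thesis by simp
qed

lemma smooth_on_frechet_derivative:
  "smooth_on S f \<Longrightarrow> smooth_on S (\<lambda>x. frechet_derivative f (at x) v)"
  unfolding smooth_on_def by (metis Ck_on.simps(2))

lemma smooth_on_has_derivative:
  "open S \<Longrightarrow> smooth_on S f \<Longrightarrow> x \<in> S \<Longrightarrow> (f has_derivative frechet_derivative f (at x)) (at x)"
  using Ck_on_Suc_has_derivative unfolding smooth_on_def by blast

lemma smooth_on_differentiable: "open S \<Longrightarrow> smooth_on S f \<Longrightarrow> x \<in> S \<Longrightarrow> f differentiable at x"
  using smooth_on_has_derivative differentiableI by blast

lemma smooth_on_continuous_on: "smooth_on S f \<Longrightarrow> continuous_on S f"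
  unfolding smooth_on_def by (metis Ck_on.simps(1))

lemma smooth_on_frechet_derivative_apply:
  fixes f :: "'a::euclidean_space \<Rightarrow> 'b::real_normed_vector"
  assumes S: "open S" and f: "smooth_on S f" and h: "smooth_on S h"
  shows "smooth_on S (\<lambda>x. frechet_derivative f (at x) (h x))"
proof (rule smooth_on_cong[OF S])
  show "smooth_on S (\<lambda>x. \<Sum>b\<in>Basis. (h x \<bullet> b) *\<^sub>R frechet_derivative f (at x) b)"
    by (intro smooth_on_sum smooth_on_scaleR smooth_on_inner_left smooth_on_frechet_derivative
        S f h)
qed (use frechet_derivative_sum_Basis[symmetric] smooth_on_differentiable[OF S f] in blast)

lemma has_derivative_frechet_derivative_apply:
  fixes f :: "'a::euclidean_space \<Rightarrow> 'b::real_normed_vector"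
  assumes S: "open S" "x \<in> S" and f: "smooth_on S f" and h: "(h has_derivative h') (at x)"
  shows "((\<lambda>y. frechet_derivative f (at y) (h y)) has_derivative
    (\<lambda>a. frechet_derivative f (at x) (h' a)
      + frechet_derivative (\<lambda>y. frechet_derivative f (at y) (h x)) (at x) a)) (at x)"
proof -
  let ?f = "\<lambda>b y. frechet_derivative f (at y) b"
  have expand: "?f v y = (\<Sum>b\<in>Basis. (v \<bullet> b) *\<^sub>R ?f b y)" if "y \<in> S" for y v
    using frechet_derivative_sum_Basis smooth_on_differentiable[OF S(1) f that] by blast
  have expanded: "((\<lambda>y. ?f (k y) y) has_derivative (\<lambda>a. \<Sum>b\<in>Basis.
      (k x \<bullet> b) *\<^sub>R frechet_derivative (?f b) (at x) a + (k' a \<bullet> b) *\<^sub>R ?f b x)) (at x)"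
    if k: "(k has_derivative k') (at x)" for k k'
  proof (rule has_derivative_transform_within_open[OF _ S])
    show "((\<lambda>y. \<Sum>b\<in>Basis. (k y \<bullet> b) *\<^sub>R ?f b y) has_derivative (\<lambda>a. \<Sum>b\<in>Basis.
        (k x \<bullet> b) *\<^sub>R frechet_derivative (?f b) (at x) a + (k' a \<bullet> b) *\<^sub>R ?f b x)) (at x)"
      by (intro has_derivative_sum has_derivative_scaleR has_derivative_inner_left k
          smooth_on_has_derivative[OF S(1) _ S(2)] smooth_on_frechet_derivative f)
  qed (simp add: expand[symmetric])
  have "frechet_derivative (?f (h x)) (at x)
      = (\<lambda>a. \<Sum>b\<in>Basis. (h x \<bullet> b) *\<^sub>R frechet_derivative (?f b) (at x) a)"
    using frechet_derivative_at[OF expanded[OF has_derivative_const]] by simp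
  then show ?thesis
    using expanded[OF h] by (simp add: sum.distrib expand[OF S(2), symmetric] add.commute)
qed

lemma frechet_derivative_fst:
  fixes f :: "'a::euclidean_space \<Rightarrow> 'c::real_normed_vector" and z :: "'a \<times> 'b::euclidean_space"
  assumes "f differentiable at (fst z)"
  shows "frechet_derivative (\<lambda>z. f (fst z)) (at z) w = frechet_derivative f (at (fst z)) (fst w)"
proof -
  have "((\<lambda>z. f (fst z)) has_derivative (\<lambda>w. frechet_derivative f (at (fst z)) (fst w))) (at z)"
    using diff_chain_at[OF has_derivative_fst[OF has_derivative_ident]
        assms[unfolded frechet_derivative_works]]
    by (simp add: o_def)
  then show ?thesis by (metis frechet_derivative_at)
qed

lemma smooth_on_fst_compose:
  assumes "open S" "smooth_on S f"
  shows "smooth_on (S \<times> (UNIV :: 'b::euclidean_space set)) (\<lambda>z. f (fst z))"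
  using smooth_on_compose[OF _ assms(1) _ assms(2) smooth_on_fst[of "S \<times> UNIV"]] assms(1)
  by (fastforce simp: open_Times)

lemma smooth_on_frechet_derivative_snd:
  fixes f :: "'a::euclidean_space \<Rightarrow> 'b::real_normed_vector"
  assumes "open S" "smooth_on S f"
  shows "smooth_on (S \<times> UNIV) (\<lambda>z. frechet_derivative f (at (fst z)) (snd z))"
proof (rule smooth_on_cong)
  let ?f = "\<lambda>b x. frechet_derivative f (at x) b"
  show S: "open (S \<times> (UNIV :: 'a set))"
    using assms(1) by (simp add: open_Times)
  show "smooth_on (S \<times> (UNIV :: 'a set)) (\<lambda>z. \<Sum>b\<in>Basis. (snd z \<bullet> b) *\<^sub>R ?f b (fst z))"
    by (intro smooth_on_sum smooth_on_scaleR smooth_on_inner_left smooth_on_snd S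
        smooth_on_fst_compose smooth_on_frechet_derivative assms)
  show "(\<Sum>b\<in>Basis. (snd z \<bullet> b) *\<^sub>R ?f b (fst z)) = ?f (snd z) (fst z)" if "z \<in> S \<times> UNIV" for z
    using that smooth_on_differentiable[OF assms, of "fst z"]
    by (simp add: mem_Times_iff frechet_derivative_sum_Basis[of f "fst z" "snd z"])
qed

lemma has_derivative_frechet_derivative_snd:
  fixes f :: "'a::euclidean_space \<Rightarrow> 'b::real_normed_vector"
  assumes "open S" "x \<in> S" "smooth_on S f"
  shows "((\<lambda>z. frechet_derivative f (at (fst z)) (snd z)) has_derivative
    (\<lambda>w. frechet_derivative f (at x) (snd w)
      + frechet_derivative (\<lambda>y. frechet_derivative f (at y) v) (at x) (fst w))) (at (x, v))"
proof -
  let ?f = "\<lambda>z :: 'a \<times> 'a. f (fst z)" and ?T = "S \<times> (UNIV :: 'a set)"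
  have T: "open ?T" "(x, v) \<in> ?T"
    using assms by (simp_all add: open_Times)
  have derivative_fst: "frechet_derivative ?f (at z) w = frechet_derivative f (at (fst z)) (fst w)"
    if "z \<in> ?T" for z w
    using that by (intro frechet_derivative_fst smooth_on_differentiable[OF assms(1,3)]) auto
  have "((\<lambda>z. frechet_derivative ?f (at z) (snd z, 0)) has_derivative
      (\<lambda>w. frechet_derivative ?f (at (x, v)) (snd w, 0)
        + frechet_derivative (\<lambda>z. frechet_derivative ?f (at z) (snd (x, v), 0)) (at (x, v)) w))
      (at (x, v))"
    by (intro has_derivative_frechet_derivative_apply[OF T] smooth_on_fst_compose assms
        has_derivative_Pair has_derivative_snd has_derivative_ident has_derivative_const)
  then have "((\<lambda>z. frechet_derivative f (at (fst z)) (snd z)) has_derivative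
      (\<lambda>w. frechet_derivative ?f (at (x, v)) (snd w, 0)
        + frechet_derivative (\<lambda>z. frechet_derivative ?f (at z) (snd (x, v), 0)) (at (x, v)) w))
      (at (x, v))"
    by (rule has_derivative_transform_within_open[OF _ T]) (simp only: derivative_fst fst_conv)
  moreover have "frechet_derivative (\<lambda>z. frechet_derivative ?f (at z) (v, 0)) (at (x, v)) w
      = frechet_derivative (\<lambda>y. frechet_derivative f (at y) v) (at x) (fst w)" for w
  proof -
    have "frechet_derivative (\<lambda>z. frechet_derivative ?f (at z) (v, 0)) (at (x, v))
        = frechet_derivative (\<lambda>z :: 'a \<times> 'a. frechet_derivative f (at (fst z)) v) (at (x, v))"
      by (rule frechet_derivative_cong_open[OF T]) (simp only: derivative_fst fst_conv)
    then show ?thesis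
      using frechet_derivative_fst[of "\<lambda>y. frechet_derivative f (at y) v" "(x, v)" w]
        smooth_on_differentiable[OF assms(1) smooth_on_frechet_derivative[OF assms(3)] assms(2)]
      by simp
  qed
  ultimately show ?thesis
    by (simp only: derivative_fst[OF T(2)] fst_conv snd_conv)
qed

lemma second_difference_mean_value:
  fixes f :: "'a::euclidean_space \<Rightarrow> real"
  assumes S: "open S" and f: "smooth_on S f" and h: "h > 0"
    and in_S: "\<And>s t. 0 \<le> s \<Longrightarrow> s \<le> h \<Longrightarrow> 0 \<le> t \<Longrightarrow> t \<le> h \<Longrightarrow> x + s *\<^sub>R v + t *\<^sub>R w \<in> S"
  shows "\<exists>s t. s \<in> {0<..<h} \<and> t \<in> {0<..<h} \<and>
    f (x + h *\<^sub>R v + h *\<^sub>R w) - f (x + h *\<^sub>R v) - f (x + h *\<^sub>R w) + f x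
    = h * h * frechet_derivative (\<lambda>x. frechet_derivative f (at x) v) (at (x + s *\<^sub>R v + t *\<^sub>R w)) w"
proof -
  let ?p = "\<lambda>s t. x + s *\<^sub>R v + t *\<^sub>R w"
  define fv where "fv = (\<lambda>x. frechet_derivative f (at x) v)"
  have along: "((\<lambda>r. F (c r)) has_real_derivative frechet_derivative F (at (c r)) u) (at r)"
    if "smooth_on S F" "c r \<in> S" "(c has_vector_derivative u) (at r)" for F c r u
    using vector_derivative_diff_chain_within[of c u r UNIV F, OF that(3)
        has_derivative_at_withinI[OF smooth_on_has_derivative[OF S that(1,2)]]]
    by (simp add: has_real_derivative_iff_has_vector_derivative o_def)
  have deriv_s: "((\<lambda>s. f (?p s t)) has_real_derivative fv (?p s t)) (at s)"
    and deriv_t: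
      "((\<lambda>t. fv (?p s t)) has_real_derivative frechet_derivative fv (at (?p s t)) w) (at t)"
    if "0 \<le> s" "s \<le> h" "0 \<le> t" "t \<le> h" for s t
    unfolding fv_def
  proof -
    have "((\<lambda>s. ?p s t) has_vector_derivative v) (at s)"
      "((\<lambda>t. ?p s t) has_vector_derivative w) (at t)"
      by (auto intro!: derivative_eq_intros)
    then show "((\<lambda>s. f (?p s t)) has_real_derivative frechet_derivative f (at (?p s t)) v) (at s)"
      "((\<lambda>t. frechet_derivative f (at (?p s t)) v) has_real_derivative
        frechet_derivative (\<lambda>x. frechet_derivative f (at x) v) (at (?p s t)) w) (at t)"
      using along[of f "\<lambda>s. ?p s t"] along[of _ "\<lambda>t. ?p s t"] in_S[OF that] f
        smooth_on_frechet_derivative by blast+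
  qed
  have "\<exists>s>0. s < h \<and> (f (?p h h) - f (?p h 0)) - (f (?p 0 h) - f (?p 0 0))
      = (h - 0) * (fv (?p s h) - fv (?p s 0))"
    using h by (intro MVT2 DERIV_diff deriv_s) auto
  then obtain s where s: "0 < s" "s < h"
    "f (?p h h) - f (?p h 0) - f (?p 0 h) + f (?p 0 0) = h * (fv (?p s h) - fv (?p s 0))"
    by (auto simp: algebra_simps)
  have "\<exists>t>0. t < h \<and> fv (?p s h) - fv (?p s 0) = (h - 0) * frechet_derivative fv (at (?p s t)) w"
    using h s by (intro MVT2 deriv_t) auto
  then show ?thesis
    using s unfolding fv_def by (force simp: mult.assoc)
qed

lemma eventually_parallelogram_subset_open:
  fixes v w :: "'a::real_normed_vector"
  assumes "open S" "x \<in> S"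
  shows "\<forall>\<^sub>F h in at_right 0. \<forall>s\<in>{0..h}. \<forall>t\<in>{0..h}. x + s *\<^sub>R v + t *\<^sub>R w \<in> S"
proof -
  obtain d where d: "d > 0" "ball x d \<subseteq> S"
    using assms open_contains_ball by blast
  have "\<forall>\<^sub>F h in at_right 0. h * norm v + h * norm w < d"
    by (rule order_tendstoD(2)[OF _ d(1)]) (auto intro!: tendsto_eq_intros)
  then show ?thesis
  proof eventually_elim
    case (elim h)
    show ?case
    proof (intro ballI)
      fix s t assume "s \<in> {0..h}" "t \<in> {0..h}"
      then have "norm (s *\<^sub>R v) \<le> h * norm v" "norm (t *\<^sub>R w) \<le> h * norm w"
        by (simp_all add: mult_right_mono)
      then have "norm (s *\<^sub>R v + t *\<^sub>R w) < d"
        using norm_triangle_ineq[of "s *\<^sub>R v" "t *\<^sub>R w"] elim by linarith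
      then have "x + s *\<^sub>R v + t *\<^sub>R w \<in> ball x d"
        by (metis add.assoc add_diff_cancel_left' dist_norm dist_commute mem_ball)
      then show "x + s *\<^sub>R v + t *\<^sub>R w \<in> S"
        using d(2) by blast
    qed
  qed
qed

lemma second_difference_tendsto:
  fixes f :: "'a::euclidean_space \<Rightarrow> real"
  assumes S: "open S" and f: "smooth_on S f" and x: "x \<in> S"
  shows "((\<lambda>h. (f (x + h *\<^sub>R v + h *\<^sub>R w) - f (x + h *\<^sub>R v) - f (x + h *\<^sub>R w) + f x) / (h * h))
    \<longlongrightarrow> frechet_derivative (\<lambda>x. frechet_derivative f (at x) v) (at x) w) (at_right 0)"
proof -
  let ?D = "\<lambda>h. (f (x + h *\<^sub>R v + h *\<^sub>R w) - f (x + h *\<^sub>R v) - f (x + h *\<^sub>R w) + f x) / (h * h)"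
  define H where "H = (\<lambda>y. frechet_derivative (\<lambda>x. frechet_derivative f (at x) v) (at y) w)"
  have "\<forall>\<^sub>F h in at_right 0. \<exists>s t. s \<in> {0<..<h} \<and> t \<in> {0<..<h} \<and> ?D h = H (x + s *\<^sub>R v + t *\<^sub>R w)"
    using eventually_parallelogram_subset_open[OF S x, of v w] eventually_at_right_less[of 0]
  proof eventually_elim
    case (elim h)
    then show ?case
      using second_difference_mean_value[OF S f, of h x v w] by (fastforce simp: H_def)
  qed
  then obtain s t where st: "\<forall>\<^sub>F h in at_right 0.
      s h \<in> {0<..<h} \<and> t h \<in> {0<..<h} \<and> ?D h = H (x + s h *\<^sub>R v + t h *\<^sub>R w)"
    unfolding eventually_ex by blast
  have "(s \<longlongrightarrow> 0) (at_right 0)" "(t \<longlongrightarrow> 0) (at_right 0)"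
    by (rule tendsto_sandwich[of "\<lambda>_. 0" _ _ "\<lambda>h. h"];
        use st in \<open>auto elim: eventually_mono intro: tendsto_eq_intros\<close>)+
  then have "((\<lambda>h. x + s h *\<^sub>R v + t h *\<^sub>R w) \<longlongrightarrow> x) (at_right 0)"
    by (auto intro!: tendsto_eq_intros)
  moreover have "isCont H x"
    unfolding H_def
    by (rule continuous_on_interior[OF smooth_on_continuous_on])
      (use S x in \<open>auto intro!: smooth_on_frechet_derivative f simp: interior_open\<close>)
  ultimately have "((\<lambda>h. H (x + s h *\<^sub>R v + t h *\<^sub>R w)) \<longlongrightarrow> H x) (at_right 0)"
    using isCont_tendsto_compose by blast
  then have "(?D \<longlongrightarrow> H x) (at_right 0)"
    by (rule Lim_transform_eventually) (use st in \<open>auto elim: eventually_mono\<close>)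
  then show ?thesis by (simp add: H_def)
qed

theorem symmetric_second_derivative:
  fixes f :: "'a::euclidean_space \<Rightarrow> 'b::euclidean_space"
  assumes S: "open S" "x \<in> S" and f: "smooth_on S f"
  shows "frechet_derivative (\<lambda>x. frechet_derivative f (at x) v) (at x) w
       = frechet_derivative (\<lambda>x. frechet_derivative f (at x) w) (at x) v"
proof (rule euclidean_eqI)
  fix b :: 'b
  have inner: "frechet_derivative (\<lambda>x. F x \<bullet> b) (at y) u = frechet_derivative F (at y) u \<bullet> b"
    if "smooth_on S F" "y \<in> S" for F :: "'a \<Rightarrow> 'b" and y u
    using frechet_derivative_at[OF has_derivative_inner_left[OF
          smooth_on_has_derivative[OF S(1) that]], of b, symmetric] by simp
  have second: "frechet_derivative (\<lambda>x. frechet_derivative (\<lambda>x. f x \<bullet> b) (at x) v) (at x) w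
      = frechet_derivative (\<lambda>x. frechet_derivative f (at x) v) (at x) w \<bullet> b" for v w
  proof -
    have "frechet_derivative (\<lambda>x. frechet_derivative (\<lambda>x. f x \<bullet> b) (at x) v) (at x)
        = frechet_derivative (\<lambda>x. frechet_derivative f (at x) v \<bullet> b) (at x)"
      by (rule frechet_derivative_cong_open[OF S]) (rule inner[OF f])
    then show ?thesis
      by (simp only: inner[OF smooth_on_frechet_derivative[OF f] S(2)])
  qed
  have limit: "((\<lambda>h. (f (x + h *\<^sub>R v + h *\<^sub>R w) \<bullet> b - f (x + h *\<^sub>R v) \<bullet> b - f (x + h *\<^sub>R w) \<bullet> b
      + f x \<bullet> b) / (h * h)) \<longlongrightarrow> frechet_derivative (\<lambda>x. frechet_derivative f (at x) v) (at x) w \<bullet> b)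
      (at_right 0)" for v w
    using second_difference_tendsto[OF S(1) smooth_on_inner_left[OF S(1) f, of b] S(2), of v w]
    unfolding second .
  have "f (x + h *\<^sub>R w + h *\<^sub>R v) \<bullet> b - f (x + h *\<^sub>R w) \<bullet> b - f (x + h *\<^sub>R v) \<bullet> b + f x \<bullet> b
      = f (x + h *\<^sub>R v + h *\<^sub>R w) \<bullet> b - f (x + h *\<^sub>R v) \<bullet> b - f (x + h *\<^sub>R w) \<bullet> b + f x \<bullet> b" for h
    by (simp add: add.assoc add.commute[of "h *\<^sub>R w"])
  with limit[of v w] limit[of w v] show
    "frechet_derivative (\<lambda>x. frechet_derivative f (at x) v) (at x) w \<bullet> b
      = frechet_derivative (\<lambda>x. frechet_derivative f (at x) w) (at x) v \<bullet> b"
    using tendsto_unique[OF trivial_limit_at_right_real] by simp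
qed

section \<open>Tangent vectors\<close>

lemma sum_fun_apply [simp]: "(\<Sum>k\<in>K. f k) x = (\<Sum>k\<in>K. f k x)"
  by (induction K rule: infinite_finite_induct) auto

lemma vscale_apply [simp]: "(a \<cdot> v) i = a *\<^sub>R v i"
  by (simp add: vscale_def)

lemma vscale_simps [simp]:
  fixes v :: "'i \<Rightarrow> 'e::real_vector"
  shows "1 \<cdot> v = v" "0 \<cdot> v = 0" "a \<cdot> (0 :: 'i \<Rightarrow> 'e) = 0" "a \<cdot> b \<cdot> v = (a * b) \<cdot> v" "(- 1) \<cdot> v = - v"
    "a \<cdot> (- v) = (- a) \<cdot> v"
  by (auto simp: fun_eq_iff)

lemma vscale_add_right: "a \<cdot> (v + w) = a \<cdot> v + a \<cdot> w"
  and vscale_diff_right: "a \<cdot> (v - w) = a \<cdot> v - a \<cdot> w"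
  and vscale_minus_left: "(- a) \<cdot> v = - (a \<cdot> v)"
  by (auto simp: fun_eq_iff algebra_simps)

locale smooth_atlas =
  fixes M :: "('i, 'm, 'e::euclidean_space) atlas"
  assumes inj_chart: "i \<in> idx M \<Longrightarrow> inj_on (chart M i) (cdom M i)"
    and open_overlap: "i \<in> idx M \<Longrightarrow> j \<in> idx M \<Longrightarrow> open (chart M i ` (cdom M i \<inter> cdom M j))"
    and smooth_transition: "i \<in> idx M \<Longrightarrow> j \<in> idx M \<Longrightarrow>
      smooth_on (chart M i ` (cdom M i \<inter> cdom M j)) (transition M i j)"
begin

lemma charts_at_iff: "i \<in> charts_at M p \<longleftrightarrow> i \<in> idx M \<and> p \<in> cdom M i"
  by (simp add: charts_at_def)

lemma param_chart [simp]: "i \<in> idx M \<Longrightarrow> p \<in> cdom M i \<Longrightarrow> param M i (chart M i p) = p"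
  by (simp add: param_def inv_into_f_f inj_chart)

lemma transition_chart [simp]:
  "i \<in> idx M \<Longrightarrow> p \<in> cdom M i \<Longrightarrow> transition M i j (chart M i p) = chart M j p"
  by (simp add: transition_def)

lemma mopen_imp_open: "mopen M U \<Longrightarrow> i \<in> idx M \<Longrightarrow> open (chart M i ` (U \<inter> cdom M i))"
  by (simp add: mopen_def)

lemma mopen_cdom: "i \<in> idx M \<Longrightarrow> mopen M (cdom M i)"
  using open_overlap by (auto simp: mopen_def carrier_of_def Int_commute)

lemma mopen_carrier: "mopen M U \<Longrightarrow> U \<subseteq> carrier_of M"
  by (simp add: mopen_def)

lemma carrier_of_mopen: "mopen M U \<Longrightarrow> p \<in> U \<Longrightarrow> p \<in> carrier_of M"
  using mopen_carrier by blast

lemma carrier_chart: "p \<in> carrier_of M \<Longrightarrow> \<exists>i. i \<in> charts_at M p"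
  by (auto simp: carrier_of_def charts_at_def)

lemma mopen_Int:
  assumes "mopen M U" "mopen M V"
  shows "mopen M (U \<inter> V)"
proof -
  have "chart M i ` (U \<inter> V \<inter> cdom M i) = chart M i ` (U \<inter> cdom M i) \<inter> chart M i ` (V \<inter> cdom M i)"
    if "i \<in> idx M" for i
    using inj_on_image_Int[OF inj_chart[OF that], of "U \<inter> cdom M i" "V \<inter> cdom M i"]
    by (simp add: Int_ac)
  then show ?thesis
    using assms by (auto simp: mopen_def)
qed

lemma has_derivative_transition:
  assumes "i \<in> charts_at M p" "j \<in> charts_at M p"
  shows "(transition M i j has_derivative dtrans M i j p) (at (chart M i p))"
  unfolding dtrans_def
  by (rule smooth_on_has_derivative[OF open_overlap smooth_transition])
    (use assms in \<open>auto simp: charts_at_iff\<close>)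

lemma linear_dtrans: "i \<in> charts_at M p \<Longrightarrow> j \<in> charts_at M p \<Longrightarrow> linear (dtrans M i j p)"
  using has_derivative_transition has_derivative_linear by blast

lemma dtrans_comp:
  assumes "i \<in> charts_at M p" "j \<in> charts_at M p" "k \<in> charts_at M p"
  shows "dtrans M j k p (dtrans M i j p v) = dtrans M i k p v"
proof -
  let ?U = "cdom M j \<inter> cdom M k"
  have i: "i \<in> idx M" "p \<in> cdom M i" and U: "mopen M ?U" "p \<in> ?U"
    using assms by (auto simp: charts_at_iff mopen_Int mopen_cdom)
  have "(transition M j k \<circ> transition M i j has_derivative dtrans M j k p \<circ> dtrans M i j p)
      (at (chart M i p))"
    using has_derivative_transition[OF assms(1,2)] has_derivative_transition[OF assms(2,3)] i
    by (intro diff_chain_at) auto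
  then have "(transition M i k has_derivative dtrans M j k p \<circ> dtrans M i j p) (at (chart M i p))"
    by (rule has_derivative_transform_within_open[OF _ mopen_imp_open[OF U(1) i(1)]])
      (use i U assms in \<open>auto simp: charts_at_iff\<close>)
  then show ?thesis
    using has_derivative_unique[OF _ has_derivative_transition[OF assms(1,3)]] by (metis comp_apply)
qed

lemma dtrans_self: "i \<in> charts_at M p \<Longrightarrow> dtrans M i i p v = v"
proof -
  assume i: "i \<in> charts_at M p"
  have "(transition M i i has_derivative (\<lambda>v. v)) (at (chart M i p))"
    by (rule has_derivative_transform_within_open[OF has_derivative_ident open_overlap[of i i]])
      (use i in \<open>auto simp: charts_at_iff\<close>)
  then show ?thesis
    using has_derivative_unique[OF _ has_derivative_transition[OF i i]] by metis
qed

lemma tangentI: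
  "(\<And>i j. i \<in> charts_at M p \<Longrightarrow> j \<in> charts_at M p \<Longrightarrow> dtrans M i j p (v i) = v j) \<Longrightarrow>
   (\<And>i. i \<notin> charts_at M p \<Longrightarrow> v i = 0) \<Longrightarrow> v \<in> tangent_space M p"
  unfolding tangent_space_def by (intro CollectI conjI ballI allI impI) simp_all

lemma tangent_transform:
  "v \<in> tangent_space M p \<Longrightarrow> i \<in> charts_at M p \<Longrightarrow> j \<in> charts_at M p \<Longrightarrow> dtrans M i j p (v i) = v j"
  unfolding tangent_space_def by (drule CollectD, rule sym, blast)

lemma tangent_outside: "v \<in> tangent_space M p \<Longrightarrow> i \<notin> charts_at M p \<Longrightarrow> v i = 0"
  by (simp add: tangent_space_def)

lemma tangent_zero [simp]: "0 \<in> tangent_space M p"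
  by (rule tangentI) (auto simp: linear_0[OF linear_dtrans])

lemma tangent_add [simp]:
  "u \<in> tangent_space M p \<Longrightarrow> v \<in> tangent_space M p \<Longrightarrow> u + v \<in> tangent_space M p"
  by (rule tangentI) (auto simp: linear_add[OF linear_dtrans] tangent_transform tangent_outside)

lemma tangent_scale [simp]: "v \<in> tangent_space M p \<Longrightarrow> a \<cdot> v \<in> tangent_space M p"
  by (rule tangentI) (auto simp: linear_scale[OF linear_dtrans] tangent_transform tangent_outside)

lemma tangent_uminus [simp]: "v \<in> tangent_space M p \<Longrightarrow> - v \<in> tangent_space M p"
  using tangent_scale[of v p "- 1"] by simp

lemma tangent_diff [simp]:
  "u \<in> tangent_space M p \<Longrightarrow> v \<in> tangent_space M p \<Longrightarrow> u - v \<in> tangent_space M p"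
  using tangent_add[of u p "- v"] by simp

lemma tangent_sum [simp]:
  "(\<And>k. k \<in> K \<Longrightarrow> v k \<in> tangent_space M p) \<Longrightarrow> (\<Sum>k\<in>K. v k) \<in> tangent_space M p"
  by (induction K rule: infinite_finite_induct) auto

lemma tangent_eqI:
  assumes "u \<in> tangent_space M p" "v \<in> tangent_space M p" "i \<in> charts_at M p" "u i = v i"
  shows "u = v"
proof
  fix j show "u j = v j"
    using assms tangent_transform[of _ p i j] tangent_outside[of _ p j]
    by (cases "j \<in> charts_at M p") metis+
qed

lemma const_field_tangent [simp]: "const_field M i a p \<in> tangent_space M p"
  by (rule tangentI) (auto simp: const_field_def dtrans_comp linear_0[OF linear_dtrans])

lemma const_field_apply: "i \<in> charts_at M p \<Longrightarrow> const_field M i a p i = a"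
  by (simp add: const_field_def dtrans_self)

lemma const_field_add: "const_field M i (a + b) = const_field M i a + const_field M i b"
  using linear_add[OF linear_dtrans] by (fastforce simp: const_field_def fun_eq_iff)

lemma const_field_scale: "const_field M i (r *\<^sub>R a) = (\<lambda>p. r \<cdot> const_field M i a p)"
  using linear_scale[OF linear_dtrans] by (fastforce simp: const_field_def fun_eq_iff)

lemma tangent_eq_const_field:
  "u \<in> tangent_space M p \<Longrightarrow> i \<in> charts_at M p \<Longrightarrow> u = const_field M i (u i) p"
  by (rule tangent_eqI) (auto simp: const_field_apply)

lemma tangent_expand:
  assumes "u \<in> tangent_space M p" "i \<in> charts_at M p"
  shows "u = (\<Sum>b\<in>Basis. (u i \<bullet> b) \<cdot> const_field M i b p)"
  by (rule tangent_eqI[OF _ _ assms(2)])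
    (use assms in \<open>auto simp: const_field_apply euclidean_representation\<close>)

section \<open>Smooth functions and vector fields\<close>

lemma smooth_funI:
  "(\<And>i. i \<in> idx M \<Longrightarrow> smooth_on (chart M i ` (U \<inter> cdom M i)) (\<lambda>x. f (param M i x))) \<Longrightarrow>
      smooth_fun M U f"
  by (simp add: smooth_fun_def o_def)

lemma smooth_funD:
  "smooth_fun M U f \<Longrightarrow> i \<in> idx M \<Longrightarrow> smooth_on (chart M i ` (U \<inter> cdom M i)) (\<lambda>x. f (param M i x))"
  by (simp add: smooth_fun_def o_def)

lemma smooth_fun_const: "mopen M U \<Longrightarrow> smooth_fun M U (\<lambda>p. c)"
  by (rule smooth_funI) (intro smooth_on_const mopen_imp_open)

lemma smooth_fun_add:
  "mopen M U \<Longrightarrow> smooth_fun M U f \<Longrightarrow> smooth_fun M U h \<Longrightarrow> smooth_fun M U (\<lambda>p. f p + h p)"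
  by (rule smooth_funI) (intro smooth_on_add mopen_imp_open smooth_funD)

lemma smooth_fun_mult:
  "mopen M U \<Longrightarrow> smooth_fun M U f \<Longrightarrow> smooth_fun M U h \<Longrightarrow> smooth_fun M U (\<lambda>p. f p * h p)"
  by (rule smooth_funI) (intro smooth_on_mult mopen_imp_open smooth_funD)

lemma smooth_fun_uminus: "mopen M U \<Longrightarrow> smooth_fun M U f \<Longrightarrow> smooth_fun M U (\<lambda>p. - f p)"
  by (rule smooth_funI) (intro smooth_on_uminus mopen_imp_open smooth_funD)

lemma smooth_fun_sum:
  "mopen M U \<Longrightarrow> (\<And>k. k \<in> K \<Longrightarrow> smooth_fun M U (f k)) \<Longrightarrow> smooth_fun M U (\<lambda>p. \<Sum>k\<in>K. f k p)"
  by (rule smooth_funI) (intro smooth_on_sum mopen_imp_open smooth_funD)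

lemma smooth_fun_powr:
  assumes "mopen M U" "smooth_fun M U f" "\<And>p. p \<in> U \<Longrightarrow> f p > 0"
  shows "smooth_fun M U (\<lambda>p. f p powr a)"
  by (rule smooth_funI, rule smooth_on_powr[OF mopen_imp_open smooth_funD])
    (use assms in auto)

lemma transition_image:
  assumes "i \<in> idx M" "j \<in> idx M" "U \<subseteq> cdom M i"
  shows "transition M j i ` (chart M j ` (U \<inter> cdom M j)) \<subseteq> chart M i ` (U \<inter> cdom M i)"
  using assms by auto

lemma smooth_transition_subset:
  assumes "i \<in> idx M" "j \<in> idx M" "U \<subseteq> cdom M i"
  shows "smooth_on (chart M j ` (U \<inter> cdom M j)) (transition M j i)"
  by (rule smooth_on_subset[OF smooth_transition]) (use assms in auto)

lemma smooth_on_change_chart: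
  assumes "mopen M U" "i \<in> idx M" "j \<in> idx M" "U \<subseteq> cdom M i"
    and "smooth_on (chart M i ` (U \<inter> cdom M i)) F"
  shows "smooth_on (chart M j ` (U \<inter> cdom M j)) (\<lambda>x. F (transition M j i x))"
  by (rule smooth_on_compose[OF mopen_imp_open mopen_imp_open transition_image assms(5)
        smooth_transition_subset]) (use assms in auto)

lemma smooth_fun_single_chart:
  assumes "mopen M U" "i \<in> idx M" "U \<subseteq> cdom M i"
    and "smooth_on (chart M i ` (U \<inter> cdom M i)) (\<lambda>x. f (param M i x))"
  shows "smooth_fun M U f"
proof (rule smooth_funI)
  fix j assume j: "j \<in> idx M"
  show "smooth_on (chart M j ` (U \<inter> cdom M j)) (\<lambda>x. f (param M j x))"
    by (rule smooth_on_cong[OF mopen_imp_open[OF assms(1) j]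
          smooth_on_change_chart[OF assms(1,2) j assms(3,4)]])
      (use assms j in auto)
qed

lemma vector_fieldI:
  "(\<And>p. p \<in> U \<Longrightarrow> X p \<in> tangent_space M p) \<Longrightarrow>
   (\<And>i. i \<in> idx M \<Longrightarrow> smooth_on (chart M i ` (U \<inter> cdom M i)) (\<lambda>x. X (param M i x) i)) \<Longrightarrow>
   vector_field M U X"
  by (simp add: vector_field_def)

lemma vector_field_tangent: "vector_field M U X \<Longrightarrow> p \<in> U \<Longrightarrow> X p \<in> tangent_space M p"
  by (simp add: vector_field_def)

lemma vector_field_smooth:
  "vector_field M U X \<Longrightarrow> i \<in> idx M \<Longrightarrow>
    smooth_on (chart M i ` (U \<inter> cdom M i)) (\<lambda>x. X (param M i x) i)"
  by (simp add: vector_field_def)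

lemma vector_field_subset: "vector_field M U X \<Longrightarrow> V \<subseteq> U \<Longrightarrow> vector_field M V X"
  by (rule vector_fieldI, blast dest: vector_field_tangent, rule smooth_on_subset[OF
      vector_field_smooth]) auto

lemma vector_field_add:
  assumes "mopen M U" "vector_field M U X" "vector_field M U Y"
  shows "vector_field M U (X + Y)"
proof (rule vector_fieldI)
  fix i assume i: "i \<in> idx M"
  show "smooth_on (chart M i ` (U \<inter> cdom M i)) (\<lambda>x. (X + Y) (param M i x) i)"
    using smooth_on_add[OF mopen_imp_open vector_field_smooth vector_field_smooth] assms i by simp
qed (use assms in \<open>auto simp: vector_field_tangent\<close>)

lemma vector_field_scale:
  assumes "mopen M U" "smooth_fun M U f" "vector_field M U X"
  shows "vector_field M U (\<lambda>p. f p \<cdot> X p)"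
proof (rule vector_fieldI)
  fix i assume i: "i \<in> idx M"
  show "smooth_on (chart M i ` (U \<inter> cdom M i)) (\<lambda>x. (f (param M i x) \<cdot> X (param M i x)) i)"
    using smooth_on_scaleR[OF mopen_imp_open smooth_funD vector_field_smooth] assms i by simp
qed (use assms in \<open>auto simp: vector_field_tangent\<close>)

lemma vector_field_zero: "mopen M U \<Longrightarrow> vector_field M U 0"
  by (rule vector_fieldI) (auto intro: smooth_on_const mopen_imp_open)

lemma vector_field_uminus:
  assumes "mopen M U" "vector_field M U X"
  shows "vector_field M U (- X)"
  using vector_field_scale[OF assms(1) smooth_fun_const[OF assms(1), of "- 1"] assms(2)]
  by (simp add: fun_Compl_def)

lemma vector_field_diff:
  assumes "mopen M U" "vector_field M U X" "vector_field M U Y"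
  shows "vector_field M U (X - Y)"
  using vector_field_add[OF assms(1,2) vector_field_uminus[OF assms(1,3)]] by simp

lemma vector_field_sum:
  assumes "mopen M U" "\<And>k. k \<in> K \<Longrightarrow> vector_field M U (X k)"
  shows "vector_field M U (\<Sum>k\<in>K. X k)"
  using assms(2)
  by (induction K rule: infinite_finite_induct)
      (auto intro: vector_field_zero vector_field_add assms(1))

lemma vector_field_single_chart:
  assumes U: "mopen M U" "U \<subseteq> cdom M i" and i: "i \<in> idx M"
    and X: "\<And>p. p \<in> U \<Longrightarrow> X p \<in> tangent_space M p"
      "smooth_on (chart M i ` (U \<inter> cdom M i)) (\<lambda>x. X (param M i x) i)"
  shows "vector_field M U X"
proof (rule vector_fieldI[OF X(1)])
  fix j assume j: "j \<in> idx M"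
  let ?S = "chart M i ` (U \<inter> cdom M i \<inter> cdom M j)"
  let ?V = "U \<inter> cdom M j"
  have V: "mopen M ?V" "?V \<subseteq> cdom M i"
    using U j by (auto intro: mopen_Int mopen_cdom)
  have S: "open (chart M i ` (?V \<inter> cdom M i))"
    by (rule mopen_imp_open[OF V(1) i])
  have "smooth_on (chart M i ` (?V \<inter> cdom M i))
      (\<lambda>x. frechet_derivative (transition M i j) (at x) (X (param M i x) i))"
    by (intro smooth_on_frechet_derivative_apply[OF S]
        smooth_on_subset[OF smooth_transition[OF i j]]
        smooth_on_subset[OF X(2)]) auto
  from smooth_on_change_chart[OF V(1) i j V(2) this]
  have *: "smooth_on (chart M j ` (U \<inter> cdom M j)) (\<lambda>x. frechet_derivative (transition M i j)
      (at (transition M j i x)) (X (param M i (transition M j i x)) i))"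
    by (simp add: Int_ac)
  show "smooth_on (chart M j ` (U \<inter> cdom M j)) (\<lambda>x. X (param M j x) j)"
  proof (rule smooth_on_cong[OF mopen_imp_open[OF U(1) j] *])
    fix x assume "x \<in> chart M j ` (U \<inter> cdom M j)"
    then obtain p where p: "x = chart M j p" "p \<in> U" "p \<in> cdom M j" by blast
    have "dtrans M i j p (X p i) = X p j"
      using tangent_transform[OF X(1)[OF p(2)]] p U i j by (auto simp: charts_at_iff)
    then show "frechet_derivative (transition M i j)
      (at (transition M j i x)) (X (param M i (transition M j i x)) i) = X (param M j x) j"
      using p U i j by (auto simp: dtrans_def)
  qed
qed

lemma vector_field_const_field:
  assumes "mopen M U" "U \<subseteq> cdom M i" "i \<in> idx M"
  shows "vector_field M U (const_field M i a)"
proof (rule vector_field_single_chart[OF assms const_field_tangent])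
  show "smooth_on (chart M i ` (U \<inter> cdom M i)) (\<lambda>x. const_field M i a (param M i x) i)"
    by (rule smooth_on_cong[OF mopen_imp_open[OF assms(1,3)] smooth_on_const[of _ a]])
      (use assms in \<open>auto simp: const_field_apply charts_at_iff mopen_imp_open\<close>)
qed

lemma smooth_fun_component:
  assumes "mopen M U" "U \<subseteq> cdom M i" "i \<in> idx M" "vector_field M U X"
  shows "smooth_fun M U (\<lambda>p. X p i \<bullet> b)"
  by (rule smooth_fun_single_chart[OF assms(1,3,2)])
    (use assms in \<open>auto intro!: smooth_on_inner_left vector_field_smooth mopen_imp_open\<close>)

lemma vector_field_expand:
  assumes "p \<in> U" "U \<subseteq> cdom M i" "i \<in> idx M" "vector_field M U X"
  shows "X p = (\<Sum>b\<in>Basis. (X p i \<bullet> b) \<cdot> const_field M i b p)"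
  using tangent_expand[of "X p" p i] assms by (auto simp: vector_field_tangent charts_at_iff)

section \<open>Directional derivatives and Lie brackets\<close>

lemma some_chart: "i \<in> charts_at M p \<Longrightarrow> (SOME i. i \<in> charts_at M p) \<in> charts_at M p"
  by (metis someI)

lemma smooth_fun_has_derivative:
  assumes "mopen M U" "p \<in> U" "smooth_fun M U f" "i \<in> charts_at M p"
  shows "((\<lambda>x. f (param M i x)) has_derivative
    frechet_derivative (\<lambda>x. f (param M i x)) (at (chart M i p))) (at (chart M i p))"
  using assms
  by (intro smooth_on_has_derivative[OF mopen_imp_open smooth_funD]) (auto simp: charts_at_iff)

lemma vector_field_has_derivative:
  assumes "mopen M U" "p \<in> U" "vector_field M U X" "i \<in> charts_at M p"
  shows "((\<lambda>x. X (param M i x) i) has_derivative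
    frechet_derivative (\<lambda>x. X (param M i x) i) (at (chart M i p))) (at (chart M i p))"
  using assms
  by (intro smooth_on_has_derivative[OF mopen_imp_open vector_field_smooth])
    (auto simp: charts_at_iff)

lemma dir_deriv_chart:
  assumes U: "mopen M U" "p \<in> U" and f: "smooth_fun M U f" and X: "X p \<in> tangent_space M p"
    and i: "i \<in> charts_at M p"
  shows "dir_deriv M X f p = frechet_derivative (\<lambda>x. f (param M i x)) (at (chart M i p)) (X p i)"
proof -
  define j where "j = (SOME i. i \<in> charts_at M p)"
  have j: "j \<in> charts_at M p"
    unfolding j_def by (rule some_chart[OF i])
  let ?f = "\<lambda>i x. f (param M i x)"
  have "(?f i \<circ> transition M j i has_derivative
      frechet_derivative (?f i) (at (chart M i p)) \<circ> dtrans M j i p) (at (chart M j p))"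
    using has_derivative_transition[OF j i] smooth_fun_has_derivative[OF U f i] j
    by (intro diff_chain_at) (auto simp: charts_at_iff)
  then have "(?f j has_derivative
      frechet_derivative (?f i) (at (chart M i p)) \<circ> dtrans M j i p) (at (chart M j p))"
    by (rule has_derivative_transform_within_open[OF _ mopen_imp_open[OF mopen_cdom[of i], of j]])
      (use i j in \<open>auto simp: charts_at_iff\<close>)
  then have "frechet_derivative (?f j) (at (chart M j p)) (X p j)
      = frechet_derivative (?f i) (at (chart M i p)) (dtrans M j i p (X p j))"
    using frechet_derivative_at by (metis comp_apply)
  also have "dtrans M j i p (X p j) = X p i"
    using tangent_transform[OF X j i] .
  finally show ?thesis
    by (simp add: dir_deriv_def j_def Let_def o_def)
qed

lemma frechet_derivative_chart_cong:
  assumes U: "mopen M U" "p \<in> U" and i: "i \<in> charts_at M p" and eq: "\<And>q. q \<in> U \<Longrightarrow> f q = h q"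
  shows "frechet_derivative (\<lambda>x. f (param M i x)) (at (chart M i p))
    = frechet_derivative (\<lambda>x. h (param M i x)) (at (chart M i p))"
  by (rule frechet_derivative_cong_open[OF mopen_imp_open[OF U(1), of i]])
    (use i U eq in \<open>auto simp: charts_at_iff\<close>)

lemma dir_deriv_cong:
  assumes U: "mopen M U" "p \<in> U" and eq: "\<And>q. q \<in> U \<Longrightarrow> f q = h q" and X: "X p = Y p"
  shows "dir_deriv M X f p = dir_deriv M Y h p"
proof -
  obtain i where "i \<in> charts_at M p"
    using carrier_chart[OF carrier_of_mopen[OF U]] by blast
  then show ?thesis
    using frechet_derivative_chart_cong[OF U some_chart, of i f h] eq
    by (simp add: dir_deriv_def Let_def X o_def)
qed

context
  fixes U p
  assumes U: "mopen M U" "p \<in> U"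
begin

lemma dir_deriv_const: "dir_deriv M X (\<lambda>q. c) p = 0"
  by (simp add: dir_deriv_def Let_def o_def)

lemma dir_deriv_add:
  assumes "smooth_fun M U f" "smooth_fun M U h" "X p \<in> tangent_space M p"
  shows "dir_deriv M X (\<lambda>q. f q + h q) p = dir_deriv M X f p + dir_deriv M X h p"
proof -
  obtain i where i: "i \<in> charts_at M p"
    using carrier_chart[OF carrier_of_mopen[OF U]] by blast
  have "frechet_derivative (\<lambda>x. f (param M i x) + h (param M i x)) (at (chart M i p))
      = (\<lambda>v. frechet_derivative (\<lambda>x. f (param M i x)) (at (chart M i p)) v
        + frechet_derivative (\<lambda>x. h (param M i x)) (at (chart M i p)) v)"
    by (intro frechet_derivative_at[symmetric] has_derivative_add
        smooth_fun_has_derivative[OF U] assms i)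
  then show ?thesis
    using assms i U by (simp add: dir_deriv_chart[OF U _ _ i] smooth_fun_add)
qed

lemma dir_deriv_mult:
  assumes "smooth_fun M U f" "smooth_fun M U h" "X p \<in> tangent_space M p"
  shows "dir_deriv M X (\<lambda>q. f q * h q) p = f p * dir_deriv M X h p + dir_deriv M X f p * h p"
proof -
  obtain i where i: "i \<in> charts_at M p"
    using carrier_chart[OF carrier_of_mopen[OF U]] by blast
  have "frechet_derivative (\<lambda>x. f (param M i x) * h (param M i x)) (at (chart M i p))
      = (\<lambda>v. f (param M i (chart M i p))
          * frechet_derivative (\<lambda>x. h (param M i x)) (at (chart M i p)) v
        + frechet_derivative (\<lambda>x. f (param M i x)) (at (chart M i p)) v
          * h (param M i (chart M i p)))"
    by (intro frechet_derivative_at[symmetric] has_derivative_mult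
        smooth_fun_has_derivative[OF U] assms i)
  then show ?thesis
    using assms i U by (simp add: dir_deriv_chart[OF U _ _ i] smooth_fun_mult charts_at_iff)
qed

lemma dir_deriv_uminus:
  assumes "smooth_fun M U f" "X p \<in> tangent_space M p"
  shows "dir_deriv M X (\<lambda>q. - f q) p = - dir_deriv M X f p"
  using dir_deriv_mult[of "\<lambda>q. - 1" f X] assms smooth_fun_const[OF U(1)]
  by (simp add: dir_deriv_const)

lemma dir_deriv_sum:
  assumes "\<And>k. k \<in> K \<Longrightarrow> smooth_fun M U (f k)" "X p \<in> tangent_space M p"
  shows "dir_deriv M X (\<lambda>q. \<Sum>k\<in>K. f k q) p = (\<Sum>k\<in>K. dir_deriv M X (f k) p)"
  using assms(1)
proof (induction K rule: infinite_finite_induct)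
  case (insert k K)
  then show ?case
    using dir_deriv_add[of "f k" "\<lambda>q. \<Sum>k\<in>K. f k q" X] assms(2)
    by (simp add: smooth_fun_sum[OF U(1)])
qed (simp_all add: dir_deriv_const)

end

lemma smooth_fun_dir_deriv:
  assumes U: "mopen M U" and f: "smooth_fun M U f" and X: "vector_field M U X"
  shows "smooth_fun M U (dir_deriv M X f)"
proof (rule smooth_funI)
  fix i assume i: "i \<in> idx M"
  note S = mopen_imp_open[OF U i]
  show "smooth_on (chart M i ` (U \<inter> cdom M i)) (\<lambda>x. dir_deriv M X f (param M i x))"
    by (rule smooth_on_cong[OF S smooth_on_frechet_derivative_apply[OF S smooth_funD[OF f i]
            vector_field_smooth[OF X i]]])
      (use i U X in \<open>auto simp: charts_at_iff dir_deriv_chart[OF U _ f] vector_field_tangent\<close>)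
qed

lemma lie_bracket_apply:
  "i \<in> charts_at M p \<Longrightarrow> lie_bracket M X Y p i =
    frechet_derivative (\<lambda>x. Y (param M i x) i) (at (chart M i p)) (X p i)
    - frechet_derivative (\<lambda>x. X (param M i x) i) (at (chart M i p)) (Y p i)"
  by (simp add: lie_bracket_def)

lemma lie_bracket_outside: "i \<notin> charts_at M p \<Longrightarrow> lie_bracket M X Y p i = 0"
  by (simp add: lie_bracket_def)

lemma lie_bracket_swap: "lie_bracket M Y X = - lie_bracket M X Y"
  by (auto simp: fun_eq_iff lie_bracket_def)

lemma lie_bracket_cong:
  assumes U: "mopen M U" "p \<in> U" and X: "\<And>q. q \<in> U \<Longrightarrow> X q = X' q" and Y: "\<And>q. q \<in> U \<Longrightarrow> Y q = Y' q"
  shows "lie_bracket M X Y p = lie_bracket M X' Y' p"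
proof
  fix i show "lie_bracket M X Y p i = lie_bracket M X' Y' p i"
  proof (cases "i \<in> charts_at M p")
    case True
    show ?thesis
      using frechet_derivative_chart_cong[OF U True, of "\<lambda>q. X q i" "\<lambda>q. X' q i"]
        frechet_derivative_chart_cong[OF U True, of "\<lambda>q. Y q i" "\<lambda>q. Y' q i"]
      by (simp add: lie_bracket_apply[OF True] X Y U(2))
  qed (simp add: lie_bracket_outside)
qed

lemma lie_bracket_add_left:
  assumes U: "mopen M U" "p \<in> U" and X: "vector_field M U X" and X': "vector_field M U X'"
    and Y: "vector_field M U Y"
  shows "lie_bracket M (X + X') Y p = lie_bracket M X Y p + lie_bracket M X' Y p"
proof
  fix i show "lie_bracket M (X + X') Y p i = (lie_bracket M X Y p + lie_bracket M X' Y p) i"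
  proof (cases "i \<in> charts_at M p")
    case True
    note D = vector_field_has_derivative[OF U _ True]
    show ?thesis
      using frechet_derivative_at[OF has_derivative_add[OF D[OF X] D[OF X']], symmetric]
        linear_add[OF has_derivative_linear[OF D[OF Y]]]
      by (simp add: lie_bracket_apply[OF True])
  qed (simp add: lie_bracket_outside)
qed

lemma lie_bracket_scale_left:
  assumes U: "mopen M U" "p \<in> U" and X: "vector_field M U X" and Y: "vector_field M U Y"
    and f: "smooth_fun M U f"
  shows "lie_bracket M (\<lambda>q. f q \<cdot> X q) Y p
    = f p \<cdot> lie_bracket M X Y p + (- dir_deriv M Y f p) \<cdot> X p"
proof
  fix i show "lie_bracket M (\<lambda>q. f q \<cdot> X q) Y p i
    = (f p \<cdot> lie_bracket M X Y p + (- dir_deriv M Y f p) \<cdot> X p) i"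
  proof (cases "i \<in> charts_at M p")
    case True
    then have i: "param M i (chart M i p) = p" by (simp add: charts_at_iff)
    note D = vector_field_has_derivative[OF U _ True]
    show ?thesis
      using frechet_derivative_at[OF has_derivative_scaleR[OF
            smooth_fun_has_derivative[OF U f True] D[OF X]], symmetric]
        linear_scale[OF has_derivative_linear[OF D[OF Y]]]
        dir_deriv_chart[where X = Y, OF U f vector_field_tangent[OF Y U(2)] True]
      by (simp add: lie_bracket_apply[OF True] i algebra_simps)
  next
    case False
    then show ?thesis
      using tangent_outside[OF vector_field_tangent[OF X U(2)]] by (simp add: lie_bracket_outside)
  qed
qed

lemma vector_field_derivative_transform:
  assumes U: "mopen M U" "p \<in> U" and X: "vector_field M U X"
    and i: "i \<in> charts_at M p" and j: "j \<in> charts_at M p"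
  shows "frechet_derivative (\<lambda>x. X (param M j x) j) (at (chart M j p)) (dtrans M i j p a)
    = dtrans M i j p (frechet_derivative (\<lambda>x. X (param M i x) i) (at (chart M i p)) a)
      + frechet_derivative (\<lambda>x. frechet_derivative (transition M i j) (at x) (X p i))
          (at (chart M i p)) a"
proof -
  let ?V = "U \<inter> cdom M j" and ?X = "\<lambda>i x. X (param M i x) i"
  have ij: "i \<in> idx M" "p \<in> cdom M i" "j \<in> idx M" "p \<in> cdom M j"
    using i j by (simp_all add: charts_at_iff)
  have S: "open (chart M i ` (?V \<inter> cdom M i))" "chart M i p \<in> chart M i ` (?V \<inter> cdom M i)"
    using mopen_imp_open[OF mopen_Int[OF U(1) mopen_cdom[OF ij(3)]] ij(1)] ij U by auto
  have "(?X j \<circ> transition M i j has_derivative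
      frechet_derivative (?X j) (at (chart M j p)) \<circ> dtrans M i j p) (at (chart M i p))"
    using has_derivative_transition[OF i j] vector_field_has_derivative[OF U X j] ij
    by (intro diff_chain_at) auto
  then have chain: "((\<lambda>x. frechet_derivative (transition M i j) (at x) (?X i x)) has_derivative
      frechet_derivative (?X j) (at (chart M j p)) \<circ> dtrans M i j p) (at (chart M i p))"
  proof (rule has_derivative_transform_within_open[OF _ S])
    fix x assume "x \<in> chart M i ` (?V \<inter> cdom M i)"
    then obtain q where q: "x = chart M i q" "q \<in> U" "q \<in> cdom M i" "q \<in> cdom M j" by blast
    then have "dtrans M i j q (X q i) = X q j"
      using ij by (intro tangent_transform[OF vector_field_tangent[OF X]])
        (simp_all add: charts_at_iff)
    then show "(?X j \<circ> transition M i j) x = frechet_derivative (transition M i j) (at x) (?X i x)"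
      using q ij by (simp add: dtrans_def)
  qed
  have product: "((\<lambda>x. frechet_derivative (transition M i j) (at x) (?X i x)) has_derivative
      (\<lambda>a. dtrans M i j p (frechet_derivative (?X i) (at (chart M i p)) a)
        + frechet_derivative (\<lambda>x. frechet_derivative (transition M i j) (at x) (X p i))
            (at (chart M i p)) a)) (at (chart M i p))"
    using has_derivative_frechet_derivative_apply[OF open_overlap[OF ij(1,3)] _
        smooth_transition[OF ij(1,3)] vector_field_has_derivative[OF U X i]] ij
    by (simp add: dtrans_def)
  show ?thesis
    using fun_cong[OF has_derivative_unique[OF chain product], of a] by simp
qed

lemma vector_field_lie_bracket:
  assumes U: "mopen M U" and X: "vector_field M U X" and Y: "vector_field M U Y"
  shows "vector_field M U (lie_bracket M X Y)"
proof (rule vector_fieldI)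
  fix p assume p: "p \<in> U"
  show "lie_bracket M X Y p \<in> tangent_space M p"
  proof (rule tangentI)
    fix i j assume i: "i \<in> charts_at M p" and j: "j \<in> charts_at M p"
    then have ij: "i \<in> idx M" "j \<in> idx M" "chart M i p \<in> chart M i ` (cdom M i \<inter> cdom M j)"
      by (auto simp: charts_at_iff)
    note tangent = tangent_transform[OF vector_field_tangent[OF _ p] i j, symmetric]
    show "dtrans M i j p (lie_bracket M X Y p i) = lie_bracket M X Y p j"
      using symmetric_second_derivative[OF open_overlap[OF ij(1,2)] ij(3)
          smooth_transition[OF ij(1,2)], of "X p i" "Y p i"]
      by (simp add: lie_bracket_apply i j tangent[OF X] tangent[OF Y] linear_diff[OF linear_dtrans]
          vector_field_derivative_transform[OF U p X i j]
          vector_field_derivative_transform[OF U p Y i j])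
  qed (simp add: lie_bracket_outside)
next
  fix i assume i: "i \<in> idx M"
  let ?S = "chart M i ` (U \<inter> cdom M i)"
  let ?D = "\<lambda>X Y x. frechet_derivative (\<lambda>x. Y (param M i x) i) (at x) (X (param M i x) i)"
  have S: "open ?S" by (rule mopen_imp_open[OF U i])
  have "smooth_on ?S (\<lambda>x. ?D X Y x - ?D Y X x)"
    by (intro smooth_on_diff smooth_on_frechet_derivative_apply vector_field_smooth S X Y i)
  then show "smooth_on ?S (\<lambda>x. lie_bracket M X Y (param M i x) i)"
    by (rule smooth_on_cong[OF S]) (use i in \<open>auto simp: lie_bracket_apply charts_at_iff\<close>)
qed

lemma dir_deriv_dir_deriv:
  assumes U: "mopen M U" "p \<in> U" and f: "smooth_fun M U f" and X: "vector_field M U X"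
    and Y: "vector_field M U Y" and i: "i \<in> charts_at M p"
  shows "dir_deriv M X (dir_deriv M Y f) p
    = frechet_derivative (\<lambda>x. f (param M i x)) (at (chart M i p))
        (frechet_derivative (\<lambda>x. Y (param M i x) i) (at (chart M i p)) (X p i))
      + frechet_derivative (\<lambda>y. frechet_derivative (\<lambda>x. f (param M i x)) (at y) (Y p i))
          (at (chart M i p)) (X p i)"
proof -
  let ?f = "\<lambda>x. f (param M i x)" and ?S = "chart M i ` (U \<inter> cdom M i)" and ?x = "chart M i p"
  have i': "i \<in> idx M" "p \<in> cdom M i" using i by (simp_all add: charts_at_iff)
  have S: "open ?S" "?x \<in> ?S"
    using mopen_imp_open[OF U(1) i'(1)] U i' by auto
  have "dir_deriv M X (dir_deriv M Y f) p
      = frechet_derivative (\<lambda>x. dir_deriv M Y f (param M i x)) (at ?x) (X p i)"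
    by (rule dir_deriv_chart[where X = X, OF U smooth_fun_dir_deriv[OF U(1) f Y]
          vector_field_tangent[OF X U(2)] i])
  also have "frechet_derivative (\<lambda>x. dir_deriv M Y f (param M i x)) (at ?x)
      = frechet_derivative (\<lambda>x. frechet_derivative ?f (at x) (Y (param M i x) i)) (at ?x)"
    by (rule frechet_derivative_cong_open[OF S])
      (use i' Y in \<open>auto simp: charts_at_iff dir_deriv_chart[OF U(1) _ f] vector_field_tangent\<close>)
  finally show ?thesis
    using frechet_derivative_at[OF has_derivative_frechet_derivative_apply[OF S
          smooth_funD[OF f i'(1)] vector_field_has_derivative[OF U Y i]], symmetric] i'
    by simp
qed

lemma dir_deriv_lie_bracket:
  assumes U: "mopen M U" "p \<in> U" and f: "smooth_fun M U f"
    and X: "vector_field M U X" and Y: "vector_field M U Y"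
  shows "dir_deriv M (lie_bracket M X Y) f p
    = dir_deriv M X (dir_deriv M Y f) p - dir_deriv M Y (dir_deriv M X f) p"
proof -
  obtain i where i: "i \<in> charts_at M p"
    using carrier_chart[OF carrier_of_mopen[OF U]] by blast
  then have i': "i \<in> idx M" "chart M i p \<in> chart M i ` (U \<inter> cdom M i)"
    using U(2) by (auto simp: charts_at_iff)
  show ?thesis
    using symmetric_second_derivative[OF mopen_imp_open[OF U(1) i'(1)] i'(2)
        smooth_funD[OF f i'(1)],
        of "X p i" "Y p i"]
      dir_deriv_chart[where X = "lie_bracket M X Y", OF U f
        vector_field_tangent[OF vector_field_lie_bracket[OF U(1) X Y] U(2)] i]
      linear_diff[OF has_derivative_linear[OF smooth_fun_has_derivative[OF U f i]]]
    by (simp add: dir_deriv_dir_deriv[OF U f _ _ i] X Y lie_bracket_apply[OF i])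
qed

lemma ext_deriv_cong:
  assumes U: "mopen M U" "p \<in> U" and eq: "\<And>q. q \<in> U \<Longrightarrow> X q = X' q"
  shows "ext_deriv M \<omega> X Y Z p = ext_deriv M \<omega> X' Y Z p"
proof -
  have "dir_deriv M X (\<lambda>q. \<omega> q (Y q) (Z q)) p = dir_deriv M X' (\<lambda>q. \<omega> q (Y q) (Z q)) p"
    "dir_deriv M Y (\<lambda>q. \<omega> q (Z q) (X q)) p = dir_deriv M Y (\<lambda>q. \<omega> q (Z q) (X' q)) p"
    "dir_deriv M Z (\<lambda>q. \<omega> q (X q) (Y q)) p = dir_deriv M Z (\<lambda>q. \<omega> q (X' q) (Y q)) p"
    by (intro dir_deriv_cong[OF U]; simp add: eq U(2))+
  then show ?thesis
    using lie_bracket_cong[OF U, of X X' Y Y] lie_bracket_cong[OF U, of Z Z X X'] eq U(2)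
    by (simp add: ext_deriv_def)
qed

section \<open>Tensorial operators and connections\<close>

definition tensorial_at :: "'m set \<Rightarrow> 'm \<Rightarrow> (('m \<Rightarrow> 'i \<Rightarrow> 'e) \<Rightarrow> 'i \<Rightarrow> 'e) \<Rightarrow> bool" where
  "tensorial_at U p L \<longleftrightarrow> (\<forall>X X' f. vector_field M U X \<and> vector_field M U X' \<and> smooth_fun M U f \<longrightarrow>
     ((\<forall>q\<in>U. X q = X' q) \<longrightarrow> L X = L X') \<and>
     L (X + X') = L X + L X' \<and> L (\<lambda>q. f q \<cdot> X q) = f p \<cdot> L X)"

lemma tensorial_atI:
  assumes "\<And>X X'. vector_field M U X \<Longrightarrow> vector_field M U X' \<Longrightarrow> (\<And>q. q \<in> U \<Longrightarrow> X q = X' q) \<Longrightarrow> L X = L X'"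
    and "\<And>X X'. vector_field M U X \<Longrightarrow> vector_field M U X' \<Longrightarrow> L (X + X') = L X + L X'"
    and "\<And>X f. vector_field M U X \<Longrightarrow> smooth_fun M U f \<Longrightarrow> L (\<lambda>q. f q \<cdot> X q) = f p \<cdot> L X"
  shows "tensorial_at U p L"
  using assms unfolding tensorial_at_def by blast

context
  fixes U p and L :: "('m \<Rightarrow> 'i \<Rightarrow> 'e) \<Rightarrow> 'i \<Rightarrow> 'e"
  assumes L: "tensorial_at U p L" and U: "mopen M U"
begin

lemma tensorial_cong:
  "vector_field M U X \<Longrightarrow> vector_field M U X' \<Longrightarrow> (\<And>q. q \<in> U \<Longrightarrow> X q = X' q) \<Longrightarrow> L X = L X'"
  using L smooth_fun_const[OF U, of 0] unfolding tensorial_at_def by blast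

lemma tensorial_add: "vector_field M U X \<Longrightarrow> vector_field M U X' \<Longrightarrow> L (X + X') = L X + L X'"
  using L smooth_fun_const[OF U, of 0] unfolding tensorial_at_def by blast

lemma tensorial_scale: "vector_field M U X \<Longrightarrow> smooth_fun M U f \<Longrightarrow> L (\<lambda>q. f q \<cdot> X q) = f p \<cdot> L X"
  using L unfolding tensorial_at_def by blast

lemma tensorial_sum:
  assumes "\<And>k. k \<in> K \<Longrightarrow> vector_field M U (X k)"
  shows "L (\<Sum>k\<in>K. X k) = (\<Sum>k\<in>K. L (X k))"
  using assms
proof (induction K rule: infinite_finite_induct)
  case (insert k K)
  then show ?case
    using tensorial_add[of "X k" "\<Sum>k\<in>K. X k"] vector_field_sum[OF U, of K X]
    by (simp del: sum_fun_apply plus_fun_apply)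
qed (use tensorial_add[of 0 0] vector_field_zero[OF U] in simp_all)

lemma tensorial_zero: "L 0 = 0"
  using tensorial_sum[of "{}"] by simp

lemma tensorial_uminus:
  assumes "vector_field M U X"
  shows "L (- X) = - L X"
  using tensorial_scale[OF assms smooth_fun_const[OF U, of "- 1"]] by (simp add: fun_Compl_def)

lemma tensorial_lincomb:
  assumes X: "vector_field M U X" and Z: "\<And>k. k \<in> K \<Longrightarrow> vector_field M U (Z k)"
    and f: "\<And>k. k \<in> K \<Longrightarrow> smooth_fun M U (f k)"
    and eq: "\<And>q. q \<in> U \<Longrightarrow> X q = (\<Sum>k\<in>K. f k q \<cdot> Z k q)"
  shows "L X = (\<Sum>k\<in>K. f k p \<cdot> L (Z k))"
proof -
  let ?Z = "\<lambda>k q. f k q \<cdot> Z k q"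
  have Z': "vector_field M U (?Z k)" if "k \<in> K" for k
    by (rule vector_field_scale[OF U f[OF that] Z[OF that]])
  have "L X = L (\<Sum>k\<in>K. ?Z k)"
    by (rule tensorial_cong[OF X vector_field_sum[OF U Z']]) (simp_all add: eq fun_eq_iff)
  also have "\<dots> = (\<Sum>k\<in>K. L (?Z k))"
    by (rule tensorial_sum[OF Z'])
  also have "\<dots> = (\<Sum>k\<in>K. f k p \<cdot> L (Z k))"
    by (intro sum.cong refl tensorial_scale Z f)
  finally show ?thesis .
qed

context
  fixes i
  assumes i: "i \<in> idx M" "U \<subseteq> cdom M i"
begin

lemma tensorial_expand:
  assumes "vector_field M U X"
  shows "L X = (\<Sum>b\<in>Basis. (X p i \<bullet> b) \<cdot> L (const_field M i b))"
  by (rule tensorial_lincomb)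
    (use assms i U in \<open>auto intro: vector_field_const_field smooth_fun_component
        vector_field_expand\<close>)

lemma tensorial_pointwise:
  assumes "vector_field M U X" "vector_field M U Y" "X p = Y p"
  shows "L X = L Y"
  using assms tensorial_expand by simp

lemma tensorial_lincomb_at:
  assumes X: "vector_field M U X" and Z: "\<And>k. k \<in> K \<Longrightarrow> vector_field M U (Z k)"
    and eq: "X p = (\<Sum>k\<in>K. c k \<cdot> Z k p)"
  shows "L X = (\<Sum>k\<in>K. c k \<cdot> L (Z k))"
proof -
  let ?Z = "\<lambda>k q. c k \<cdot> Z k q"
  have Z': "vector_field M U (?Z k)" if "k \<in> K" for k
    by (rule vector_field_scale[OF U smooth_fun_const[OF U] Z[OF that]])
  have "L X = L (\<Sum>k\<in>K. ?Z k)"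
    by (rule tensorial_pointwise[OF X vector_field_sum[OF U Z']]) (simp_all add: eq fun_eq_iff)
  also have "\<dots> = (\<Sum>k\<in>K. L (?Z k))"
    by (rule tensorial_sum[OF Z'])
  also have "\<dots> = (\<Sum>k\<in>K. c k \<cdot> L (Z k))"
    by (intro sum.cong refl tensorial_scale Z smooth_fun_const[OF U])
  finally show ?thesis .
qed

end

end

lemma tensorial_at_add:
  assumes L: "tensorial_at U p L" and L': "tensorial_at U p L'" and U: "mopen M U"
  shows "tensorial_at U p (\<lambda>X. L X + L' X)"
proof (rule tensorial_atI)
  fix X X' assume X: "vector_field M U X" and X': "vector_field M U X'"
  show "L X + L' X = L X' + L' X'" if "\<And>q. q \<in> U \<Longrightarrow> X q = X' q"
    using tensorial_cong[OF L U X X' that] tensorial_cong[OF L' U X X' that] by simp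
  show "L (X + X') + L' (X + X') = L X + L' X + (L X' + L' X')"
    using tensorial_add[OF L U X X'] tensorial_add[OF L' U X X'] by (simp add: ac_simps)
  show "L (\<lambda>q. f q \<cdot> X q) + L' (\<lambda>q. f q \<cdot> X q) = f p \<cdot> (L X + L' X)" if "smooth_fun M U f" for f
    using tensorial_scale[OF L U X that] tensorial_scale[OF L' U X that]
    by (simp add: vscale_add_right)
qed

lemma tensorial_at_vscale:
  assumes L: "tensorial_at U p L" and U: "mopen M U"
  shows "tensorial_at U p (\<lambda>X. r \<cdot> L X)"
proof (rule tensorial_atI)
  fix X X' assume X: "vector_field M U X" and X': "vector_field M U X'"
  show "r \<cdot> L X = r \<cdot> L X'" if "\<And>q. q \<in> U \<Longrightarrow> X q = X' q"
    using tensorial_cong[OF L U X X' that] by simp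
  show "r \<cdot> L (X + X') = r \<cdot> L X + r \<cdot> L X'"
    using tensorial_add[OF L U X X'] by (simp add: vscale_add_right)
  show "r \<cdot> L (\<lambda>q. f q \<cdot> X q) = f p \<cdot> r \<cdot> L X" if "smooth_fun M U f" for f
    using tensorial_scale[OF L U X that] by (simp add: mult.commute)
qed

definition tensor_field :: "(('m \<Rightarrow> 'i \<Rightarrow> 'e) \<Rightarrow> ('m \<Rightarrow> 'i \<Rightarrow> 'e) \<Rightarrow> 'm \<Rightarrow> 'i \<Rightarrow> 'e) \<Rightarrow> bool" where
  "tensor_field T \<longleftrightarrow> (\<forall>U X Y. mopen M U \<and> vector_field M U X \<and> vector_field M U Y \<longrightarrow>
     vector_field M U (T X Y) \<and>
     (\<forall>p\<in>U. tensorial_at U p (\<lambda>X. T X Y p) \<and> tensorial_at U p (\<lambda>Y. T X Y p)))"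

context
  fixes T :: "('m \<Rightarrow> 'i \<Rightarrow> 'e) \<Rightarrow> ('m \<Rightarrow> 'i \<Rightarrow> 'e) \<Rightarrow> 'm \<Rightarrow> 'i \<Rightarrow> 'e" and U
  assumes T: "tensor_field T" and U: "mopen M U"
begin

lemma tensor_field_vector_field:
  "vector_field M U X \<Longrightarrow> vector_field M U Y \<Longrightarrow> vector_field M U (T X Y)"
  using T U unfolding tensor_field_def by blast

lemma tensor_field_tensorial_left: "p \<in> U \<Longrightarrow> vector_field M U Y \<Longrightarrow> tensorial_at U p (\<lambda>X. T X Y p)"
  using T U vector_field_zero unfolding tensor_field_def by blast

lemma tensor_field_tensorial_right: "p \<in> U \<Longrightarrow> vector_field M U X \<Longrightarrow> tensorial_at U p (\<lambda>Y. T X Y p)"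
  using T U vector_field_zero unfolding tensor_field_def by blast

lemma tensor_field_cong:
  assumes "vector_field M U X" "vector_field M U X'" "vector_field M U Y" "vector_field M U Y'"
    and "\<And>q. q \<in> U \<Longrightarrow> X q = X' q" "\<And>q. q \<in> U \<Longrightarrow> Y q = Y' q" "p \<in> U"
  shows "T X Y p = T X' Y' p"
  using tensorial_cong[OF tensor_field_tensorial_left[OF assms(7,3)] U assms(1,2,5)]
    tensorial_cong[OF tensor_field_tensorial_right[OF assms(7,2)] U assms(3,4,6)] by simp

end

lemma tensor_field_add:
  assumes T: "tensor_field T" and T': "tensor_field T'"
  shows "tensor_field (\<lambda>X Y. T X Y + T' X Y)"
  unfolding tensor_field_def
proof (intro allI impI conjI ballI; elim conjE)
  fix U X Y assume U: "mopen M U" and X: "vector_field M U X" and Y: "vector_field M U Y"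
  show "vector_field M U (T X Y + T' X Y)"
    by (intro vector_field_add U tensor_field_vector_field[OF T U X Y]
        tensor_field_vector_field[OF T' U X Y])
  fix p assume p: "p \<in> U"
  show "tensorial_at U p (\<lambda>X. (T X Y + T' X Y) p)"
    using tensorial_at_add[OF tensor_field_tensorial_left[OF T U p Y]
        tensor_field_tensorial_left[OF T' U p Y] U] by simp
  show "tensorial_at U p (\<lambda>Y. (T X Y + T' X Y) p)"
    using tensorial_at_add[OF tensor_field_tensorial_right[OF T U p X]
        tensor_field_tensorial_right[OF T' U p X] U] by simp
qed

lemma tensor_field_scale:
  assumes T: "tensor_field T"
  shows "tensor_field (\<lambda>X Y p. r \<cdot> T X Y p)"
  unfolding tensor_field_def
proof (intro allI impI conjI ballI; elim conjE)
  fix U X Y assume U: "mopen M U" and X: "vector_field M U X" and Y: "vector_field M U Y"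
  show "vector_field M U (\<lambda>p. r \<cdot> T X Y p)"
    by (intro vector_field_scale smooth_fun_const U tensor_field_vector_field[OF T U X Y])
  fix p assume p: "p \<in> U"
  show "tensorial_at U p (\<lambda>X. r \<cdot> T X Y p)"
    by (rule tensorial_at_vscale[OF tensor_field_tensorial_left[OF T U p Y] U])
  show "tensorial_at U p (\<lambda>Y. r \<cdot> T X Y p)"
    by (rule tensorial_at_vscale[OF tensor_field_tensorial_right[OF T U p X] U])
qed

end

locale atlas_connection = smooth_atlas M
  for M :: "('i, 'm, 'e::euclidean_space) atlas" +
  fixes nab :: "('m \<Rightarrow> 'i \<Rightarrow> 'e) \<Rightarrow> ('m \<Rightarrow> 'i \<Rightarrow> 'e) \<Rightarrow> 'm \<Rightarrow> 'i \<Rightarrow> 'e"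
  assumes connection: "connection M nab"
begin

context
  fixes U
  assumes U: "mopen M U"
begin

lemma connection_vector_field:
  "vector_field M U X \<Longrightarrow> vector_field M U Y \<Longrightarrow> vector_field M U (nab X Y)"
  using connection smooth_fun_const[OF U, of 0] U unfolding connection_def by blast

lemma connection_cong:
  "vector_field M U X \<Longrightarrow> vector_field M U X' \<Longrightarrow> vector_field M U Y \<Longrightarrow> vector_field M U Y' \<Longrightarrow>
   (\<And>q. q \<in> U \<Longrightarrow> X q = X' q) \<Longrightarrow> (\<And>q. q \<in> U \<Longrightarrow> Y q = Y' q) \<Longrightarrow> p \<in> U \<Longrightarrow> nab X Y p = nab X' Y' p"
  using connection smooth_fun_const[OF U, of 0] U unfolding connection_def by blast

lemma connection_add_left:
  "vector_field M U X \<Longrightarrow> vector_field M U X' \<Longrightarrow> vector_field M U Y \<Longrightarrow> p \<in> U \<Longrightarrow>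
   nab (X + X') Y p = nab X Y p + nab X' Y p"
  using connection smooth_fun_const[OF U, of 0] U unfolding connection_def by blast

lemma connection_add_right:
  "vector_field M U X \<Longrightarrow> vector_field M U Y \<Longrightarrow> vector_field M U Y' \<Longrightarrow> p \<in> U \<Longrightarrow>
   nab X (Y + Y') p = nab X Y p + nab X Y' p"
  using connection smooth_fun_const[OF U, of 0] U unfolding connection_def by blast

lemma connection_scale_left:
  "vector_field M U X \<Longrightarrow> vector_field M U Y \<Longrightarrow> smooth_fun M U f \<Longrightarrow> p \<in> U \<Longrightarrow>
   nab (\<lambda>q. f q \<cdot> X q) Y p = f p \<cdot> nab X Y p"
  using connection U unfolding connection_def by blast

lemma connection_leibniz:
  "vector_field M U X \<Longrightarrow> vector_field M U Y \<Longrightarrow> smooth_fun M U f \<Longrightarrow> p \<in> U \<Longrightarrow>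
   nab X (\<lambda>q. f q \<cdot> Y q) p = dir_deriv M X f p \<cdot> Y p + f p \<cdot> nab X Y p"
  using connection U unfolding connection_def by blast

lemma connection_scale_const_right:
  "vector_field M U X \<Longrightarrow> vector_field M U Y \<Longrightarrow> p \<in> U \<Longrightarrow> nab X (\<lambda>q. c \<cdot> Y q) p = c \<cdot> nab X Y p"
  using connection_leibniz[OF _ _ smooth_fun_const[OF U, of c]] dir_deriv_const[OF U] by simp

lemma connection_uminus_left:
  "vector_field M U X \<Longrightarrow> vector_field M U Y \<Longrightarrow> p \<in> U \<Longrightarrow> nab (- X) Y p = - nab X Y p"
  using connection_scale_left[OF _ _ smooth_fun_const[OF U, of "- 1"], of X Y p]
  by (simp add: fun_Compl_def)

lemma connection_zero_right: "vector_field M U X \<Longrightarrow> p \<in> U \<Longrightarrow> nab X 0 p = 0"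
  using connection_add_right[of X 0 0 p] vector_field_zero[OF U] by simp

lemma connection_sum_right:
  assumes "vector_field M U X" "p \<in> U" "\<And>k. k \<in> K \<Longrightarrow> vector_field M U (Y k)"
  shows "nab X (\<Sum>k\<in>K. Y k) p = (\<Sum>k\<in>K. nab X (Y k) p)"
  using assms(3)
proof (induction K rule: infinite_finite_induct)
  case (insert k K)
  then show ?case
    using assms(1,2) connection_add_right[of X "Y k" "\<Sum>k\<in>K. Y k" p] vector_field_sum[OF U, of K Y]
    by (simp del: sum_fun_apply plus_fun_apply)
qed (simp_all add: connection_zero_right assms)

lemma connection_expand_right:
  assumes p: "p \<in> U" and X: "vector_field M U X" and Y: "vector_field M U Y"
    and Z: "\<And>k. k \<in> K \<Longrightarrow> vector_field M U (Z k)" and f: "\<And>k. k \<in> K \<Longrightarrow> smooth_fun M U (f k)"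
    and eq: "\<And>q. q \<in> U \<Longrightarrow> Y q = (\<Sum>k\<in>K. f k q \<cdot> Z k q)"
  shows "nab X Y p = (\<Sum>k\<in>K. dir_deriv M X (f k) p \<cdot> Z k p + f k p \<cdot> nab X (Z k) p)"
proof -
  let ?Z = "\<lambda>k q. f k q \<cdot> Z k q"
  have Z': "vector_field M U (?Z k)" if "k \<in> K" for k
    by (rule vector_field_scale[OF U f[OF that] Z[OF that]])
  have "nab X Y p = nab X (\<Sum>k\<in>K. ?Z k) p"
    by (rule connection_cong[OF X X Y vector_field_sum[OF U Z'] refl _ p])
      (simp_all add: eq fun_eq_iff)
  also have "\<dots> = (\<Sum>k\<in>K. nab X (?Z k) p)"
    by (rule connection_sum_right[OF X p Z'])
  also have "\<dots> = (\<Sum>k\<in>K. dir_deriv M X (f k) p \<cdot> Z k p + f k p \<cdot> nab X (Z k) p)"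
    by (rule sum.cong[OF refl connection_leibniz[OF X Z f p]])
  finally show ?thesis .
qed

lemma connection_tensorial_left:
  assumes "p \<in> U" "vector_field M U Y"
  shows "tensorial_at U p (\<lambda>X. nab X Y p)"
  by (rule tensorial_atI, rule connection_cong)
    (simp_all add: assms connection_add_left connection_scale_left)

end

lemma connection_add_tensor_field:
  assumes T: "tensor_field T"
  shows "connection M (\<lambda>X Y. nab X Y + T X Y)"
  unfolding connection_def
proof (intro allI impI conjI ballI; (elim conjE)?)
  fix U X X' Y Y' and f :: "'m \<Rightarrow> real"
  assume U: "mopen M U" and vector_fields: "vector_field M U X" "vector_field M U X'"
    "vector_field M U Y" "vector_field M U Y'" and f: "smooth_fun M U f"
  show "vector_field M U (nab X Y + T X Y)"
    by (intro vector_field_add[OF U] connection_vector_field[OF U]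
        tensor_field_vector_field[OF T U] vector_fields)
  fix p assume p: "p \<in> U"
  note left = tensor_field_tensorial_left[OF T U p vector_fields(3)]
    and right = tensor_field_tensorial_right[OF T U p vector_fields(1)]
  show "(nab X Y + T X Y) p = (nab X' Y' + T X' Y') p" if "\<forall>p\<in>U. X p = X' p \<and> Y p = Y' p"
    using connection_cong[OF U vector_fields _ _ p] tensor_field_cong[OF T U vector_fields _ _ p]
      that by simp
  show "(nab (X + X') Y + T (X + X') Y) p = (nab X Y + T X Y) p + (nab X' Y + T X' Y) p"
    using connection_add_left[OF U vector_fields(1-3) p] tensorial_add[OF left U vector_fields(1,2)]
    by (simp add: ac_simps)
  show "(nab (\<lambda>q. f q \<cdot> X q) Y + T (\<lambda>q. f q \<cdot> X q) Y) p = f p \<cdot> (nab X Y + T X Y) p"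
    using connection_scale_left[OF U vector_fields(1,3) f p]
      tensorial_scale[OF left U vector_fields(1) f]
    by (simp add: vscale_add_right)
  show "(nab X (Y + Y') + T X (Y + Y')) p = (nab X Y + T X Y) p + (nab X Y' + T X Y') p"
    using connection_add_right[OF U vector_fields(1,3,4) p]
      tensorial_add[OF right U vector_fields(3,4)]
    by (simp add: ac_simps)
  show "(nab X (\<lambda>q. f q \<cdot> Y q) + T X (\<lambda>q. f q \<cdot> Y q)) p
      = dir_deriv M X f p \<cdot> Y p + f p \<cdot> (nab X Y + T X Y) p"
    using connection_leibniz[OF U vector_fields(1,3) f p]
      tensorial_scale[OF right U vector_fields(3) f]
    by (simp add: vscale_add_right add.assoc)
qed

lemma tensor_field_difference:
  assumes D: "connection M D"
  shows "tensor_field (difference_tensor D nab)"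
  unfolding tensor_field_def difference_tensor_def
proof (intro allI impI conjI ballI; elim conjE)
  interpret D: atlas_connection M D by standard (rule D)
  fix U X Y assume U: "mopen M U" and X: "vector_field M U X" and Y: "vector_field M U Y"
  show "vector_field M U (D X Y - nab X Y)"
    by (intro vector_field_diff[OF U] connection_vector_field[OF U]
        D.connection_vector_field[OF U] X Y)
  fix p assume p: "p \<in> U"
  show "tensorial_at U p (\<lambda>X. (D X Y - nab X Y) p)"
  proof (rule tensorial_atI)
    fix X X' assume X: "vector_field M U X" and X': "vector_field M U X'"
    show "(D X Y - nab X Y) p = (D X' Y - nab X' Y) p" if "\<And>q. q \<in> U \<Longrightarrow> X q = X' q"
      using D.connection_cong[OF U X X' Y Y that refl p] connection_cong[OF U X X' Y Y that refl p]
      by simp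
    show "(D (X + X') Y - nab (X + X') Y) p = (D X Y - nab X Y) p + (D X' Y - nab X' Y) p"
      by (simp add: D.connection_add_left[OF U X X' Y p] connection_add_left[OF U X X' Y p])
    show "(D (\<lambda>q. f q \<cdot> X q) Y - nab (\<lambda>q. f q \<cdot> X q) Y) p = f p \<cdot> (D X Y - nab X Y) p"
      if "smooth_fun M U f" for f
      by (simp add: D.connection_scale_left[OF U X Y that p] connection_scale_left[OF U X Y that p]
          vscale_diff_right)
  qed
  show "tensorial_at U p (\<lambda>Y. (D X Y - nab X Y) p)"
  proof (rule tensorial_atI)
    fix Y Y' assume Y: "vector_field M U Y" and Y': "vector_field M U Y'"
    show "(D X Y - nab X Y) p = (D X Y' - nab X Y') p" if "\<And>q. q \<in> U \<Longrightarrow> Y q = Y' q"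
      using D.connection_cong[OF U X X Y Y' refl that p] connection_cong[OF U X X Y Y' refl that p]
      by simp
    show "(D X (Y + Y') - nab X (Y + Y')) p = (D X Y - nab X Y) p + (D X Y' - nab X Y') p"
      by (simp add: D.connection_add_right[OF U X Y Y' p] connection_add_right[OF U X Y Y' p])
    show "(D X (\<lambda>q. f q \<cdot> Y q) - nab X (\<lambda>q. f q \<cdot> Y q)) p = f p \<cdot> (D X Y - nab X Y) p"
      if "smooth_fun M U f" for f
      by (simp add: D.connection_leibniz[OF U X Y that p] connection_leibniz[OF U X Y that p]
          vscale_diff_right)
  qed
qed

lemma vector_field_const_field_cdom: "i \<in> idx M \<Longrightarrow> vector_field M (cdom M i) (const_field M i a)"
  by (intro vector_field_const_field mopen_cdom order_refl)

lemma linear_christoffel_left: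
  assumes i: "i \<in> charts_at M p"
  shows "linear (\<lambda>a. christoffel M nab i p a b)"
proof -
  have i': "mopen M (cdom M i)" "p \<in> cdom M i" "vector_field M (cdom M i) (const_field M i a)" for a
    using i by (auto simp: charts_at_iff mopen_cdom vector_field_const_field_cdom)
  show ?thesis
    unfolding christoffel_def
    by (rule linearI) (simp_all add: const_field_add const_field_scale
        connection_add_left[OF i'(1,3,3,3,2)]
        connection_scale_left[OF i'(1,3,3) smooth_fun_const[OF i'(1)] i'(2)])
qed

lemma linear_christoffel_right:
  assumes i: "i \<in> charts_at M p"
  shows "linear (christoffel M nab i p a)"
proof -
  have i': "mopen M (cdom M i)" "p \<in> cdom M i" "vector_field M (cdom M i) (const_field M i a)" for a
    using i by (auto simp: charts_at_iff mopen_cdom vector_field_const_field_cdom)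
  show ?thesis
    unfolding christoffel_def
    by (rule linearI) (simp_all add: const_field_add const_field_scale
        connection_add_right[OF i'(1,3,3,3,2)] connection_scale_const_right[OF i'(1,3,3,2)])
qed

lemma christoffel_expand_right:
  assumes "i \<in> charts_at M p"
  shows "christoffel M nab i p a b = (\<Sum>d\<in>Basis. (b \<bullet> d) *\<^sub>R christoffel M nab i p a d)"
proof -
  interpret linear "christoffel M nab i p a" by (rule linear_christoffel_right[OF assms])
  have "christoffel M nab i p a b = christoffel M nab i p a (\<Sum>d\<in>Basis. (b \<bullet> d) *\<^sub>R d)"
    by (simp add: euclidean_representation)
  then show ?thesis by (simp only: sum scale)
qed

lemma connection_const_field:
  assumes U: "mopen M U" "p \<in> U" and i: "i \<in> charts_at M p" and X: "vector_field M U X"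
  shows "nab X (const_field M i b) p i = christoffel M nab i p (X p i) b"
proof -
  let ?V = "U \<inter> cdom M i"
  have i': "i \<in> idx M" "p \<in> cdom M i" using i by (auto simp: charts_at_iff)
  have V: "mopen M ?V" "p \<in> ?V"
    using U i' by (auto intro: mopen_Int mopen_cdom)
  have const: "vector_field M ?V (const_field M i a)" for a
    using V i' by (intro vector_field_const_field) auto
  have "nab X (const_field M i b) p = nab (const_field M i (X p i)) (const_field M i b) p"
    by (rule tensorial_pointwise[OF connection_tensorial_left[OF V const] V(1) i'(1) _
          vector_field_subset[OF X] const])
      (use tangent_eq_const_field[OF vector_field_tangent[OF X U(2)] i] in auto)
  then show ?thesis by (simp add: christoffel_def)
qed

lemma connection_in_chart:
  assumes U: "mopen M U" "p \<in> U" and i: "i \<in> charts_at M p"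
    and X: "vector_field M U X" and Y: "vector_field M U Y"
  shows "nab X Y p i = frechet_derivative (\<lambda>x. Y (param M i x) i) (at (chart M i p)) (X p i)
    + christoffel M nab i p (X p i) (Y p i)"
proof -
  let ?V = "U \<inter> cdom M i" and ?y = "\<lambda>b q. Y q i \<bullet> b"
  let ?D = "frechet_derivative (\<lambda>x. Y (param M i x) i) (at (chart M i p))"
  have i': "i \<in> idx M" "p \<in> cdom M i" using i by (auto simp: charts_at_iff)
  have V: "mopen M ?V" "p \<in> ?V" "?V \<subseteq> cdom M i"
    using U i' by (auto intro: mopen_Int mopen_cdom)
  have XY: "vector_field M ?V X" "vector_field M ?V Y"
    using X Y by (auto intro: vector_field_subset)
  have y: "smooth_fun M ?V (?y b)" for b
    using V i' XY by (intro smooth_fun_component)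
  have dir_deriv_component: "dir_deriv M X (?y b) p = ?D (X p i) \<bullet> b" for b
    using dir_deriv_chart[where X = X, OF V(1,2) y vector_field_tangent[OF X U(2)] i, of b]
      fun_cong[OF frechet_derivative_at[OF has_derivative_inner_left[OF
            vector_field_has_derivative[OF U Y i], of b]], of "X p i"] by simp
  have "nab X Y p i = (\<Sum>b\<in>Basis. dir_deriv M X (?y b) p *\<^sub>R const_field M i b p i
      + ?y b p *\<^sub>R nab X (const_field M i b) p i)"
    by (subst connection_expand_right[OF V(1,2) XY vector_field_const_field[OF V(1,3) i'(1)] y
          vector_field_expand[OF _ V(3) i'(1) XY(2)]]) simp_all
  also have "\<dots> = (\<Sum>b\<in>Basis. (?D (X p i) \<bullet> b) *\<^sub>R b + ?y b p *\<^sub>R christoffel M nab i p (X p i) b)"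
    by (simp add: dir_deriv_component const_field_apply[OF i] connection_const_field[OF U i X])
  also have "\<dots> = ?D (X p i) + christoffel M nab i p (X p i) (Y p i)"
    by (simp add: sum.distrib euclidean_representation christoffel_expand_right[OF i, of _ "Y p i"])
  finally show ?thesis .
qed

section \<open>Curvature\<close>

lemma vector_field_curvature:
  assumes U: "mopen M U" and "vector_field M U X" "vector_field M U Y" "vector_field M U Z"
  shows "vector_field M U (curvature M nab X Y Z)"
  unfolding curvature_def
  by (intro vector_field_add[OF U] vector_field_diff[OF U] connection_vector_field[OF U]
      vector_field_lie_bracket[OF U] assms)

context
  fixes U p
  assumes U: "mopen M U" "p \<in> U"
begin

lemma connection_connection_cong:
  assumes X: "vector_field M U X" and Y: "vector_field M U Y" and Z: "vector_field M U Z"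
    and W: "vector_field M U W" and eq: "\<And>q. q \<in> U \<Longrightarrow> nab Y Z q = W q"
  shows "nab X (nab Y Z) p = nab X W p"
  using eq by (intro connection_cong[OF U(1)] connection_vector_field[OF U(1)] X Y Z W U) simp_all

lemma curvature_cong:
  assumes X: "vector_field M U X" "vector_field M U X'"
    and Y: "vector_field M U Y" "vector_field M U Y'"
    and Z: "vector_field M U Z" "vector_field M U Z'"
    and eq: "\<And>q. q \<in> U \<Longrightarrow> X q = X' q" "\<And>q. q \<in> U \<Longrightarrow> Y q = Y' q" "\<And>q. q \<in> U \<Longrightarrow> Z q = Z' q"
  shows "curvature M nab X Y Z p = curvature M nab X' Y' Z' p"
proof -
  have "nab (lie_bracket M X Y) Z p = nab (lie_bracket M X' Y') Z' p"
    by (intro connection_cong[OF U(1)] vector_field_lie_bracket[OF U(1)] lie_bracket_cong[OF U(1)]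
        X Y Z eq U)
  moreover have "nab X (nab Y Z) p = nab X' (nab Y' Z') p"
    "nab Y (nab X Z) p = nab Y' (nab X' Z') p"
    by (intro connection_cong[OF U(1)] connection_vector_field[OF U(1)] X Y Z eq U; assumption)+
  ultimately show ?thesis by (simp add: curvature_def)
qed

lemma curvature_swap:
  assumes "vector_field M U X" "vector_field M U Y" "vector_field M U Z"
  shows "curvature M nab Y X Z p = - curvature M nab X Y Z p"
proof -
  have "nab (lie_bracket M Y X) Z p = - nab (lie_bracket M X Y) Z p"
    using assms by (subst lie_bracket_swap[of Y X])
      (intro connection_uminus_left[OF U(1) _ _ U(2)] vector_field_lie_bracket[OF U(1)])
  then show ?thesis by (simp add: curvature_def)
qed

lemma curvature_add_first:
  assumes X: "vector_field M U X" and X': "vector_field M U X'" and Y: "vector_field M U Y"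
    and Z: "vector_field M U Z"
  shows "curvature M nab (X + X') Y Z p = curvature M nab X Y Z p + curvature M nab X' Y Z p"
proof -
  note vector_fields = X X' Y Z vector_field_add[OF U(1)] vector_field_lie_bracket[OF U(1)]
    connection_vector_field[OF U(1)]
  have "nab (lie_bracket M (X + X') Y) Z p = nab (lie_bracket M X Y + lie_bracket M X' Y) Z p"
    by (intro connection_cong[OF U(1)] vector_fields U)
      (simp_all add: lie_bracket_add_left[OF U(1) _ X X' Y])
  then have bracket: "nab (lie_bracket M (X + X') Y) Z p
      = nab (lie_bracket M X Y) Z p + nab (lie_bracket M X' Y) Z p"
    by (subst (asm) connection_add_left[OF U(1)]) (intro vector_fields U | assumption)+
  have "nab Y (nab (X + X') Z) p = nab Y (nab X Z + nab X' Z) p"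
    by (intro connection_connection_cong vector_fields)
      (simp add: connection_add_left[OF U(1) X X' Z])
  then have inner: "nab Y (nab (X + X') Z) p = nab Y (nab X Z) p + nab Y (nab X' Z) p"
    by (subst (asm) connection_add_right[OF U(1)]) (intro vector_fields U | assumption)+
  have outer: "nab (X + X') (nab Y Z) p = nab X (nab Y Z) p + nab X' (nab Y Z) p"
    by (intro connection_add_left[OF U(1)] vector_fields U)
  show ?thesis
    by (simp add: curvature_def bracket inner outer)
qed

lemma curvature_scale_first:
  assumes X: "vector_field M U X" and Y: "vector_field M U Y" and Z: "vector_field M U Z"
    and f: "smooth_fun M U f"
  shows "curvature M nab (\<lambda>q. f q \<cdot> X q) Y Z p = f p \<cdot> curvature M nab X Y Z p"
proof -
  note vector_fields = X Y Z f vector_field_add[OF U(1)] vector_field_lie_bracket[OF U(1)]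
    connection_vector_field[OF U(1)] vector_field_scale[OF U(1)] smooth_fun_uminus[OF U(1)]
    smooth_fun_dir_deriv[OF U(1)]
  let ?V = "\<lambda>q. f q \<cdot> lie_bracket M X Y q" and ?W = "\<lambda>q. (- dir_deriv M Y f q) \<cdot> X q"
  have "nab (lie_bracket M (\<lambda>q. f q \<cdot> X q) Y) Z p = nab (?V + ?W) Z p"
    by (intro connection_cong[OF U(1)] vector_fields U)
      (simp_all add: lie_bracket_scale_left[OF U(1) _ X Y f])
  also have "\<dots> = nab ?V Z p + nab ?W Z p"
    by (intro connection_add_left[OF U(1)] vector_fields U)
  also have "nab ?V Z p = f p \<cdot> nab (lie_bracket M X Y) Z p"
    by (intro connection_scale_left[OF U(1)] vector_fields U)
  also have "nab ?W Z p = (- dir_deriv M Y f p) \<cdot> nab X Z p"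
    by (intro connection_scale_left[OF U(1)] vector_fields U)
  finally have bracket: "nab (lie_bracket M (\<lambda>q. f q \<cdot> X q) Y) Z p
    = f p \<cdot> nab (lie_bracket M X Y) Z p + (- dir_deriv M Y f p) \<cdot> nab X Z p" .
  have "nab Y (nab (\<lambda>q. f q \<cdot> X q) Z) p = nab Y (\<lambda>q. f q \<cdot> nab X Z q) p"
    by (intro connection_connection_cong vector_fields) (rule connection_scale_left[OF U(1) X Z f])
  also have "\<dots> = dir_deriv M Y f p \<cdot> nab X Z p + f p \<cdot> nab Y (nab X Z) p"
    by (intro connection_leibniz[OF U(1)] vector_fields U)
  finally have inner: "nab Y (nab (\<lambda>q. f q \<cdot> X q) Z) p = \<dots>" .
  have outer: "nab (\<lambda>q. f q \<cdot> X q) (nab Y Z) p = f p \<cdot> nab X (nab Y Z) p"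
    by (intro connection_scale_left[OF U(1)] vector_fields U)
  show ?thesis
    by (simp add: curvature_def bracket inner outer vscale_add_right vscale_diff_right
        vscale_minus_left)
qed

lemma curvature_add_third:
  assumes X: "vector_field M U X" and Y: "vector_field M U Y" and Z: "vector_field M U Z"
    and Z': "vector_field M U Z'"
  shows "curvature M nab X Y (Z + Z') p = curvature M nab X Y Z p + curvature M nab X Y Z' p"
proof -
  note vector_fields = X Y Z Z' vector_field_add[OF U(1)] vector_field_lie_bracket[OF U(1)]
    connection_vector_field[OF U(1)]
  have second: "nab V (nab W (Z + Z')) p = nab V (nab W Z) p + nab V (nab W Z') p"
    if V: "vector_field M U V" and W: "vector_field M U W" for V W
  proof -
    have "nab V (nab W (Z + Z')) p = nab V (nab W Z + nab W Z') p"
      by (intro connection_connection_cong vector_fields V W)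
        (simp add: connection_add_right[OF U(1) W Z Z'])
    also have "\<dots> = nab V (nab W Z) p + nab V (nab W Z') p"
      by (intro connection_add_right[OF U(1)] vector_fields U V W)
    finally show ?thesis .
  qed
  have "nab (lie_bracket M X Y) (Z + Z') p
      = nab (lie_bracket M X Y) Z p + nab (lie_bracket M X Y) Z' p"
    by (intro connection_add_right[OF U(1)] vector_fields U)
  then show ?thesis
    by (simp add: curvature_def second X Y)
qed

lemma connection_connection_scale:
  assumes X: "vector_field M U X" and Y: "vector_field M U Y" and Z: "vector_field M U Z"
    and f: "smooth_fun M U f"
  shows "nab X (nab Y (\<lambda>q. f q \<cdot> Z q)) p = dir_deriv M X (dir_deriv M Y f) p \<cdot> Z p
    + dir_deriv M Y f p \<cdot> nab X Z p + dir_deriv M X f p \<cdot> nab Y Z p + f p \<cdot> nab X (nab Y Z) p"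
proof -
  note vector_fields = X Y Z f vector_field_add[OF U(1)] connection_vector_field[OF U(1)]
    vector_field_scale[OF U(1)] smooth_fun_dir_deriv[OF U(1)]
  have "nab X (nab Y (\<lambda>q. f q \<cdot> Z q)) p
      = nab X ((\<lambda>q. dir_deriv M Y f q \<cdot> Z q) + (\<lambda>q. f q \<cdot> nab Y Z q)) p"
    by (intro connection_connection_cong vector_fields)
      (simp add: connection_leibniz[OF U(1) Y Z f])
  also have "\<dots> = nab X (\<lambda>q. dir_deriv M Y f q \<cdot> Z q) p + nab X (\<lambda>q. f q \<cdot> nab Y Z q) p"
    by (intro connection_add_right[OF U(1)] vector_fields U)
  also have "nab X (\<lambda>q. dir_deriv M Y f q \<cdot> Z q) p
      = dir_deriv M X (dir_deriv M Y f) p \<cdot> Z p + dir_deriv M Y f p \<cdot> nab X Z p"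
    by (intro connection_leibniz[OF U(1)] vector_fields U)
  also have
    "nab X (\<lambda>q. f q \<cdot> nab Y Z q) p = dir_deriv M X f p \<cdot> nab Y Z p + f p \<cdot> nab X (nab Y Z) p"
    by (intro connection_leibniz[OF U(1)] vector_fields U)
  finally show ?thesis by (simp only: add.assoc)
qed

lemma curvature_scale_third:
  assumes X: "vector_field M U X" and Y: "vector_field M U Y" and Z: "vector_field M U Z"
    and f: "smooth_fun M U f"
  shows "curvature M nab X Y (\<lambda>q. f q \<cdot> Z q) p = f p \<cdot> curvature M nab X Y Z p"
proof -
  have "nab (lie_bracket M X Y) (\<lambda>q. f q \<cdot> Z q) p
      = dir_deriv M (lie_bracket M X Y) f p \<cdot> Z p + f p \<cdot> nab (lie_bracket M X Y) Z p"
    by (intro connection_leibniz[OF U(1)] vector_field_lie_bracket[OF U(1)] X Y Z f U)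
  then show ?thesis
    by (simp add: fun_eq_iff curvature_def connection_connection_scale X Y Z f
        dir_deriv_lie_bracket[OF U f X Y] algebra_simps)
qed

lemma curvature_tensorial_first:
  "vector_field M U Y \<Longrightarrow> vector_field M U Z \<Longrightarrow> tensorial_at U p (\<lambda>X. curvature M nab X Y Z p)"
  by (rule tensorial_atI, rule curvature_cong)
    (simp_all add: curvature_add_first curvature_scale_first)

lemma curvature_tensorial_second:
  assumes X: "vector_field M U X" and Z: "vector_field M U Z"
  shows "tensorial_at U p (\<lambda>Y. curvature M nab X Y Z p)"
proof (rule tensorial_atI)
  fix Y Y' f assume Y: "vector_field M U Y" and f: "smooth_fun M U f"
  show "curvature M nab X (\<lambda>q. f q \<cdot> Y q) Z p = f p \<cdot> curvature M nab X Y Z p"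
    using curvature_scale_first[OF Y X Z f] Y X Z f
    by (simp add: curvature_swap[of _ X] vector_field_scale[OF U(1)] vscale_minus_left)
next
  fix Y Y' assume Y: "vector_field M U Y" and Y': "vector_field M U Y'"
  show "curvature M nab X (Y + Y') Z p = curvature M nab X Y Z p + curvature M nab X Y' Z p"
    using curvature_add_first[OF Y Y' X Z] Y Y' X Z
    by (simp add: curvature_swap[of _ X] vector_field_add[OF U(1)])
  show "curvature M nab X Y Z p = curvature M nab X Y' Z p" if "\<And>q. q \<in> U \<Longrightarrow> Y q = Y' q"
    by (rule curvature_cong) (simp_all add: X Y Y' Z that)
qed

lemma curvature_tensorial_third:
  "vector_field M U X \<Longrightarrow> vector_field M U Y \<Longrightarrow> tensorial_at U p (\<lambda>Z. curvature M nab X Y Z p)"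
  by (rule tensorial_atI, rule curvature_cong)
    (simp_all add: curvature_add_third curvature_scale_third)

end

end

section \<open>Metrics\<close>

locale metric_atlas = smooth_atlas M
  for M :: "('i, 'm, 'e::euclidean_space) atlas" +
  fixes g :: "'m \<Rightarrow> ('i \<Rightarrow> 'e) \<Rightarrow> ('i \<Rightarrow> 'e) \<Rightarrow> real"
  assumes metric_sym: "p \<in> carrier_of M \<Longrightarrow> u \<in> tangent_space M p \<Longrightarrow> v \<in> tangent_space M p \<Longrightarrow>
      g p u v = g p v u"
    and metric_linear: "p \<in> carrier_of M \<Longrightarrow> u \<in> tangent_space M p \<Longrightarrow> v \<in> tangent_space M p \<Longrightarrow>
      w \<in> tangent_space M p \<Longrightarrow> g p (a \<cdot> u + b \<cdot> v) w = a * g p u w + b * g p v w"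
begin

context
  fixes p
  assumes p: "p \<in> carrier_of M"
begin

lemma metric_scale_left:
  "u \<in> tangent_space M p \<Longrightarrow> w \<in> tangent_space M p \<Longrightarrow> g p (a \<cdot> u) w = a * g p u w"
  using metric_linear[OF p, of u u w a 0] by simp

lemma metric_add_left:
  "u \<in> tangent_space M p \<Longrightarrow> v \<in> tangent_space M p \<Longrightarrow> w \<in> tangent_space M p \<Longrightarrow>
   g p (u + v) w = g p u w + g p v w"
  using metric_linear[OF p, of u v w 1 1] by simp

lemma metric_diff_left:
  "u \<in> tangent_space M p \<Longrightarrow> v \<in> tangent_space M p \<Longrightarrow> w \<in> tangent_space M p \<Longrightarrow>
   g p (u - v) w = g p u w - g p v w"
  using metric_linear[OF p, of u v w 1 "- 1"] by simp

lemma metric_uminus_left: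
  "u \<in> tangent_space M p \<Longrightarrow> w \<in> tangent_space M p \<Longrightarrow> g p (- u) w = - g p u w"
  using metric_scale_left[of u w "- 1"] by simp

lemma metric_zero_left: "w \<in> tangent_space M p \<Longrightarrow> g p 0 w = 0"
  using metric_scale_left[of 0 w 0] by simp

lemma metric_sum_left:
  assumes "w \<in> tangent_space M p" "\<And>k. k \<in> K \<Longrightarrow> u k \<in> tangent_space M p"
  shows "g p (\<Sum>k\<in>K. u k) w = (\<Sum>k\<in>K. g p (u k) w)"
  using assms(2)
proof (induction K rule: infinite_finite_induct)
  case (insert k K)
  then show ?case
    using assms(1) metric_add_left[of "u k" "\<Sum>k\<in>K. u k" w]
    by (simp del: sum_fun_apply plus_fun_apply)
qed (simp_all add: metric_zero_left assms)

lemma metric_scale_right: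
  "u \<in> tangent_space M p \<Longrightarrow> w \<in> tangent_space M p \<Longrightarrow> g p w (a \<cdot> u) = a * g p w u"
  using metric_scale_left[of u w a] by (simp add: metric_sym[OF p, of w])

lemma metric_add_right:
  "u \<in> tangent_space M p \<Longrightarrow> v \<in> tangent_space M p \<Longrightarrow> w \<in> tangent_space M p \<Longrightarrow>
   g p w (u + v) = g p w u + g p w v"
  using metric_add_left[of u v w] by (simp add: metric_sym[OF p, of w])

lemma metric_diff_right:
  "u \<in> tangent_space M p \<Longrightarrow> v \<in> tangent_space M p \<Longrightarrow> w \<in> tangent_space M p \<Longrightarrow>
   g p w (u - v) = g p w u - g p w v"
  using metric_diff_left[of u v w] by (simp add: metric_sym[OF p, of w])

lemma metric_uminus_right:
  "u \<in> tangent_space M p \<Longrightarrow> w \<in> tangent_space M p \<Longrightarrow> g p w (- u) = - g p w u"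
  using metric_uminus_left[of u w] by (simp add: metric_sym[OF p, of w])

lemma metric_sum_right:
  assumes "w \<in> tangent_space M p" "\<And>k. k \<in> K \<Longrightarrow> u k \<in> tangent_space M p"
  shows "g p w (\<Sum>k\<in>K. u k) = (\<Sum>k\<in>K. g p w (u k))"
proof -
  have "g p w (\<Sum>k\<in>K. u k) = g p (\<Sum>k\<in>K. u k) w"
    using assms by (intro metric_sym[OF p] tangent_sum)
  then show ?thesis
    using metric_sum_left[OF assms] assms by (simp add: metric_sym[OF p, of w])
qed

lemma metric_sum_scale_left:
  assumes "w \<in> tangent_space M p" "\<And>k. k \<in> K \<Longrightarrow> u k \<in> tangent_space M p"
  shows "g p (\<Sum>k\<in>K. c k \<cdot> u k) w = (\<Sum>k\<in>K. c k * g p (u k) w)"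
  using assms by (simp add: metric_sum_left metric_scale_left del: sum_fun_apply)

lemma metric_sum_scale_right:
  assumes "w \<in> tangent_space M p" "\<And>k. k \<in> K \<Longrightarrow> u k \<in> tangent_space M p"
  shows "g p w (\<Sum>k\<in>K. c k \<cdot> u k) = (\<Sum>k\<in>K. c k * g p w (u k))"
  using assms by (simp add: metric_sum_right metric_scale_right del: sum_fun_apply)

end

definition orthonormal_at :: "'m \<Rightarrow> 'k set \<Rightarrow> ('k \<Rightarrow> 'i \<Rightarrow> 'e) \<Rightarrow> bool" where
  "orthonormal_at p K e \<longleftrightarrow> finite K \<and> (\<forall>k\<in>K. e k \<in> tangent_space M p) \<and>
     (\<forall>k\<in>K. \<forall>l\<in>K. g p (e k) (e l) = (if k = l then 1 else 0))"

context
  fixes p and K :: "'k set" and e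
  assumes p: "p \<in> carrier_of M" and e: "orthonormal_at p K e"
begin

lemma orthonormal_coefficient:
  assumes "l \<in> K"
  shows "g p (\<Sum>k\<in>K. c k \<cdot> e k) (e l) = c l"
proof -
  have "g p (\<Sum>k\<in>K. c k \<cdot> e k) (e l) = (\<Sum>k\<in>K. c k * (if k = l then 1 else 0))"
    using assms e by (simp add: orthonormal_at_def metric_sum_scale_left[OF p] del: sum_fun_apply)
  then show ?thesis
    using assms e by (simp add: orthonormal_at_def if_distrib cong: if_cong)
qed

lemma orthonormal_residual:
  assumes v: "v \<in> tangent_space M p" and l: "l \<in> K"
  shows "g p (v - (\<Sum>k\<in>K. g p v (e k) \<cdot> e k)) (e l) = 0"
  using orthonormal_coefficient[OF l] e v l
  by (simp add: orthonormal_at_def metric_diff_left[OF p] tangent_sum del: sum_fun_apply)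

lemma orthonormal_inj_on:
  assumes i: "i \<in> charts_at M p"
  shows "inj_on (\<lambda>k. e k i) K"
proof (rule inj_onI)
  fix k l assume eq: "k \<in> K" "l \<in> K" "e k i = e l i"
  then have "e k = e l"
    using e tangent_eqI[OF _ _ i] by (simp add: orthonormal_at_def)
  then show "k = l"
    using e eq unfolding orthonormal_at_def by (metis zero_neq_one)
qed

lemma orthonormal_independent:
  assumes i: "i \<in> charts_at M p"
  shows "independent ((\<lambda>k. e k i) ` K)"
proof (rule independent_if_scalars_zero)
  note inj = orthonormal_inj_on[OF i]
  show "finite ((\<lambda>k. e k i) ` K)" using e by (simp add: orthonormal_at_def)
  fix f x assume f: "(\<Sum>x\<in>(\<lambda>k. e k i) ` K. f x *\<^sub>R x) = 0" and "x \<in> (\<lambda>k. e k i) ` K"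
  then obtain l where l: "l \<in> K" "x = e l i" by blast
  have "(\<Sum>k\<in>K. f (e k i) \<cdot> e k) = 0"
  proof (rule tangent_eqI[OF _ tangent_zero i])
    show "(\<Sum>k\<in>K. f (e k i) \<cdot> e k) \<in> tangent_space M p"
      using e by (intro tangent_sum tangent_scale) (simp add: orthonormal_at_def)
    show "(\<Sum>k\<in>K. f (e k i) \<cdot> e k) i = 0 i"
      using f by (simp add: sum.reindex[OF inj])
  qed
  then show "f x = 0"
    using orthonormal_coefficient[OF l(1), of "\<lambda>k. f (e k i)"] metric_zero_left[OF p, of "e l"] e l
    by (simp add: orthonormal_at_def)
qed

lemma orthonormal_expand:
  assumes card: "card K = DIM('e)" and v: "v \<in> tangent_space M p"
  shows "v = (\<Sum>k\<in>K. g p v (e k) \<cdot> e k)"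
proof -
  obtain i where i: "i \<in> charts_at M p"
    using carrier_chart[OF p] by blast
  let ?B = "(\<lambda>k. e k i) ` K"
  note inj = orthonormal_inj_on[OF i]
  have "v i \<in> span ?B"
    using card_ge_dim_independent[of ?B UNIV] orthonormal_independent[OF i] card_image[OF inj] card
    by auto
  then obtain u where u: "v i = (\<Sum>x\<in>?B. u x *\<^sub>R x)"
    using e by (auto simp: span_finite orthonormal_at_def)
  have "v = (\<Sum>k\<in>K. u (e k i) \<cdot> e k)"
  proof (rule tangent_eqI[OF v _ i])
    show "(\<Sum>k\<in>K. u (e k i) \<cdot> e k) \<in> tangent_space M p"
      using e by (intro tangent_sum tangent_scale) (simp add: orthonormal_at_def)
    show "v i = (\<Sum>k\<in>K. u (e k i) \<cdot> e k) i"
      using u by (simp add: sum.reindex[OF inj])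
  qed
  then show ?thesis
    using orthonormal_coefficient[of _ "\<lambda>k. u (e k i)"]
    by (metis (no_types, lifting) sum.cong)
qed

lemma parseval:
  assumes card: "card K = DIM('e)" and u: "u \<in> tangent_space M p" and v: "v \<in> tangent_space M p"
  shows "g p u v = (\<Sum>k\<in>K. g p u (e k) * g p v (e k))"
proof -
  have tangent: "e k \<in> tangent_space M p" if "k \<in> K" for k
    using e that by (simp add: orthonormal_at_def)
  have "g p u v = g p (\<Sum>k\<in>K. g p u (e k) \<cdot> e k) v"
    using orthonormal_expand[OF card u] by simp
  also have "\<dots> = (\<Sum>k\<in>K. g p u (e k) * g p (e k) v)"
    using v tangent by (rule metric_sum_scale_left[OF p])
  also have "\<dots> = (\<Sum>k\<in>K. g p u (e k) * g p v (e k))"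
    using metric_sym[OF p v tangent] by simp
  finally show ?thesis .
qed

end

lemma orthonormal_trace_eq:
  assumes p: "p \<in> carrier_of M"
    and e: "orthonormal_at p K e" "card K = DIM('e)"
    and f: "orthonormal_at p L f" "card L = DIM('e)"
    and left: "\<And>c w. w \<in> tangent_space M p \<Longrightarrow> B (\<Sum>k\<in>K. c k \<cdot> e k) w = (\<Sum>k\<in>K. c k * B (e k) w)"
    and right: "\<And>c u. u \<in> tangent_space M p \<Longrightarrow> B u (\<Sum>k\<in>K. c k \<cdot> e k) = (\<Sum>k\<in>K. c k * B u (e k))"
  shows "(\<Sum>l\<in>L. B (f l) (f l)) = (\<Sum>k\<in>K. B (e k) (e k))"
proof -
  have e_tangent: "e k \<in> tangent_space M p" if "k \<in> K" for k
    using e that by (simp add: orthonormal_at_def)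
  have f_tangent: "f l \<in> tangent_space M p" if "l \<in> L" for l
    using f that by (simp add: orthonormal_at_def)
  let ?c = "\<lambda>l k. g p (f l) (e k)"
  have expand: "B (f l) (f l) = (\<Sum>k\<in>K. \<Sum>k'\<in>K. ?c l k * ?c l k' * B (e k) (e k'))" if "l \<in> L" for l
  proof -
    have "B (f l) (f l) = B (\<Sum>k\<in>K. ?c l k \<cdot> e k) (\<Sum>k\<in>K. ?c l k \<cdot> e k)"
      using orthonormal_expand[OF p e f_tangent[OF that]] by simp
    also have "\<dots> = (\<Sum>k\<in>K. ?c l k * B (e k) (\<Sum>k\<in>K. ?c l k \<cdot> e k))"
      using e_tangent by (intro left tangent_sum tangent_scale)
    also have "\<dots> = (\<Sum>k\<in>K. \<Sum>k'\<in>K. ?c l k * ?c l k' * B (e k) (e k'))"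
      using e_tangent by (simp add: right sum_distrib_left mult.assoc del: sum_fun_apply)
    finally show ?thesis .
  qed
  have gram: "(\<Sum>l\<in>L. ?c l k * ?c l k') = (if k = k' then 1 else 0)" if "k \<in> K" "k' \<in> K" for k k'
  proof -
    have "(\<Sum>l\<in>L. ?c l k * ?c l k') = (\<Sum>l\<in>L. g p (e k) (f l) * g p (e k') (f l))"
      using metric_sym[OF p] e_tangent f_tangent that by (intro sum.cong) simp_all
    then show ?thesis
      using parseval[OF p f e_tangent e_tangent] e that by (simp add: orthonormal_at_def)
  qed
  have "(\<Sum>l\<in>L. B (f l) (f l)) = (\<Sum>l\<in>L. \<Sum>k\<in>K. \<Sum>k'\<in>K. ?c l k * ?c l k' * B (e k) (e k'))"
    by (rule sum.cong[OF refl expand])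
  also have "\<dots> = (\<Sum>k\<in>K. \<Sum>l\<in>L. \<Sum>k'\<in>K. ?c l k * ?c l k' * B (e k) (e k'))"
    by (rule sum.swap)
  also have "\<dots> = (\<Sum>k\<in>K. \<Sum>k'\<in>K. \<Sum>l\<in>L. ?c l k * ?c l k' * B (e k) (e k'))"
    by (intro sum.cong refl sum.swap)
  also have "\<dots> = (\<Sum>k\<in>K. \<Sum>k'\<in>K. if k = k' then B (e k) (e k') else 0)"
    by (intro sum.cong refl) (simp add: sum_distrib_right[symmetric] gram)
  also have "\<dots> = (\<Sum>k\<in>K. B (e k) (e k))"
    using e by (intro sum.cong refl) (simp add: orthonormal_at_def)
  finally show ?thesis .
qed

lemma tensorial_trace_eq:
  assumes U: "mopen M U" "p \<in> U" "U \<subseteq> cdom M i" and i: "i \<in> idx M" and L: "tensorial_at U p L"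
    and L_tangent: "\<And>X. vector_field M U X \<Longrightarrow> L X \<in> tangent_space M p"
    and A: "\<And>u. u \<in> tangent_space M p \<Longrightarrow> A u \<in> tangent_space M p"
      "\<And>c. A (\<Sum>k\<in>K. c k \<cdot> E k p) = (\<Sum>k\<in>K. c k \<cdot> A (E k p))"
    and E: "\<And>k. k \<in> K \<Longrightarrow> vector_field M U (E k)" "orthonormal_at p K (\<lambda>k. E k p)" "card K = DIM('e)"
    and F: "\<And>l. l \<in> K' \<Longrightarrow> vector_field M U (F l)" "orthonormal_at p K' (\<lambda>l. F l p)"
      "card K' = DIM('e)"
  shows "(\<Sum>l\<in>K'. g p (L (F l)) (A (F l p))) = (\<Sum>k\<in>K. g p (L (E k)) (A (E k p)))"
proof -
  have p: "p \<in> carrier_of M" "i \<in> charts_at M p"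
    using U i by (auto simp: charts_at_iff carrier_of_def)
  note const = vector_field_const_field[OF U(1,3) i] and tangent = vector_field_tangent[OF _ U(2)]
  define B where "B u w = g p (L (const_field M i (u i))) (A w)" for u w
  have B: "B (X p) w = g p (L X) (A w)" if X: "vector_field M U X" for X w
    unfolding B_def using tensorial_pointwise[OF L U(1) i U(3) const X, of "X p i"]
      tangent_eq_const_field[OF tangent[OF X] p(2)] by simp
  have "(\<Sum>l\<in>K'. B (F l p) (F l p)) = (\<Sum>k\<in>K. B (E k p) (E k p))"
  proof (rule orthonormal_trace_eq[where B = B, OF p(1) E(2,3) F(2,3)])
    fix d u assume u: "u \<in> tangent_space M p"
    have E_tangent: "(\<Sum>k\<in>K. d k \<cdot> E k p) \<in> tangent_space M p"
      using E tangent by (intro tangent_sum tangent_scale) auto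
    have "L (const_field M i ((\<Sum>k\<in>K. d k \<cdot> E k p) i)) = (\<Sum>k\<in>K. d k \<cdot> L (E k))"
      by (rule tensorial_lincomb_at[OF L U(1) i U(3) const E(1) tangent_eq_const_field[OF
          E_tangent p(2), symmetric]])
    then have "B (\<Sum>k\<in>K. d k \<cdot> E k p) u = (\<Sum>k\<in>K. d k * g p (L (E k)) (A u))"
      using E(1) u L_tangent A(1)
      by (simp add: B_def metric_sum_scale_left[OF p(1)] del: sum_fun_apply)
    then show "B (\<Sum>k\<in>K. d k \<cdot> E k p) u = (\<Sum>k\<in>K. d k * B (E k p) u)"
      using E(1) by (simp add: B del: sum_fun_apply)
    show "B u (\<Sum>k\<in>K. d k \<cdot> E k p) = (\<Sum>k\<in>K. d k * B u (E k p))"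
      unfolding B_def A(2) using E(1) tangent L_tangent[OF const] A(1) 
      by (intro metric_sum_scale_right[OF p(1)]) auto
  qed
  then show ?thesis
    using E(1) F(1) by (simp add: B)
qed

lemma orthonormal_frame_at:
  "orthonormal_frame M g U E \<Longrightarrow> p \<in> U \<Longrightarrow> orthonormal_at p {..<DIM('e)} (\<lambda>k. E k p)"
  by (auto simp: orthonormal_frame_def orthonormal_at_def intro: vector_field_tangent)

lemma orthonormal_frameD:
  assumes "orthonormal_frame M g U E"
  shows "mopen M U" "k < DIM('e) \<Longrightarrow> vector_field M U (E k)"
  using assms by (simp_all add: orthonormal_frame_def)

lemma orthonormal_frame_expand:
  assumes E: "orthonormal_frame M g U E" and p: "p \<in> U" and v: "v \<in> tangent_space M p"
  shows "v = (\<Sum>k<DIM('e). g p v (E k p) \<cdot> E k p)"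
  using orthonormal_expand[OF _ orthonormal_frame_at[OF E p] _ v]
    mopen_carrier[OF orthonormal_frameD(1)[OF E]] p by auto

definition metric_connection ::
    "(('m \<Rightarrow> 'i \<Rightarrow> 'e) \<Rightarrow> ('m \<Rightarrow> 'i \<Rightarrow> 'e) \<Rightarrow> 'm \<Rightarrow> 'i \<Rightarrow> 'e) \<Rightarrow> bool" where
  "metric_connection D \<longleftrightarrow> connection M D \<and>
     (\<forall>U X Y Z. mopen M U \<and> vector_field M U X \<and> vector_field M U Y \<and> vector_field M U Z \<longrightarrow>
        (\<forall>p\<in>U. dir_deriv M X (\<lambda>q. g q (Y q) (Z q)) p
               = g p (D X Y p) (Z p) + g p (Y p) (D X Z p)))"

lemma metric_connection_atlas_connection: "metric_connection D \<Longrightarrow> atlas_connection M D"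
  by (simp add: metric_connection_def atlas_connection_def atlas_connection_axioms_def
      smooth_atlas_axioms)

lemma levi_civita_metric_connection: "levi_civita M g D \<Longrightarrow> metric_connection D"
  unfolding levi_civita_def metric_connection_def by blast

lemma metric_connection_dir_deriv:
  "metric_connection D \<Longrightarrow> mopen M U \<Longrightarrow> vector_field M U X \<Longrightarrow> vector_field M U Y \<Longrightarrow>
   vector_field M U Z \<Longrightarrow> p \<in> U \<Longrightarrow>
   dir_deriv M X (\<lambda>q. g q (Y q) (Z q)) p = g p (D X Y p) (Z p) + g p (Y p) (D X Z p)"
  unfolding metric_connection_def by blast

lemma metric_connection_frame_antisym:
  assumes D: "metric_connection D" and E: "orthonormal_frame M g U E" and p: "p \<in> U"
    and X: "vector_field M U X" and k: "k < DIM('e)" and l: "l < DIM('e)"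
  shows "g p (D X (E k) p) (E l p) = - g p (D X (E l) p) (E k p)"
proof -
  interpret D: atlas_connection M D
    by (rule metric_connection_atlas_connection[OF D])
  note U = orthonormal_frameD(1)[OF E] and frame_field = orthonormal_frameD(2)[OF E]
  have "g p (D X (E k) p) (E l p) + g p (E k p) (D X (E l) p)
      = dir_deriv M X (\<lambda>q. g q (E k q) (E l q)) p"
    by (rule metric_connection_dir_deriv[OF D U X frame_field[OF k] frame_field[OF l] p, symmetric])
  also have "\<dots> = dir_deriv M X (\<lambda>q. if k = l then 1 else 0) p"
    by (rule dir_deriv_cong[OF U p]) (use E k l in \<open>auto simp: orthonormal_frame_def\<close>)
  also have "\<dots> = 0" by (rule dir_deriv_const[OF U p])
  also have "g p (E k p) (D X (E l) p) = g p (D X (E l) p) (E k p)"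
    using mopen_carrier[OF U] p frame_field k l
    by (intro metric_sym vector_field_tangent[OF _ p] D.connection_vector_field[OF U] X) auto
  finally show ?thesis by simp
qed

lemma koszul:
  assumes levi_civita: "levi_civita M g D" and U: "mopen M U" "p \<in> U"
    and X: "vector_field M U X" and Y: "vector_field M U Y" and Z: "vector_field M U Z"
  shows "2 * g p (D X Y p) (Z p) =
    dir_deriv M X (\<lambda>q. g q (Y q) (Z q)) p + dir_deriv M Y (\<lambda>q. g q (X q) (Z q)) p
    - dir_deriv M Z (\<lambda>q. g q (X q) (Y q)) p
    + g p (lie_bracket M X Y p) (Z p) - g p (lie_bracket M X Z p) (Y p)
    - g p (lie_bracket M Y Z p) (X p)"
proof -
  interpret D: atlas_connection M D
    by standard (use levi_civita in \<open>simp add: levi_civita_def\<close>)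
  have bracket: "lie_bracket M V W p = D V W p - D W V p"
    if "vector_field M U V" "vector_field M U W" for V W
    using levi_civita U that unfolding levi_civita_def torsion_free_def by metis
  have p: "p \<in> carrier_of M" by (rule carrier_of_mopen[OF U])
  have tangent: "X p \<in> tangent_space M p" "Y p \<in> tangent_space M p" "Z p \<in> tangent_space M p"
    using X Y Z U by (auto simp: vector_field_tangent)
  have D_tangent: "D V W p \<in> tangent_space M p" if "vector_field M U V" "vector_field M U W" for V W
    using D.connection_vector_field[OF U(1) that] U by (auto simp: vector_field_tangent)
  note D_tangents = D_tangent[OF X Y] D_tangent[OF Y X] D_tangent[OF X Z] D_tangent[OF Z X]
    D_tangent[OF Y Z] D_tangent[OF Z Y]
  note metric = metric_connection_dir_deriv[OF levi_civita_metric_connection[OF levi_civita] U(1)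
      _ _ _ U(2)]
  show ?thesis
    using metric_sym[OF p tangent(1) D_tangents(5)] metric_sym[OF p tangent(1) D_tangents(6)]
      metric_sym[OF p tangent(2) D_tangents(3)] metric_sym[OF p tangent(2) D_tangents(4)]
      metric_sym[OF p tangent(3) D_tangents(1)] metric_sym[OF p tangent(3) D_tangents(2)]
    by (simp add: bracket metric X Y Z metric_diff_left[OF p] tangent D_tangents)
qed

end

lemma sum_antisym_sym_eq_0:
  fixes t :: "'k \<Rightarrow> 'k \<Rightarrow> 'v::real_vector"
  assumes "\<And>k l. k \<in> K \<Longrightarrow> l \<in> K \<Longrightarrow> a k l = - a l k" "\<And>k l. k \<in> K \<Longrightarrow> l \<in> K \<Longrightarrow> t k l = t l k"
  shows "(\<Sum>k\<in>K. \<Sum>l\<in>K. a k l *\<^sub>R t k l) = 0"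
proof -
  have "(\<Sum>k\<in>K. \<Sum>l\<in>K. a k l *\<^sub>R t k l) = (\<Sum>k\<in>K. \<Sum>l\<in>K. - (a l k *\<^sub>R t l k))"
    using assms by (intro sum.cong refl) (metis scaleR_minus_left)
  also have "\<dots> = - (\<Sum>k\<in>K. \<Sum>l\<in>K. a k l *\<^sub>R t k l)"
    by (subst sum.swap) (simp add: sum_negf)
  finally have "2 *\<^sub>R (\<Sum>k\<in>K. \<Sum>l\<in>K. a k l *\<^sub>R t k l) = 0"
    unfolding scaleR_2 by (simp only: eq_neg_iff_add_eq_0)
  then show ?thesis by simp
qed

lemma Basis_enumeration_notin_span:
  fixes b :: "nat \<Rightarrow> 'a::euclidean_space"
  assumes b: "bij_betw b {0..<DIM('a)} Basis" and m: "m < DIM('a)"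
  shows "b m \<notin> span (b ` {..<m})"
proof
  assume "b m \<in> span (b ` {..<m})"
  moreover have "b ` {..<m} \<subseteq> Basis - {b m}" "b m \<in> Basis"
    using b m by (force simp: bij_betw_def inj_on_def)+
  ultimately have "b m \<in> span (Basis - {b m})"
    using span_mono[of "b ` {..<m}" "Basis - {b m}"] by auto
  with \<open>b m \<in> Basis\<close> show False
    using independent_Basis unfolding dependent_def by blast
qed

locale riemannian_atlas = metric_atlas M g
  for M :: "('i, 'm, 'e::euclidean_space) atlas" and g +
  assumes metric_pos: "p \<in> carrier_of M \<Longrightarrow> u \<in> tangent_space M p \<Longrightarrow> u \<noteq> 0 \<Longrightarrow> 0 < g p u u"
    and metric_smooth: "mopen M U \<Longrightarrow> vector_field M U X \<Longrightarrow> vector_field M U Y \<Longrightarrow>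
      smooth_fun M U (\<lambda>p. g p (X p) (Y p))"
begin

lemma metric_nondegenerate:
  assumes U: "mopen M U" "p \<in> U" and V: "vector_field M U V" and W: "vector_field M U W"
    and eq: "\<And>Z. vector_field M U Z \<Longrightarrow> g p (V p) (Z p) = g p (W p) (Z p)"
  shows "V p = W p"
proof (rule ccontr)
  assume "V p \<noteq> W p"
  have p: "p \<in> carrier_of M" by (rule carrier_of_mopen[OF U])
  have tangent: "V p \<in> tangent_space M p" "W p \<in> tangent_space M p"
    using V W U by (auto simp: vector_field_tangent)
  have "0 < g p (V p - W p) (V p - W p)"
    using \<open>V p \<noteq> W p\<close> tangent by (intro metric_pos[OF p]) auto
  also have "\<dots> = g p (V p) ((V - W) p) - g p (W p) ((V - W) p)"
    using tangent by (simp add: metric_diff_left[OF p])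
  also have "\<dots> = 0"
    using eq[OF vector_field_diff[OF U(1) V W]] by (simp del: minus_apply)
  finally show False by simp
qed

definition orthonormal_fields :: "'m set \<Rightarrow> nat \<Rightarrow> (nat \<Rightarrow> 'm \<Rightarrow> 'i \<Rightarrow> 'e) \<Rightarrow> bool" where
  "orthonormal_fields U m E \<longleftrightarrow> (\<forall>k<m. vector_field M U (E k)) \<and>
     (\<forall>p\<in>U. orthonormal_at p {..<m} (\<lambda>k. E k p))"

lemma orthonormal_at_extend:
  assumes p: "p \<in> carrier_of M" and e: "orthonormal_at p {..<m} e" and u: "u \<in> tangent_space M p"
    and unit: "g p u u = 1" and orth: "\<And>k. k < m \<Longrightarrow> g p u (e k) = 0"
  shows "orthonormal_at p {..<Suc m} (e(m := u))"
proof -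
  have "g p (e k) u = 0" if "k < m" for k
    using orth[OF that] metric_sym[OF p _ u] e that by (simp add: orthonormal_at_def)
  then show ?thesis
    using e u unit orth by (simp add: orthonormal_at_def lessThan_Suc)
qed

definition normalize_at :: "'m \<Rightarrow> ('i \<Rightarrow> 'e) \<Rightarrow> 'i \<Rightarrow> 'e" where
  "normalize_at p u = (g p u u powr (- 1 / 2)) \<cdot> u"

lemma metric_normalize_at:
  assumes p: "p \<in> carrier_of M" and u: "u \<in> tangent_space M p" "u \<noteq> 0"
  shows "g p (normalize_at p u) (normalize_at p u) = 1"
proof -
  have "g p (normalize_at p u) (normalize_at p u)
      = g p u u powr (- 1 / 2) * g p u u powr (- 1 / 2) * g p u u"
    using u(1) by (simp add: normalize_at_def metric_scale_left[OF p] metric_scale_right[OF p])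
  then show ?thesis
    using metric_pos[OF p u] by (simp add: powr_add[symmetric] powr_minus_divide)
qed

lemma vector_field_normalize_at:
  assumes U: "mopen M U" and X: "vector_field M U X" and nonzero: "\<And>p. p \<in> U \<Longrightarrow> X p \<noteq> 0"
  shows "vector_field M U (\<lambda>p. normalize_at p (X p))"
  unfolding normalize_at_def
  using mopen_carrier[OF U] vector_field_tangent[OF X] nonzero
  by (intro vector_field_scale smooth_fun_powr metric_smooth metric_pos U X) auto

lemma gram_schmidt_step:
  assumes U: "mopen M U" and E: "orthonormal_fields U m E" and X: "vector_field M U X"
    and W_def: "W = (\<lambda>p. X p - (\<Sum>k<m. g p (X p) (E k p) \<cdot> E k p))" and W: "\<And>p. p \<in> U \<Longrightarrow> W p \<noteq> 0"
  shows "orthonormal_fields U (Suc m) (E(m := \<lambda>p. normalize_at p (W p)))"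
proof -
  let ?F = "\<lambda>p. normalize_at p (W p)"
  have frame_field: "vector_field M U (E k)" if "k < m" for k
    using E that by (simp add: orthonormal_fields_def)
  have "vector_field M U (X - (\<Sum>k<m. (\<lambda>p. g p (X p) (E k p) \<cdot> E k p)))"
    using frame_field
    by (intro vector_field_diff vector_field_sum vector_field_scale metric_smooth U X) auto
  moreover have "X - (\<Sum>k<m. (\<lambda>p. g p (X p) (E k p) \<cdot> E k p)) = W"
    by (simp add: W_def fun_eq_iff)
  ultimately have W_field: "vector_field M U W" by simp
  note F_field = vector_field_normalize_at[OF U W_field W]
  have "orthonormal_at p {..<Suc m} ((\<lambda>k. E k p)(m := ?F p))" if p: "p \<in> U" for p
  proof -
    have carrier: "p \<in> carrier_of M" by (rule carrier_of_mopen[OF U p])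
    note W_tangent = vector_field_tangent[OF W_field p]
    show ?thesis
    proof (rule orthonormal_at_extend[OF carrier])
      show e: "orthonormal_at p {..<m} (\<lambda>k. E k p)"
        using E p by (simp add: orthonormal_fields_def)
      show "g p (?F p) (E k p) = 0" if "k < m" for k
        using orthonormal_residual[OF carrier e vector_field_tangent[OF X p], of k] that W_tangent
          vector_field_tangent[OF frame_field[OF that] p]
        by (simp add: normalize_at_def metric_scale_left[OF carrier] W_def)
      show "?F p \<in> tangent_space M p"
        by (rule vector_field_tangent[OF F_field p])
      show "g p (?F p) (?F p) = 1"
        by (rule metric_normalize_at[OF carrier W_tangent W[OF p]])
    qed
  qed
  moreover have "(\<lambda>k. (E(m := ?F)) k p) = (\<lambda>k. E k p)(m := ?F p)" for p
    by (simp add: fun_eq_iff)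
  ultimately show ?thesis
    using frame_field F_field by (simp add: orthonormal_fields_def less_Suc_eq)
qed

text \<open>The span condition is what keeps the next coordinate field outside the span of the
  vectors already constructed.\<close>

lemma gram_schmidt_step_span:
  fixes b :: "nat \<Rightarrow> 'e"
  assumes i: "i \<in> idx M" and E: "orthonormal_fields (cdom M i) m E"
    and E_span: "\<And>p k. p \<in> cdom M i \<Longrightarrow> k < m \<Longrightarrow> E k p i \<in> span (b ` {..<m})"
    and b: "b m \<notin> span (b ` {..<m})"
  obtains F where "orthonormal_fields (cdom M i) (Suc m) F"
    "\<And>p k. p \<in> cdom M i \<Longrightarrow> k < Suc m \<Longrightarrow> F k p i \<in> span (b ` {..<Suc m})"
proof -
  let ?U = "cdom M i" and ?X = "const_field M i (b m)"
  have U: "mopen M ?U" by (rule mopen_cdom[OF i])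
  define W where "W = (\<lambda>p. ?X p - (\<Sum>k<m. g p (?X p) (E k p) \<cdot> E k p))"
  let ?F = "\<lambda>p. normalize_at p (W p)"
  have projection: "(\<Sum>k<m. g p (?X p) (E k p) \<cdot> E k p) i \<in> span (b ` {..<m})" if "p \<in> ?U" for p
    using E_span[OF that] by (auto intro!: span_sum span_scale)
  have W_component: "W p i = b m - (\<Sum>k<m. g p (?X p) (E k p) \<cdot> E k p) i" if "p \<in> ?U" for p
    using that i by (simp add: W_def const_field_apply charts_at_iff)
  then have "W p i \<noteq> 0" if "p \<in> ?U" for p
    using projection[OF that] b that by (metis eq_iff_diff_eq_0)
  then have "W p \<noteq> 0" if "p \<in> ?U" for p
    using that by force
  then have step: "orthonormal_fields ?U (Suc m) (E(m := ?F))"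
    by (intro gram_schmidt_step[OF U E vector_field_const_field[OF U order_refl i] W_def])
  have "W p i \<in> span (b ` {..<Suc m})" if "p \<in> ?U" for p
    unfolding W_component[OF that]
    by (rule span_diff[OF span_base subsetD[OF span_mono projection[OF that]]]) auto
  moreover have "E k p i \<in> span (b ` {..<Suc m})" if "p \<in> ?U" "k < m" for p k
    by (rule subsetD[OF span_mono E_span[OF that]]) auto
  ultimately have "(E(m := ?F)) k p i \<in> span (b ` {..<Suc m})" if "p \<in> ?U" "k < Suc m" for p k
    using that by (auto simp: less_Suc_eq normalize_at_def span_scale)
  with step show thesis by (rule that)
qed

lemma exists_orthonormal_frame:
  assumes i: "i \<in> idx M"
  shows "\<exists>E. orthonormal_frame M g (cdom M i) E"
proof -
  obtain b :: "nat \<Rightarrow> 'e" where b: "bij_betw b {0..<DIM('e)} Basis"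
    using ex_bij_betw_nat_finite[OF finite_Basis] by blast
  have "\<exists>E. orthonormal_fields (cdom M i) m E \<and>
      (\<forall>p\<in>cdom M i. \<forall>k<m. E k p i \<in> span (b ` {..<m}))" if "m \<le> DIM('e)" for m
    using that
  proof (induction m)
    case 0
    then show ?case by (simp add: orthonormal_fields_def orthonormal_at_def)
  next
    case (Suc m)
    then obtain E where "orthonormal_fields (cdom M i) m E"
      and "\<And>p k. p \<in> cdom M i \<Longrightarrow> k < m \<Longrightarrow> E k p i \<in> span (b ` {..<m})"
      by auto
    moreover have "b m \<notin> span (b ` {..<m})"
      using Basis_enumeration_notin_span[OF b] Suc.prems by simp
    ultimately show ?case
      using gram_schmidt_step_span[OF i] by metis
  qed
  from this[of "DIM('e)"] show ?thesis
    using mopen_cdom[OF i]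
    by (auto simp: orthonormal_frame_def orthonormal_fields_def orthonormal_at_def)
qed

lemma tensorial_at_metricI:
  assumes U: "mopen M U" and p: "p \<in> U"
    and L: "\<And>X. vector_field M U X \<Longrightarrow> vector_field M U (L X)"
    and cong: "\<And>X X' Z. vector_field M U X \<Longrightarrow> vector_field M U X' \<Longrightarrow> vector_field M U Z \<Longrightarrow>
      (\<And>q. q \<in> U \<Longrightarrow> X q = X' q) \<Longrightarrow> g p (L X p) (Z p) = g p (L X' p) (Z p)"
    and add: "\<And>X X' Z. vector_field M U X \<Longrightarrow> vector_field M U X' \<Longrightarrow> vector_field M U Z \<Longrightarrow>
      g p (L (X + X') p) (Z p) = g p (L X p) (Z p) + g p (L X' p) (Z p)"
    and scale: "\<And>X f Z. vector_field M U X \<Longrightarrow> smooth_fun M U f \<Longrightarrow> vector_field M U Z \<Longrightarrow>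
      g p (L (\<lambda>q. f q \<cdot> X q) p) (Z p) = f p * g p (L X p) (Z p)"
  shows "tensorial_at U p (\<lambda>X. L X p)"
proof (rule tensorial_atI)
  have carrier: "p \<in> carrier_of M" by (rule carrier_of_mopen[OF U p])
  note tangent = vector_field_tangent[OF _ p]
    and vector_fields = vector_field_add[OF U] vector_field_scale[OF U]
  fix X assume X: "vector_field M U X"
  show "L (\<lambda>q. f q \<cdot> X q) p = f p \<cdot> L X p" if "smooth_fun M U f" for f
    using metric_nondegenerate[OF U p L[OF vector_fields(2)[OF that X]]
        vector_fields(2)[OF that L[OF X]]]
      scale[OF X that] tangent[OF L[OF X]] tangent by (simp add: metric_scale_left[OF carrier])
  fix X' assume X': "vector_field M U X'"
  show "L X p = L X' p" if "\<And>q. q \<in> U \<Longrightarrow> X q = X' q"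
    by (rule metric_nondegenerate[OF U p L[OF X] L[OF X']]) (rule cong[OF X X' _ that])
  show "L (X + X') p = L X p + L X' p"
    using metric_nondegenerate[OF U p L[OF vector_fields(1)[OF X X']]
        vector_fields(1)[OF L[OF X] L[OF X']]]
      add[OF X X'] tangent[OF L[OF X]] tangent[OF L[OF X']] tangent
    by (simp add: metric_add_left[OF carrier])
qed

context
  fixes T Ts U
  assumes T: "tensor_field T" and adjoint: "adjoint_tensor M g T Ts" and U: "mopen M U"
begin

lemma adjoint_vector_field: "vector_field M U X \<Longrightarrow> vector_field M U Y \<Longrightarrow> vector_field M U (Ts X Y)"
  using adjoint U unfolding adjoint_tensor_def by blast

lemma metric_adjoint:
  "vector_field M U X \<Longrightarrow> vector_field M U Y \<Longrightarrow> vector_field M U Z \<Longrightarrow> p \<in> U \<Longrightarrow>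
   g p (Ts X Y p) (Z p) = g p (Y p) (T X Z p)"
  using adjoint U unfolding adjoint_tensor_def by blast

lemma adjoint_tensorial_left:
  assumes Y: "vector_field M U Y" and p: "p \<in> U"
  shows "tensorial_at U p (\<lambda>X. Ts X Y p)"
proof (rule tensorial_at_metricI[OF U p adjoint_vector_field[OF _ Y]])
  have carrier: "p \<in> carrier_of M" by (rule carrier_of_mopen[OF U p])
  note tangent = vector_field_tangent[OF Y p]
    vector_field_tangent[OF tensor_field_vector_field[OF T U] p]
  note left = tensor_field_tensorial_left[OF T U p]
  fix X Z assume X: "vector_field M U X" and Z: "vector_field M U Z"
  note pair = metric_adjoint[OF _ Y Z p]
  show "g p (Ts (\<lambda>q. f q \<cdot> X q) Y p) (Z p) = f p * g p (Ts X Y p) (Z p)" if "smooth_fun M U f" for f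
    using tensorial_scale[OF left[OF Z] U X that]
    by (simp add: pair vector_field_scale[OF U] X Z that tangent metric_scale_right[OF carrier])
  fix X' assume X': "vector_field M U X'"
  show "g p (Ts X Y p) (Z p) = g p (Ts X' Y p) (Z p)" if "\<And>q. q \<in> U \<Longrightarrow> X q = X' q"
    using tensorial_cong[OF left[OF Z] U X X' that] by (simp add: pair X X')
  show "g p (Ts (X + X') Y p) (Z p) = g p (Ts X Y p) (Z p) + g p (Ts X' Y p) (Z p)"
    using tensorial_add[OF left[OF Z] U X X']
    by (simp add: pair vector_field_add[OF U] X X' Z tangent metric_add_right[OF carrier])
qed

lemma adjoint_tensorial_right:
  assumes X: "vector_field M U X" and p: "p \<in> U"
  shows "tensorial_at U p (\<lambda>Y. Ts X Y p)"
proof (rule tensorial_at_metricI[OF U p adjoint_vector_field[OF X]])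
  have carrier: "p \<in> carrier_of M" by (rule carrier_of_mopen[OF U p])
  fix Y Z assume Y: "vector_field M U Y" and Z: "vector_field M U Z"
  note pair = metric_adjoint[OF X _ Z p]
  note tangent = vector_field_tangent[OF _ p]
    vector_field_tangent[OF tensor_field_vector_field[OF T U X Z] p]
  show "g p (Ts X (\<lambda>q. f q \<cdot> Y q) p) (Z p) = f p * g p (Ts X Y p) (Z p)" if "smooth_fun M U f" for f
    using pair[OF vector_field_scale[OF U that Y]]
    by (simp add: pair Y tangent metric_scale_left[OF carrier])
  fix Y' assume Y': "vector_field M U Y'"
  show "g p (Ts X Y p) (Z p) = g p (Ts X Y' p) (Z p)" if "\<And>q. q \<in> U \<Longrightarrow> Y q = Y' q"
    by (simp add: pair Y Y' that p)
  show "g p (Ts X (Y + Y') p) (Z p) = g p (Ts X Y p) (Z p) + g p (Ts X Y' p) (Z p)"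
    using pair[OF vector_field_add[OF U Y Y']]
    by (simp add: pair Y Y' tangent metric_add_left[OF carrier])
qed

end

lemma tensor_field_adjoint: "tensor_field T \<Longrightarrow> adjoint_tensor M g T Ts \<Longrightarrow> tensor_field Ts"
  unfolding tensor_field_def[of Ts]
  by (blast intro: adjoint_vector_field adjoint_tensorial_left adjoint_tensorial_right)

lemma tensorial_frame_expand:
  assumes E: "orthonormal_frame M g U E" and L: "tensorial_at U p L" and Y: "vector_field M U Y"
  shows "L Y = (\<Sum>k<DIM('e). g p (Y p) (E k p) \<cdot> L (E k))"
  by (rule tensorial_lincomb[OF L])
    (use E orthonormal_frame_expand[OF E] Y in \<open>auto simp: orthonormal_frame_def
      intro: metric_smooth dest: vector_field_tangent\<close>)

theorem frame_trace_cov_deriv: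
  assumes D: "metric_connection D" and T: "tensor_field T" and E: "orthonormal_frame M g U E"
    and X: "vector_field M U X" and p: "p \<in> U"
  shows "frame_trace E (cov_deriv D X T) p = D X (frame_trace E T) p"
proof
  fix j
  interpret D: atlas_connection M D
    by (rule metric_connection_atlas_connection[OF D])
  note U = orthonormal_frameD(1)[OF E] and frame_field = orthonormal_frameD(2)[OF E]
  have D_field: "vector_field M U (D X (E k))" if "k < DIM('e)" for k
    by (rule D.connection_vector_field[OF U X frame_field[OF that]])
  define a where "a k l = g p (D X (E k) p) (E l p)" for k l
  have anti: "a k l = - a l k" if "k \<in> {..<DIM('e)}" "l \<in> {..<DIM('e)}" for k l
    unfolding a_def by (rule metric_connection_frame_antisym[OF D E p X]) (use that in simp_all)
  have frame_terms: "T (D X (E k)) (E k) p j + T (E k) (D X (E k)) p j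
      = (\<Sum>l<DIM('e). a k l *\<^sub>R (T (E l) (E k) p j + T (E k) (E l) p j))" if k: "k < DIM('e)" for k
  proof -
    have "T (D X (E k)) (E k) p = (\<Sum>l<DIM('e). a k l \<cdot> T (E l) (E k) p)"
      "T (E k) (D X (E k)) p = (\<Sum>l<DIM('e). a k l \<cdot> T (E k) (E l) p)"
      using tensorial_frame_expand[OF E tensor_field_tensorial_left[OF T U p frame_field[OF k]]
          D_field[OF k]]
        tensorial_frame_expand[OF E tensor_field_tensorial_right[OF T U p frame_field[OF k]]
          D_field[OF k]]
      unfolding a_def by blast+
    then show ?thesis by (simp add: scaleR_add_right sum.distrib)
  qed
  have "frame_trace E (cov_deriv D X T) p j
      = (\<Sum>k<DIM('e). D X (T (E k) (E k)) p j)
        - (\<Sum>k<DIM('e). T (D X (E k)) (E k) p j + T (E k) (D X (E k)) p j)"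
    by (simp add: frame_trace_def cov_deriv_def sum_subtractf[symmetric] algebra_simps)
  also have "(\<Sum>k<DIM('e). T (D X (E k)) (E k) p j + T (E k) (D X (E k)) p j)
      = (\<Sum>k<DIM('e). \<Sum>l<DIM('e). a k l *\<^sub>R (T (E l) (E k) p j + T (E k) (E l) p j))"
    by (rule sum.cong[OF refl]) (rule frame_terms, simp)
  also have "\<dots> = 0"
    by (rule sum_antisym_sym_eq_0, rule anti) (simp_all add: add.commute)
  also have "(\<Sum>k<DIM('e). D X (T (E k) (E k)) p j) = D X (frame_trace E T) p j"
    unfolding frame_trace_def
    by (subst D.connection_sum_right[OF U X p])
      (simp_all add: tensor_field_vector_field[OF T U] frame_field)
  finally show "frame_trace E (cov_deriv D X T) p j = D X (frame_trace E T) p j" by simp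
qed

corollary trace_vanishes_cov_deriv:
  assumes D: "metric_connection D" and T: "tensor_field T" and trace: "trace_vanishes M g T"
    and X: "vector_field M (carrier_of M) X"
  shows "trace_vanishes M g (cov_deriv D X T)"
  unfolding trace_vanishes_def
proof (intro allI impI ballI)
  fix U E p assume E: "orthonormal_frame M g U E" and p: "p \<in> U"
  interpret D: atlas_connection M D
    by (rule metric_connection_atlas_connection[OF D])
  note U = orthonormal_frameD(1)[OF E] and frame_field = orthonormal_frameD(2)[OF E]
  have X_restrict: "vector_field M U X"
    by (rule vector_field_subset[OF X mopen_carrier[OF U]])
  have "vector_field M U (frame_trace E T)"
    unfolding frame_trace_def using frame_field
    by (intro vector_field_sum[OF U] tensor_field_vector_field[OF T U]) auto
  then have "D X (frame_trace E T) p = D X 0 p"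
    by (rule D.connection_cong[OF U X_restrict X_restrict _ vector_field_zero[OF U] refl _ p])
      (use trace E in \<open>simp add: trace_vanishes_def\<close>)
  then show "frame_trace E (cov_deriv D X T) p = 0"
    using frame_trace_cov_deriv[OF D T E X_restrict p] D.connection_zero_right[OF U X_restrict p]
    by simp
qed

context
  fixes D U E p X L
  assumes D: "metric_connection D" and E: "orthonormal_frame M g U E" and p: "p \<in> U"
    and X: "vector_field M U X" and L: "\<And>Y. vector_field M U Y \<Longrightarrow> vector_field M U (L Y)"
    and tensorial: "tensorial_at U p (\<lambda>Y. L Y p)"
begin

private lemma metric_connection_commutator:
  assumes k: "k < DIM('e)"
  shows "g p (D X (L (E k)) p - L (D X (E k)) p) (E k p)
    = dir_deriv M X (\<lambda>q. g q (L (E k) q) (E k q)) p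
      - (\<Sum>l<DIM('e). g p (D X (E k) p) (E l p) *\<^sub>R
          (g p (L (E k) p) (E l p) + g p (L (E l) p) (E k p)))"
proof -
  interpret D: atlas_connection M D
    by (rule metric_connection_atlas_connection[OF D])
  note U = orthonormal_frameD(1)[OF E] and frame_field = orthonormal_frameD(2)[OF E]
  have carrier: "p \<in> carrier_of M" by (rule carrier_of_mopen[OF U p])
  note tangent = vector_field_tangent[OF _ p] and Ek = frame_field[OF k]
  note DEk = D.connection_vector_field[OF U X Ek]
  define a where "a l = g p (D X (E k) p) (E l p)" for l
  have "D X (E k) p = (\<Sum>l<DIM('e). a l \<cdot> E l p)"
    unfolding a_def by (rule orthonormal_frame_expand[OF E p tangent[OF DEk]])
  then have "g p (L (E k) p) (D X (E k) p) = (\<Sum>l<DIM('e). a l * g p (L (E k) p) (E l p))"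
    using metric_sum_scale_right[OF carrier tangent[OF L[OF Ek]], of "{..<DIM('e)}" "\<lambda>l. E l p" a]
      frame_field tangent by simp
  moreover have "L (D X (E k)) p = (\<Sum>l<DIM('e). a l \<cdot> L (E l) p)"
    unfolding a_def by (rule tensorial_frame_expand[OF E tensorial DEk])
  then have "g p (L (D X (E k)) p) (E k p) = (\<Sum>l<DIM('e). a l * g p (L (E l) p) (E k p))"
    using metric_sum_scale_left[OF carrier tangent[OF Ek], of "{..<DIM('e)}" "\<lambda>l. L (E l) p" a]
      frame_field tangent L by simp
  moreover have "dir_deriv M X (\<lambda>q. g q (L (E k) q) (E k q)) p
      = g p (D X (L (E k)) p) (E k p) + g p (L (E k) p) (D X (E k) p)"
    by (rule metric_connection_dir_deriv[OF D U X L[OF Ek] Ek p])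
  ultimately show ?thesis
    using metric_diff_left[OF carrier tangent[OF D.connection_vector_field[OF U X L[OF Ek]]]
        tangent[OF L[OF DEk]] tangent[OF Ek]]
    by (simp add: a_def sum.distrib algebra_simps)
qed

lemma trace_connection_commutator:
  "(\<Sum>k<DIM('e). g p (D X (L (E k)) p - L (D X (E k)) p) (E k p))
    = dir_deriv M X (\<lambda>q. \<Sum>k<DIM('e). g q (L (E k) q) (E k q)) p"
proof -
  note U = orthonormal_frameD(1)[OF E] and frame_field = orthonormal_frameD(2)[OF E]
  let ?a = "\<lambda>k l. g p (D X (E k) p) (E l p)" and ?s = "\<lambda>k l. g p (L (E k) p) (E l p)"
  have antisym: "?a k l = - ?a l k" if "k \<in> {..<DIM('e)}" "l \<in> {..<DIM('e)}" for k l
    by (rule metric_connection_frame_antisym[OF D E p X]) (use that in simp_all)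
  have "(\<Sum>k<DIM('e). g p (D X (L (E k)) p - L (D X (E k)) p) (E k p))
      = (\<Sum>k<DIM('e). dir_deriv M X (\<lambda>q. g q (L (E k) q) (E k q)) p)
        - (\<Sum>k<DIM('e). \<Sum>l<DIM('e). ?a k l *\<^sub>R (?s k l + ?s l k))"
    by (simp add: metric_connection_commutator sum_subtractf)
  also have "(\<Sum>k<DIM('e). \<Sum>l<DIM('e). ?a k l *\<^sub>R (?s k l + ?s l k)) = 0"
    by (rule sum_antisym_sym_eq_0, rule antisym) (simp_all add: add.commute)
  finally show ?thesis
    using dir_deriv_sum[OF U p, of "{..<DIM('e)}" "\<lambda>k q. g q (L (E k) q) (E k q)" X]
      metric_smooth[OF U L[OF frame_field] frame_field] vector_field_tangent[OF X p]
    by (simp del: minus_apply)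
qed

end

end

section \<open>The tangent bundle\<close>

definition bundle_over ::
    "('i, 'm, 'e::euclidean_space) atlas \<Rightarrow> 'm set \<Rightarrow> ('m \<times> ('i \<Rightarrow> 'e)) set" where
  "bundle_over M U = {(p, v). p \<in> U \<and> v \<in> tangent_space M p}"

lemma bundle_over_iff [simp]: "(p, v) \<in> bundle_over M U \<longleftrightarrow> p \<in> U \<and> v \<in> tangent_space M p"
  by (simp add: bundle_over_def)

lemma tangent_bundle_simps [simp]:
  "idx (tangent_bundle M) = idx M"
  "cdom (tangent_bundle M) i = bundle_over M (cdom M i)"
  "chart (tangent_bundle M) i (p, v) = (chart M i p, v i)"
  by (simp_all add: tangent_bundle_def bundle_over_def)

lemma charts_at_bundle [simp]:
  "v \<in> tangent_space M p \<Longrightarrow> charts_at (tangent_bundle M) (p, v) = charts_at M p"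
  by (simp add: charts_at_def)

lemma carrier_bundle: "carrier_of (tangent_bundle M) = bundle_over M (carrier_of M)"
  by (auto simp: carrier_of_def bundle_over_def)

context smooth_atlas
begin

lemma chart_bundle_image:
  assumes "i \<in> idx M"
  shows "chart (tangent_bundle M) i ` (bundle_over M U \<inter> cdom (tangent_bundle M) i)
    = chart M i ` (U \<inter> cdom M i) \<times> UNIV"
proof (intro equalityI subsetI)
  fix z assume "z \<in> chart (tangent_bundle M) i ` (bundle_over M U \<inter> cdom (tangent_bundle M) i)"
  then obtain \<xi> where "\<xi> \<in> bundle_over M U" "\<xi> \<in> bundle_over M (cdom M i)"
    "z = chart (tangent_bundle M) i \<xi>"
    by auto
  then show "z \<in> chart M i ` (U \<inter> cdom M i) \<times> UNIV"
    by (cases \<xi>) auto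
next
  fix z assume "z \<in> chart M i ` (U \<inter> cdom M i) \<times> (UNIV :: 'e set)"
  then obtain p y where p: "p \<in> U" "p \<in> cdom M i" and z: "z = (chart M i p, y)"
    by auto
  have "z = chart (tangent_bundle M) i (p, const_field M i y p)"
    using z p assms by (simp add: const_field_apply charts_at_iff)
  moreover have "(p, const_field M i y p) \<in> bundle_over M U \<inter> cdom (tangent_bundle M) i"
    using p by simp
  ultimately show "z \<in> chart (tangent_bundle M) i ` (bundle_over M U \<inter> cdom (tangent_bundle M) i)"
    by blast
qed

lemma inj_chart_bundle:
  assumes "i \<in> idx M"
  shows "inj_on (chart (tangent_bundle M) i) (cdom (tangent_bundle M) i)"
proof (rule inj_onI)
  fix \<xi> \<eta> assume *: "\<xi> \<in> cdom (tangent_bundle M) i" "\<eta> \<in> cdom (tangent_bundle M) i"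
    "chart (tangent_bundle M) i \<xi> = chart (tangent_bundle M) i \<eta>"
  obtain p v q w where [simp]: "\<xi> = (p, v)" "\<eta> = (q, w)" by (cases \<xi>, cases \<eta>)
  have "p = q" using * inj_chart[OF assms] by (auto dest: inj_onD)
  then show "\<xi> = \<eta>" using * tangent_eqI[of v p w i] assms by (auto simp: charts_at_iff)
qed

lemma param_bundle:
  assumes "i \<in> idx M" "p \<in> cdom M i"
  shows "param (tangent_bundle M) i (chart M i p, y) = (p, const_field M i y p)"
proof -
  have "chart (tangent_bundle M) i (p, const_field M i y p) = (chart M i p, y)"
    using assms by (simp add: const_field_apply charts_at_iff)
  moreover have "(p, const_field M i y p) \<in> cdom (tangent_bundle M) i"
    using assms by simp
  ultimately show ?thesis
    unfolding param_def using inv_into_f_f[OF inj_chart_bundle[OF assms(1)]] by metis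
qed

lemma transition_bundle:
  assumes "i \<in> idx M" "j \<in> idx M" "x \<in> chart M i ` (cdom M i \<inter> cdom M j)"
  shows "transition (tangent_bundle M) i j (x, y)
    = (transition M i j x, frechet_derivative (transition M i j) (at x) y)"
proof -
  obtain p where p: "p \<in> cdom M i" "p \<in> cdom M j" "x = chart M i p"
    using assms by blast
  then show ?thesis
    using assms param_bundle[OF assms(1) p(1)]
    by (simp add: transition_def[of "tangent_bundle M"] const_field_def charts_at_iff dtrans_def)
qed

lemma cdom_bundle_Int:
  "cdom (tangent_bundle M) i \<inter> cdom (tangent_bundle M) j
    = bundle_over M (cdom M i \<inter> cdom M j) \<inter> cdom (tangent_bundle M) i"
  by auto

lemma overlap_bundle:
  assumes "i \<in> idx M"
  shows "chart (tangent_bundle M) i ` (cdom (tangent_bundle M) i \<inter> cdom (tangent_bundle M) j)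
    = chart M i ` (cdom M i \<inter> cdom M j) \<times> UNIV"
  unfolding cdom_bundle_Int chart_bundle_image[OF assms] by (simp add: Int_ac)

lemma smooth_atlas_bundle: "smooth_atlas (tangent_bundle M)"
proof
  show "inj_on (chart (tangent_bundle M) i) (cdom (tangent_bundle M) i)"
    if "i \<in> idx (tangent_bundle M)" for i
    using inj_chart_bundle that by simp
  fix i j assume "i \<in> idx (tangent_bundle M)" "j \<in> idx (tangent_bundle M)"
  then have ij: "i \<in> idx M" "j \<in> idx M" by simp_all
  let ?S = "chart M i ` (cdom M i \<inter> cdom M j)"
  have S: "open ?S" by (rule open_overlap[OF ij])
  show "open (chart (tangent_bundle M) i ` (cdom (tangent_bundle M) i \<inter> cdom (tangent_bundle M) j))"
    unfolding overlap_bundle[OF ij(1)] using S by (simp add: open_Times)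
  have "smooth_on (?S \<times> UNIV) (\<lambda>z. (transition M i j (fst z),
      frechet_derivative (transition M i j) (at (fst z)) (snd z)))"
    by (intro smooth_on_Pair smooth_on_fst_compose smooth_on_frechet_derivative_snd S
        smooth_transition ij open_Times open_UNIV)
  then show "smooth_on
      (chart (tangent_bundle M) i ` (cdom (tangent_bundle M) i \<inter> cdom (tangent_bundle M) j))
      (transition (tangent_bundle M) i j)"
    unfolding overlap_bundle[OF ij(1)]
    by (rule smooth_on_cong[rotated]) (use S transition_bundle[OF ij] in \<open>auto simp: open_Times\<close>)
qed

lemma dtrans_bundle:
  assumes "i \<in> charts_at M p" "j \<in> charts_at M p"
  shows "dtrans (tangent_bundle M) i j (p, v) (a, b) = (dtrans M i j p a,
    frechet_derivative (\<lambda>x. frechet_derivative (transition M i j) (at x) (v i)) (at (chart M i p)) a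
    + dtrans M i j p b)"
proof -
  let ?S = "chart M i ` (cdom M i \<inter> cdom M j)" and ?f = "transition M i j" and ?x = "chart M i p"
  let ?F = "\<lambda>z. (?f (fst z), frechet_derivative ?f (at (fst z)) (snd z))"
  have ij: "i \<in> idx M" "j \<in> idx M" "?x \<in> ?S" using assms by (auto simp: charts_at_iff)
  have S: "open ?S" "open (?S \<times> (UNIV :: 'e set))" "(?x, v i) \<in> ?S \<times> UNIV"
    using open_overlap[OF ij(1,2)] ij(3) by (auto simp: open_Times)
  have "dtrans (tangent_bundle M) i j (p, v) = frechet_derivative ?F (at (?x, v i))"
    unfolding dtrans_def
    using frechet_derivative_cong_open[OF S(2,3), of "transition (tangent_bundle M) i j" ?F]
      transition_bundle[OF ij(1,2)] by auto
  also have "(?F has_derivative (\<lambda>w. (dtrans M i j p (fst w), dtrans M i j p (snd w)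
      + frechet_derivative (\<lambda>y. frechet_derivative ?f (at y) (v i)) (at ?x) (fst w))))
        (at (?x, v i))"
    unfolding dtrans_def
    using diff_chain_at[OF has_derivative_fst[OF has_derivative_ident, of "at (?x, v i)"],
        of ?f "dtrans M i j p"] has_derivative_transition[OF assms]
    by (intro has_derivative_Pair has_derivative_frechet_derivative_snd[OF S(1) ij(3)]
        smooth_transition ij) (simp add: o_def dtrans_def)
  then have "frechet_derivative ?F (at (?x, v i)) = (\<lambda>w. (dtrans M i j p (fst w),
      dtrans M i j p (snd w)
      + frechet_derivative (\<lambda>y. frechet_derivative ?f (at y) (v i)) (at ?x) (fst w)))"
    by (rule frechet_derivative_at[symmetric])
  finally show ?thesis by (simp add: add.commute)
qed

lemma mopen_bundle_over:
  assumes "mopen M U"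
  shows "mopen (tangent_bundle M) (bundle_over M U)"
  unfolding mopen_def
proof (intro conjI ballI)
  show "bundle_over M U \<subseteq> carrier_of (tangent_bundle M)"
    using mopen_carrier[OF assms] by (auto simp: carrier_bundle)
  fix i assume "i \<in> idx (tangent_bundle M)"
  then show "open (chart (tangent_bundle M) i ` (bundle_over M U \<inter> cdom (tangent_bundle M) i))"
    using mopen_imp_open[OF assms] by (subst chart_bundle_image) (auto simp: open_Times)
qed

lemma smooth_fun_bundle:
  assumes U: "mopen M U" and f: "smooth_fun M U f"
  shows "smooth_fun (tangent_bundle M) (bundle_over M U) (\<lambda>\<xi>. f (fst \<xi>))"
  unfolding smooth_fun_def
proof
  fix i assume "i \<in> idx (tangent_bundle M)"
  then have i: "i \<in> idx M" by simp
  note S = mopen_imp_open[OF U i]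
  show "smooth_on (chart (tangent_bundle M) i ` (bundle_over M U \<inter> cdom (tangent_bundle M) i))
      ((\<lambda>\<xi>. f (fst \<xi>)) \<circ> param (tangent_bundle M) i)"
    unfolding chart_bundle_image[OF i]
    by (rule smooth_on_cong[OF _ smooth_on_fst_compose[OF S smooth_funD[OF f i]]])
      (use S i in \<open>auto simp: open_Times param_bundle\<close>)
qed

end

section \<open>Horizontal and vertical lifts\<close>

context atlas_connection
begin

sublocale TB: smooth_atlas "tangent_bundle M"
  by (rule smooth_atlas_bundle)

abbreviation TM where "TM \<equiv> tangent_bundle M"

text \<open>Horizontal (\<^term>\<open>True\<close>) and vertical (\<^term>\<open>False\<close>) lifts are treated uniformly, so that each
  formula below covers all combinations of types at once.\<close>

definition lift :: "bool \<Rightarrow> ('m \<Rightarrow> 'i \<Rightarrow> 'e) \<Rightarrow> 'm \<times> ('i \<Rightarrow> 'e) \<Rightarrow> 'i \<Rightarrow> 'e \<times> 'e" where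
  "lift h = (if h then hlift M nab else vlift M)"

definition lift_at :: "bool \<Rightarrow> 'm \<times> ('i \<Rightarrow> 'e) \<Rightarrow> ('i \<Rightarrow> 'e) \<Rightarrow> 'i \<Rightarrow> 'e \<times> 'e" where
  "lift_at h \<xi> u = lift h (\<lambda>_. u) \<xi>"

lemma lift_eq_lift_at: "lift h X \<xi> = lift_at h \<xi> (X (fst \<xi>))"
  by (cases \<xi>) (simp add: lift_at_def lift_def hlift_def vlift_def cong: if_cong)

lemma hlift_eq_lift_at: "hlift M nab X \<xi> = lift_at True \<xi> (X (fst \<xi>))"
  and vlift_eq_lift_at: "vlift M X \<xi> = lift_at False \<xi> (X (fst \<xi>))"
  using lift_eq_lift_at[of True X \<xi>] lift_eq_lift_at[of False X \<xi>] by (simp_all add: lift_def)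

lemma lift_at_apply:
  "i \<in> charts_at M p \<Longrightarrow>
    lift_at h (p, v) u i = (if h then (u i, - christoffel M nab i p (u i) (v i)) else (0, u i))"
  by (simp add: lift_at_def lift_def hlift_def vlift_def)

lemma lift_at_outside: "i \<notin> charts_at M p \<Longrightarrow> lift_at h (p, v) u i = 0"
  by (simp add: lift_at_def lift_def hlift_def vlift_def)

lemma lift_at_add: "lift_at h \<xi> (u + w) = lift_at h \<xi> u + lift_at h \<xi> w"
proof
  fix i
  obtain p v where \<xi>: "\<xi> = (p, v)" by (cases \<xi>)
  show "lift_at h \<xi> (u + w) i = (lift_at h \<xi> u + lift_at h \<xi> w) i"
    using linear_add[OF linear_christoffel_left]
    by (cases "i \<in> charts_at M p") (simp_all add: \<xi> lift_at_apply lift_at_outside)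
qed

lemma lift_at_scale: "lift_at h \<xi> (r \<cdot> u) = r \<cdot> lift_at h \<xi> u"
proof
  fix i
  obtain p v where \<xi>: "\<xi> = (p, v)" by (cases \<xi>)
  show "lift_at h \<xi> (r \<cdot> u) i = (r \<cdot> lift_at h \<xi> u) i"
    using linear_scale[OF linear_christoffel_left]
    by (cases "i \<in> charts_at M p") (simp_all add: \<xi> lift_at_apply lift_at_outside)
qed

lemma lift_at_zero: "lift_at h \<xi> 0 = 0"
  using lift_at_scale[of h \<xi> 0 0] by simp

lemma lift_at_uminus: "lift_at h \<xi> (- u) = - lift_at h \<xi> u"
  using lift_at_scale[of h \<xi> "- 1" u] by simp

lemma lift_at_diff: "lift_at h \<xi> (u - w) = lift_at h \<xi> u - lift_at h \<xi> w"
  using lift_at_add[of h \<xi> u "- w"] by (simp add: lift_at_uminus)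

lemma christoffel_transform:
  assumes i: "i \<in> charts_at M p" and j: "j \<in> charts_at M p"
  shows "dtrans M i j p (christoffel M nab i p a y)
    = frechet_derivative (\<lambda>x. frechet_derivative (transition M i j) (at x) y) (at (chart M i p)) a
      + christoffel M nab j p (dtrans M i j p a) (dtrans M i j p y)"
proof -
  have i': "i \<in> idx M" "p \<in> cdom M i" using i by (simp_all add: charts_at_iff)
  note U = mopen_cdom[OF i'(1)] i'(2) and coordinate_field = vector_field_const_field_cdom[OF i'(1)]
  have "((\<lambda>x. const_field M i y (param M i x) i) has_derivative (\<lambda>_. 0)) (at (chart M i p))"
    by (rule has_derivative_transform_within_open[OF has_derivative_const open_overlap[of i i]])
      (use i' in \<open>auto simp: const_field_apply charts_at_iff\<close>)
  then have const: "frechet_derivative (\<lambda>x. const_field M i y (param M i x) i) (at (chart M i p))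
      = (\<lambda>_. 0)"
    by (rule frechet_derivative_at[symmetric])
  have "dtrans M i j p (christoffel M nab i p a y)
      = nab (const_field M i a) (const_field M i y) p j"
    unfolding christoffel_def
    by (rule tangent_transform[OF vector_field_tangent[OF
            connection_vector_field[OF U(1) coordinate_field coordinate_field] U(2)] i j])
  also have "\<dots> = frechet_derivative (\<lambda>x. const_field M i y (param M j x) j) (at (chart M j p))
      (dtrans M i j p a) + christoffel M nab j p (dtrans M i j p a) (dtrans M i j p y)"
    using connection_in_chart[OF U j coordinate_field coordinate_field] i j
    by (simp add: const_field_def)
  finally show ?thesis
    using linear_0[OF linear_dtrans[OF i j]]
    by (simp add: vector_field_derivative_transform[OF U coordinate_field i j] const
        const_field_apply[OF i])
qed

lemma lift_at_tangent:
  assumes u: "u \<in> tangent_space M p" and v: "v \<in> tangent_space M p"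
  shows "lift_at h (p, v) u \<in> tangent_space TM (p, v)"
proof (rule TB.tangentI)
  fix i j assume "i \<in> charts_at TM (p, v)" "j \<in> charts_at TM (p, v)"
  then have ij: "i \<in> charts_at M p" "j \<in> charts_at M p" using v by simp_all
  then have ij': "i \<in> idx M" "j \<in> idx M" "chart M i p \<in> chart M i ` (cdom M i \<inter> cdom M j)"
    by (auto simp: charts_at_iff)
  have "frechet_derivative (\<lambda>x. frechet_derivative (transition M i j) (at x) (v i))
      (at (chart M i p)) 0 = 0"
    using smooth_on_differentiable[OF open_overlap smooth_on_frechet_derivative[OF
          smooth_transition]] ij'
    by (intro linear_0 linear_frechet_derivative) blast
  then show "dtrans TM i j (p, v) (lift_at h (p, v) u i) = lift_at h (p, v) u j"
    using christoffel_transform[OF ij, of "u i" "v i"] linear_0[OF linear_dtrans[OF ij]]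
      linear_neg[OF linear_dtrans[OF ij]]
    by (simp add: lift_at_apply ij dtrans_bundle[OF ij] tangent_transform[OF u ij]
        tangent_transform[OF v ij])
qed (use v in \<open>simp add: lift_at_outside\<close>)

lemma lift_at_decompose:
  assumes w: "w \<in> tangent_space TM (p, v)" and p: "p \<in> carrier_of M" and v: "v \<in> tangent_space M p"
  obtains u where "\<And>h. u h \<in> tangent_space M p" "w = (\<Sum>h\<in>UNIV. lift_at h (p, v) (u h))"
proof -
  obtain i where i: "i \<in> charts_at M p" using carrier_chart[OF p] by blast
  define u where "u h = const_field M i (if h then fst (w i)
    else snd (w i) + christoffel M nab i p (fst (w i)) (v i)) p" for h
  have u: "u h \<in> tangent_space M p" for h by (simp add: u_def)
  moreover have "w = (\<Sum>h\<in>UNIV. lift_at h (p, v) (u h))"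
  proof (rule TB.tangent_eqI[OF w, where i = i])
    show "(\<Sum>h\<in>UNIV. lift_at h (p, v) (u h)) \<in> tangent_space TM (p, v)"
      by (intro TB.tangent_sum lift_at_tangent u v)
    show "w i = (\<Sum>h\<in>UNIV. lift_at h (p, v) (u h)) i"
      using i by (simp add: UNIV_bool lift_at_apply u_def const_field_apply prod_eq_iff)
  qed (use v i in simp)
  ultimately show thesis by (rule that)
qed

lemma connection_const_field_expand:
  assumes "mopen M U" "q \<in> U" "i \<in> charts_at M q" "vector_field M U X"
  shows "nab X (const_field M i b) q i = (\<Sum>d\<in>Basis. (b \<bullet> d) *\<^sub>R nab X (const_field M i d) q i)"
  using assms by (simp add: connection_const_field christoffel_expand_right[of i q _ b])

lemma lift_in_chart:
  assumes U: "mopen M U" and X: "vector_field M U X" and i: "i \<in> idx M"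
    and z: "z \<in> chart M i ` (U \<inter> cdom M i) \<times> UNIV"
  shows "lift h X (param TM i z) i = (if h
    then (X (param M i (fst z)) i,
      - (\<Sum>d\<in>Basis. (snd z \<bullet> d) *\<^sub>R nab X (const_field M i d) (param M i (fst z)) i))
    else (0, X (param M i (fst z)) i))"
proof -
  obtain p y where p: "p \<in> U" "p \<in> cdom M i" and z: "z = (chart M i p, y)"
    using z by auto
  then have "i \<in> charts_at M p" using i by (simp add: charts_at_iff)
  then show ?thesis
    using connection_const_field[OF U p(1) _ X] connection_const_field_expand[OF U p(1) _ X, of i y]
    by (simp add: z param_bundle[OF i p(2)] i p lift_eq_lift_at lift_at_apply const_field_apply)
qed

lemma vector_field_lift:
  assumes U: "mopen M U" and X: "vector_field M U X"
  shows "vector_field TM (bundle_over M U) (lift h X)"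
proof (rule TB.vector_fieldI)
  fix \<xi> assume "\<xi> \<in> bundle_over M U"
  then show "lift h X \<xi> \<in> tangent_space TM \<xi>"
    using vector_field_tangent[OF X] by (cases \<xi>) (simp add: lift_eq_lift_at lift_at_tangent)
next
  fix i assume "i \<in> idx TM"
  then have i: "i \<in> idx M" by simp
  let ?V = "U \<inter> cdom M i"
  let ?S = "chart M i ` ?V" and ?X = "\<lambda>x. X (param M i x) i"
  have V: "mopen M ?V" "vector_field M ?V X"
    using mopen_Int[OF U mopen_cdom[OF i]] vector_field_subset[OF X] by auto
  have S: "open ?S" "open (?S \<times> (UNIV :: 'e set))"
    using mopen_imp_open[OF U i] by (simp_all add: open_Times)
  have "vector_field M ?V (nab X (const_field M i d))" for d
    by (intro connection_vector_field V vector_field_const_field i) simp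
  then have smooth: "smooth_on ?S (\<lambda>x. nab X (const_field M i d) (param M i x) i)" for d
    using vector_field_smooth[OF _ i] by (fastforce simp: Int_assoc)
  let ?hor = "\<lambda>z. (?X (fst z),
    - (\<Sum>d\<in>Basis. (snd z \<bullet> d) *\<^sub>R nab X (const_field M i d) (param M i (fst z)) i))"
  let ?ver = "\<lambda>z :: 'e \<times> 'e. (0 :: 'e, ?X (fst z))"
  have horizontal: "smooth_on (?S \<times> UNIV) ?hor"
    by (intro smooth_on_Pair smooth_on_uminus smooth_on_sum smooth_on_scaleR smooth_on_inner_left
        smooth_on_fst_compose smooth_on_snd S smooth vector_field_smooth[OF X i])
  have vertical: "smooth_on (?S \<times> UNIV) ?ver"
    by (intro smooth_on_Pair smooth_on_const smooth_on_fst_compose S vector_field_smooth[OF X i])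
  show "smooth_on (chart TM i ` (bundle_over M U \<inter> cdom TM i)) (\<lambda>z. lift h X (param TM i z) i)"
    unfolding chart_bundle_image[OF i]
  proof (rule smooth_on_cong[OF S(2)])
    show "smooth_on (?S \<times> UNIV) (if h then ?hor else ?ver)"
      using horizontal vertical by simp
  qed (simp add: lift_in_chart[OF U X i])
qed

lemma vector_field_lift_cdom:
  "i \<in> idx M \<Longrightarrow> U \<subseteq> cdom TM i \<Longrightarrow> vector_field M (cdom M i) X \<Longrightarrow> vector_field TM U (lift h X)"
  using TB.vector_field_subset[OF vector_field_lift[OF mopen_cdom]] by simp

lemma dir_deriv_lift:
  assumes U: "mopen M U" "p \<in> U" and v: "v \<in> tangent_space M p" and X: "X p \<in> tangent_space M p"
    and f: "smooth_fun M U f" and eq: "\<And>q w. q \<in> U \<Longrightarrow> w \<in> tangent_space M q \<Longrightarrow> F (q, w) = f q"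
  shows "dir_deriv TM (lift h X) F (p, v) = (if h then dir_deriv M X f p else 0)"
proof -
  obtain i where i: "i \<in> charts_at M p"
    using carrier_chart[OF carrier_of_mopen[OF U]] by blast
  have i': "i \<in> idx M" "i \<in> charts_at TM (p, v)" using i v by (auto simp: charts_at_iff)
  let ?f = "\<lambda>x. f (param M i x)" and ?S = "chart M i ` (U \<inter> cdom M i)"
  have \<xi>: "mopen TM (bundle_over M U)" "(p, v) \<in> bundle_over M U"
    using U v by (auto intro: mopen_bundle_over)
  have S: "open (?S \<times> (UNIV :: 'e set))" "(chart M i p, v i) \<in> ?S \<times> UNIV"
    using mopen_imp_open[OF U(1) i'(1)] U i by (auto simp: open_Times charts_at_iff)
  have lift_tangent: "lift h X (p, v) \<in> tangent_space TM (p, v)"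
    by (simp add: lift_eq_lift_at lift_at_tangent X v)
  have "dir_deriv TM (lift h X) F (p, v) = dir_deriv TM (lift h X) (\<lambda>\<xi>. f (fst \<xi>)) (p, v)"
    by (rule TB.dir_deriv_cong[OF \<xi>]) (use eq in auto)
  also have "\<dots> = frechet_derivative (\<lambda>z. f (fst (param TM i z))) (at (chart M i p, v i))
      (lift h X (p, v) i)"
    using TB.dir_deriv_chart[where X = "lift h X",
        OF \<xi> smooth_fun_bundle[OF U(1) f] lift_tangent i'(2)]
    by simp
  also have "frechet_derivative (\<lambda>z. f (fst (param TM i z))) (at (chart M i p, v i))
      = frechet_derivative (\<lambda>z :: 'e \<times> 'e. ?f (fst z)) (at (chart M i p, v i))"
    by (rule frechet_derivative_cong_open[OF S]) (use i' in \<open>auto simp: param_bundle\<close>)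
  also have "\<dots> (lift h X (p, v) i)
      = frechet_derivative ?f (at (chart M i p)) (fst (lift h X (p, v) i))"
    using frechet_derivative_fst[of ?f "(chart M i p, v i)"]
      differentiableI[OF smooth_fun_has_derivative[OF U f i]] by simp
  finally show ?thesis
    using dir_deriv_chart[where X = X, OF U f X i]
      linear_0[OF has_derivative_linear[OF smooth_fun_has_derivative[OF U f i]]]
    by (simp add: lift_eq_lift_at[of _ _ "(p, v)"] lift_at_apply[OF i])
qed

context
  fixes U i p X and v :: "'i \<Rightarrow> 'e"
  assumes U: "mopen M U" "p \<in> U" and i: "i \<in> charts_at M p" and X: "vector_field M U X"
begin

private lemma chart_image_open:
  "open (chart M i ` (U \<inter> cdom M i))" "chart M i p \<in> chart M i ` (U \<inter> cdom M i)"
  "open (chart M i ` (U \<inter> cdom M i) \<times> (UNIV :: 'e set))"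
  "(chart M i p, v i) \<in> chart M i ` (U \<inter> cdom M i) \<times> UNIV"
  using mopen_imp_open[OF U(1), of i] U(2) i by (auto simp: open_Times charts_at_iff)

private lemma vector_field_connection_const_field:
  "vector_field M (U \<inter> cdom M i) (nab X (const_field M i d))"
  using U i X by (intro connection_vector_field vector_field_const_field mopen_Int mopen_cdom)
    (auto simp: charts_at_iff intro: vector_field_subset)

private lemma has_derivative_connection_const_field:
  "((\<lambda>x. nab X (const_field M i d) (param M i x) i) has_derivative
    frechet_derivative (\<lambda>x. nab X (const_field M i d) (param M i x) i) (at (chart M i p)))
    (at (chart M i p))"
  using U i by (intro vector_field_has_derivative[OF _ _ vector_field_connection_const_field])
    (auto simp: charts_at_iff mopen_Int mopen_cdom)

private lemma frechet_derivative_connection_const_field_expand: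
  "(\<Sum>d\<in>Basis. (b \<bullet> d) *\<^sub>R frechet_derivative (\<lambda>x. nab X (const_field M i d) (param M i x) i)
      (at (chart M i p)) u)
    = frechet_derivative (\<lambda>x. nab X (const_field M i b) (param M i x) i) (at (chart M i p)) u"
proof -
  let ?x = "chart M i p" and ?N = "\<lambda>d x. nab X (const_field M i d) (param M i x) i"
  have i': "i \<in> idx M" using i by (simp add: charts_at_iff)
  have "(?N b has_derivative (\<lambda>u. \<Sum>d\<in>Basis. (b \<bullet> d) *\<^sub>R frechet_derivative (?N d) (at ?x) u))
      (at ?x)"
  proof (rule has_derivative_transform_within_open[OF _ chart_image_open(1,2)])
    show "((\<lambda>x. \<Sum>d\<in>Basis. (b \<bullet> d) *\<^sub>R ?N d x) has_derivative
        (\<lambda>u. \<Sum>d\<in>Basis. (b \<bullet> d) *\<^sub>R frechet_derivative (?N d) (at ?x) u)) (at ?x)"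
      by (intro has_derivative_sum has_derivative_scaleR_right
          has_derivative_connection_const_field)
    show "(\<Sum>d\<in>Basis. (b \<bullet> d) *\<^sub>R ?N d x) = ?N b x" if "x \<in> chart M i ` (U \<inter> cdom M i)" for x
      using that i' connection_const_field_expand[OF U(1) _ _ X, of _ i b]
      by (auto simp: charts_at_iff)
  qed
  then show ?thesis
    by (rule fun_cong[OF frechet_derivative_at])
qed

lemma has_derivative_lift_horizontal:
  "((\<lambda>z. lift True X (param TM i z) i) has_derivative
     (\<lambda>w. (frechet_derivative (\<lambda>x. X (param M i x) i) (at (chart M i p)) (fst w),
        - (frechet_derivative (\<lambda>x. nab X (const_field M i (v i)) (param M i x) i) (at (chart M i p))
            (fst w)
          + christoffel M nab i p (X p i) (snd w))))) (at (chart M i p, v i))"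
proof -
  let ?x = "chart M i p" and ?N = "\<lambda>d x. nab X (const_field M i d) (param M i x) i"
  have i': "i \<in> idx M" "p \<in> cdom M i" using i by (simp_all add: charts_at_iff)
  note D = has_derivative_connection_const_field
  have fst: "((\<lambda>z :: 'e \<times> 'e. F (fst z)) has_derivative (\<lambda>w. F' (fst w))) (at (?x, v i))"
    if "(F has_derivative F') (at ?x)" for F :: "'e \<Rightarrow> 'e" and F'
    using diff_chain_at[OF has_derivative_fst[OF has_derivative_ident[of "at (?x, v i)"]], of F F']
      that by (simp add: o_def)
  have "((\<lambda>z. \<Sum>d\<in>Basis. (snd z \<bullet> d) *\<^sub>R ?N d (fst z)) has_derivative
      (\<lambda>w. \<Sum>d\<in>Basis. (snd (?x, v i) \<bullet> d) *\<^sub>R frechet_derivative (?N d) (at ?x) (fst w)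
        + (snd w \<bullet> d) *\<^sub>R ?N d (fst (?x, v i)))) (at (?x, v i))"
    by (intro has_derivative_sum has_derivative_scaleR has_derivative_inner_left has_derivative_snd
        has_derivative_ident fst D)
  moreover have "(\<Sum>d\<in>Basis. (u \<bullet> d) *\<^sub>R ?N d ?x) = christoffel M nab i p (X p i) u" for u
    using connection_const_field[OF U i X] christoffel_expand_right[OF i, of "X p i" u] i' by simp
  ultimately have "((\<lambda>z. \<Sum>d\<in>Basis. (snd z \<bullet> d) *\<^sub>R ?N d (fst z)) has_derivative
      (\<lambda>w. frechet_derivative (?N (v i)) (at ?x) (fst w) + christoffel M nab i p (X p i) (snd w)))
      (at (?x, v i))"
    by (simp add: sum.distrib frechet_derivative_connection_const_field_expand)
  then have "((\<lambda>z. (X (param M i (fst z)) i, - (\<Sum>d\<in>Basis. (snd z \<bullet> d) *\<^sub>R ?N d (fst z))))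
      has_derivative (\<lambda>w. (frechet_derivative (\<lambda>x. X (param M i x) i) (at ?x) (fst w),
        - (frechet_derivative (?N (v i)) (at ?x) (fst w)
          + christoffel M nab i p (X p i) (snd w))))) (at (?x, v i))"
    by (intro has_derivative_Pair has_derivative_minus fst vector_field_has_derivative[OF U X i])
  then show ?thesis
    by (rule has_derivative_transform_within_open[OF _ chart_image_open(3,4)])
      (simp add: lift_in_chart[OF U(1) X i'(1)])
qed

lemma has_derivative_lift_vertical:
  "((\<lambda>z. lift False X (param TM i z) i) has_derivative
     (\<lambda>w. (0, frechet_derivative (\<lambda>x. X (param M i x) i) (at (chart M i p)) (fst w))))
     (at (chart M i p, v i))"
proof -
  have i': "i \<in> idx M" using i by (simp add: charts_at_iff)
  have "((\<lambda>z :: 'e \<times> 'e. (0 :: 'e, X (param M i (fst z)) i)) has_derivative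
      (\<lambda>w. (0, frechet_derivative (\<lambda>x. X (param M i x) i) (at (chart M i p)) (fst w))))
      (at (chart M i p, v i))"
    using diff_chain_at[OF has_derivative_fst[OF has_derivative_ident, of "at (chart M i p, v i)"],
        of "\<lambda>x. X (param M i x) i"] vector_field_has_derivative[OF U X i]
    by (intro has_derivative_Pair has_derivative_const) (simp add: o_def)
  then show ?thesis
    by (rule has_derivative_transform_within_open[OF _ chart_image_open(3,4)])
      (simp add: lift_in_chart[OF U(1) X i'])
qed

end

end

locale flat_atlas = atlas_connection M nab
  for M :: "('i, 'm, 'e::euclidean_space) atlas" and nab +
  assumes flat: "flat M nab" and torsion_free: "torsion_free M nab"
begin

lemma lie_bracket_eq:
  "mopen M U \<Longrightarrow> vector_field M U X \<Longrightarrow> vector_field M U Y \<Longrightarrow> p \<in> U \<Longrightarrow>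
    lie_bracket M X Y p = nab X Y p - nab Y X p"
  using torsion_free unfolding torsion_free_def by metis

text \<open>Where flatness enters: the vertical part of \<open>[X\<^sup>h, Y\<^sup>h]\<close> at \<open>v\<close> is the curvature
  \<open>R(X, Y) v\<close>.\<close>

lemma christoffel_lie_bracket:
  assumes U: "mopen M U" "p \<in> U" and i: "i \<in> charts_at M p"
    and X: "vector_field M U X" and Y: "vector_field M U Y"
  shows "christoffel M nab i p (lie_bracket M X Y p i) y
    = frechet_derivative (\<lambda>x. nab Y (const_field M i y) (param M i x) i) (at (chart M i p)) (X p i)
      + christoffel M nab i p (X p i) (christoffel M nab i p (Y p i) y)
      - frechet_derivative (\<lambda>x. nab X (const_field M i y) (param M i x) i) (at (chart M i p))
        (Y p i)
      - christoffel M nab i p (Y p i) (christoffel M nab i p (X p i) y)"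
proof -
  let ?V = "U \<inter> cdom M i" and ?c = "const_field M i y"
  have V: "mopen M ?V" "p \<in> ?V"
    using U i by (auto simp: charts_at_iff mopen_Int mopen_cdom)
  have vector_fields: "vector_field M ?V X" "vector_field M ?V Y" "vector_field M ?V ?c"
    using X Y V i by (auto simp: charts_at_iff intro: vector_field_subset vector_field_const_field)
  have "curvature M nab X Y ?c p = 0"
    using flat V vector_fields unfolding flat_def by blast
  then have "nab (lie_bracket M X Y) ?c p i = nab X (nab Y ?c) p i - nab Y (nab X ?c) p i"
    by (simp add: curvature_def fun_eq_iff algebra_simps)
  then show ?thesis
    using connection_in_chart[OF V i vector_fields(1)
        connection_vector_field[OF V(1) vector_fields(2,3)]]
      connection_in_chart[OF V i vector_fields(2)
        connection_vector_field[OF V(1) vector_fields(1,3)]]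
      connection_const_field[OF V i vector_fields(1)]
      connection_const_field[OF V i vector_fields(2)]
      connection_const_field[OF V i vector_field_lie_bracket[OF V(1) vector_fields(1,2)]]
    by simp
qed

lemma lie_bracket_lift_eqI:
  assumes U: "mopen M U" "p \<in> U" and i: "i \<in> charts_at M p"
    and X: "vector_field M U X" and Y: "vector_field M U Y"
    and v: "v \<in> tangent_space M p" and w: "w \<in> tangent_space M p"
    and eq: "lie_bracket TM (lift a X) (lift b Y) (p, v) i = lift_at h (p, v) w i"
  shows "lie_bracket TM (lift a X) (lift b Y) (p, v) = lift_at h (p, v) w"
proof (rule TB.tangent_eqI[where i = i])
  show "lie_bracket TM (lift a X) (lift b Y) (p, v) \<in> tangent_space TM (p, v)"
    by (rule TB.vector_field_tangent[OF TB.vector_field_lie_bracket[OF mopen_bundle_over[OF U(1)]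
            vector_field_lift[OF U(1) X] vector_field_lift[OF U(1) Y]]]) (use U(2) v in simp)
qed (use v w i eq in \<open>simp_all add: lift_at_tangent\<close>)

lemma lie_bracket_lift:
  assumes U: "mopen M U" "p \<in> U" and X: "vector_field M U X" and Y: "vector_field M U Y"
    and v: "v \<in> tangent_space M p"
  shows "lie_bracket TM (lift a X) (lift b Y) (p, v)
    = lift_at (a \<and> b) (p, v) ((if a then nab X Y p else 0) - (if b then nab Y X p else 0))"
proof -
  obtain i where i: "i \<in> charts_at M p"
    using carrier_chart[OF carrier_of_mopen[OF U]] by blast
  then have i': "i \<in> charts_at TM (p, v)" using v by simp
  note bracket = lie_bracket_lift_eqI[OF U i _ _ v]
  have tangent: "nab X Y p \<in> tangent_space M p" if "vector_field M U X" "vector_field M U Y" for X Y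
    by (rule vector_field_tangent[OF connection_vector_field[OF U(1) that] U(2)])
  note D = frechet_derivative_at[OF has_derivative_lift_horizontal[OF U i], of _ v, symmetric]
    frechet_derivative_at[OF has_derivative_lift_vertical[OF U i], of _ v, symmetric]
  note chart_simps = TB.lie_bracket_apply[OF i'] D lift_eq_lift_at[of _ _ "(p, v)"]
    lift_at_apply[OF i] lie_bracket_apply[OF i] zero_prod_def
    linear_0[OF linear_christoffel_right[OF i]]
    linear_neg[OF linear_christoffel_right[OF i]]
  have hor_hor: "lie_bracket TM (lift True X) (lift True Y) (p, v)
      = lift_at True (p, v) (lie_bracket M X Y p)"
    using bracket[of X Y _ True True]
      vector_field_tangent[OF vector_field_lie_bracket[OF U(1) X Y] U(2)]
    by (simp add: X Y chart_simps
        christoffel_lie_bracket[OF U i X Y, unfolded lie_bracket_apply[OF i]])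
  have ver_ver: "lie_bracket TM (lift False X) (lift False Y) (p, v) = lift_at False (p, v) 0"
    using bracket[of X Y 0 False False]
      linear_0[OF has_derivative_linear[OF vector_field_has_derivative[OF U _ i]]]
    by (simp add: X Y chart_simps)
  have hor_ver:
    "lie_bracket TM (lift True X) (lift False Y) (p, v) = lift_at False (p, v) (nab X Y p)"
    if X: "vector_field M U X" and Y: "vector_field M U Y" for X Y
    using bracket[of X Y _ True False] tangent[OF X Y]
      linear_0[OF has_derivative_linear[OF has_derivative_lift_horizontal[OF U i X, of v]]]
    by (simp add: X Y chart_simps connection_in_chart[OF U i X Y])
  have ver_hor: "lie_bracket TM (lift False X) (lift True Y) (p, v)
      = lift_at False (p, v) (- nab Y X p)"
    using hor_ver[OF Y X] TB.lie_bracket_swap[of "lift False X" "lift True Y"]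
    by (simp add: lift_at_uminus)
  show ?thesis
    using hor_hor ver_ver hor_ver[OF X Y] ver_hor
    by (cases a; cases b) (simp_all add: lie_bracket_eq[OF U(1) X Y U(2)])
qed

end

section \<open>The difference tensor of an affine-Riemann manifold\<close>

lemma riemannian_atlasI:
  assumes M: "smooth_manifold M" and g: "riemannian_metric M g"
  shows "riemannian_atlas M g"
proof -
  interpret smooth_atlas M
    using M unfolding smooth_manifold_def smooth_atlas_def by blast
  show ?thesis
  proof
    fix p u v w a b
    assume p: "p \<in> carrier_of M" and u: "u \<in> tangent_space M p" and v: "v \<in> tangent_space M p"
    show "g p u v = g p v u"
      using g p u v unfolding riemannian_metric_def by blast
    show "g p (a \<cdot> u + b \<cdot> v) w = a * g p u w + b * g p v w" if "w \<in> tangent_space M p"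
      using g p u v that unfolding riemannian_metric_def by blast
    show "0 < g p u u" if "u \<noteq> 0"
      using g p u that unfolding riemannian_metric_def by blast
  next
    fix U X Y assume "mopen M U" "vector_field M U X" "vector_field M U Y"
    then show "smooth_fun M U (\<lambda>p. g p (X p) (Y p))"
      using g[unfolded riemannian_metric_def, THEN conjunct2] by simp
  qed
qed

locale affine_riemann_adjoint =
  fixes M :: "('i, 'm, 'e::euclidean_space) atlas"
    and nab D \<gamma>\<^sub>s :: "('m \<Rightarrow> 'i \<Rightarrow> 'e) \<Rightarrow> ('m \<Rightarrow> 'i \<Rightarrow> 'e) \<Rightarrow> 'm \<Rightarrow> 'i \<Rightarrow> 'e"
    and g :: "'m \<Rightarrow> ('i \<Rightarrow> 'e) \<Rightarrow> ('i \<Rightarrow> 'e) \<Rightarrow> real"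
  assumes affine_riemann: "affine_riemann M nab g"
    and levi_civita: "levi_civita M g D"
    and adjoint: "adjoint_tensor M g (difference_tensor D nab) \<gamma>\<^sub>s"
begin

sublocale riemannian_atlas M g
  using affine_riemann by (simp add: affine_riemann_def riemannian_atlasI)

sublocale flat_atlas M nab
  by unfold_locales (use affine_riemann in \<open>simp_all add: affine_riemann_def\<close>)

definition nonmetricity :: "('m \<Rightarrow> 'i \<Rightarrow> 'e) \<Rightarrow> ('m \<Rightarrow> 'i \<Rightarrow> 'e) \<Rightarrow> 'm \<Rightarrow> 'i \<Rightarrow> 'e" where
  "nonmetricity X Y = difference_tensor D nab X Y + \<gamma>\<^sub>s X Y"

definition mean_connection :: "('m \<Rightarrow> 'i \<Rightarrow> 'e) \<Rightarrow> ('m \<Rightarrow> 'i \<Rightarrow> 'e) \<Rightarrow> 'm \<Rightarrow> 'i \<Rightarrow> 'e" where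
  "mean_connection X Y = nab X Y + (\<lambda>p. (1 / 2) \<cdot> nonmetricity X Y p)"

lemma tensor_field_difference_levi_civita: "tensor_field (difference_tensor D nab)"
  using levi_civita by (simp add: levi_civita_def tensor_field_difference)

lemma tensor_field_\<gamma>\<^sub>s: "tensor_field \<gamma>\<^sub>s"
  by (rule tensor_field_adjoint[OF tensor_field_difference_levi_civita adjoint])

lemma tensor_field_nonmetricity: "tensor_field nonmetricity"
  using tensor_field_add[OF tensor_field_difference_levi_civita tensor_field_\<gamma>\<^sub>s]
  by (simp add: nonmetricity_def[abs_def])

lemma connection_mean_connection: "connection M mean_connection"
  using connection_add_tensor_field[OF tensor_field_scale[OF tensor_field_nonmetricity, of "1 / 2"]]
  by (simp add: mean_connection_def[abs_def])

sublocale mean: atlas_connection M mean_connection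
  by standard (rule connection_mean_connection)

lemma trace_cov_deriv_vanishes:
  assumes "trace_vanishes M g \<gamma>\<^sub>s" "vector_field M (carrier_of M) X"
  shows "trace_vanishes M g (cov_deriv D X \<gamma>\<^sub>s)"
  using levi_civita_metric_connection[OF levi_civita] tensor_field_\<gamma>\<^sub>s assms
  by (rule trace_vanishes_cov_deriv)

context
  fixes U
  assumes U: "mopen M U"
begin

lemmas vector_field_nonmetricity = tensor_field_vector_field[OF tensor_field_nonmetricity U]

lemmas vector_field_mean_connection = mean.connection_vector_field[OF U]

lemmas metric_\<gamma>\<^sub>s = metric_adjoint[OF tensor_field_difference_levi_civita adjoint U]

context
  fixes X Y Z p
  assumes X: "vector_field M U X" and Y: "vector_field M U Y" and Z: "vector_field M U Z"
    and p: "p \<in> U"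
begin

lemma metric_nonmetricity:
  "g p (nonmetricity X Y p) (Z p)
    = dir_deriv M X (\<lambda>q. g q (Y q) (Z q)) p - g p (nab X Y p) (Z p) - g p (Y p) (nab X Z p)"
proof -
  interpret D: atlas_connection M D
    by standard (use levi_civita in \<open>simp add: levi_civita_def\<close>)
  note tangent = vector_field_tangent[OF _ p] and carrier = carrier_of_mopen[OF U p]
  note tangent = tangent[OF Y] tangent[OF Z] tangent[OF connection_vector_field[OF U X Y]]
    tangent[OF connection_vector_field[OF U X Z]] tangent[OF D.connection_vector_field[OF U X Y]]
    tangent[OF D.connection_vector_field[OF U X Z]]
    tangent[OF tensor_field_vector_field[OF tensor_field_\<gamma>\<^sub>s U X Y]]
  have "g p (nonmetricity X Y p) (Z p)
      = g p (D X Y p - nab X Y p) (Z p) + g p (Y p) (D X Z p - nab X Z p)"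
    using metric_\<gamma>\<^sub>s[OF X Y Z p] tangent
    by (simp add: nonmetricity_def difference_tensor_def metric_add_left[OF carrier] tangent_diff)
  also have "\<dots> = g p (D X Y p) (Z p) + g p (Y p) (D X Z p)
      - g p (nab X Y p) (Z p) - g p (Y p) (nab X Z p)"
    using tangent by (simp add: metric_diff_left[OF carrier] metric_diff_right[OF carrier])
  finally show ?thesis
    using metric_connection_dir_deriv[OF levi_civita_metric_connection[OF levi_civita] U X Y Z p]
    by simp
qed

lemma metric_mean_connection:
  "2 * g p (mean_connection X Y p) (Z p)
    = 2 * g p (nab X Y p) (Z p) + g p (nonmetricity X Y p) (Z p)"
  using vector_field_tangent[OF _ p] connection_vector_field[OF U X Y]
    vector_field_nonmetricity[OF X Y] Z
  by (simp add: mean_connection_def metric_add_left[OF carrier_of_mopen[OF U p]]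
      metric_scale_left[OF carrier_of_mopen[OF U p]])

end

lemma nonmetricity_symmetric:
  assumes X: "vector_field M U X" and Y: "vector_field M U Y" and Z: "vector_field M U Z"
    and p: "p \<in> U"
  shows "g p (nonmetricity X Y p) (Z p) = g p (nonmetricity X Z p) (Y p)"
proof -
  note tangent = vector_field_tangent[OF _ p] and sym = metric_sym[OF carrier_of_mopen[OF U p]]
  have "dir_deriv M X (\<lambda>q. g q (Y q) (Z q)) p = dir_deriv M X (\<lambda>q. g q (Z q) (Y q)) p"
    using Y Z
    by (intro dir_deriv_cong[OF U p] metric_sym carrier_of_mopen[OF U] vector_field_tangent) auto
  then show ?thesis
    using sym[OF tangent[OF Y] tangent[OF connection_vector_field[OF U X Z]]]
      sym[OF tangent[OF Z] tangent[OF connection_vector_field[OF U X Y]]]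
    by (simp add: metric_nonmetricity[OF X _ _ p] Y Z)
qed

end

lemma metric_connection_mean_connection: "metric_connection mean_connection"
  unfolding metric_connection_def
proof (intro conjI allI impI ballI connection_mean_connection; elim conjE)
  fix U X Y Z p assume U: "mopen M U" and p: "p \<in> U"
    and X: "vector_field M U X" and Y: "vector_field M U Y" and Z: "vector_field M U Z"
  note tangent = vector_field_tangent[OF _ p] and sym = metric_sym[OF carrier_of_mopen[OF U p]]
  have "g p (Y p) (mean_connection X Z p) = g p (mean_connection X Z p) (Y p)"
    "g p (Y p) (nab X Z p) = g p (nab X Z p) (Y p)"
    by (intro sym tangent mean.connection_vector_field[OF U] connection_vector_field[OF U] X Y Z)+
  then show "dir_deriv M X (\<lambda>q. g q (Y q) (Z q)) p
      = g p (mean_connection X Y p) (Z p) + g p (Y p) (mean_connection X Z p)"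
    using metric_nonmetricity[OF U X Y Z p] metric_mean_connection[OF U X Y Z p]
      metric_mean_connection[OF U X Z Y p] nonmetricity_symmetric[OF U X Y Z p] by simp
qed

lemma difference_tensor_symmetric:
  assumes U: "mopen M U" and X: "vector_field M U X" and Y: "vector_field M U Y" and p: "p \<in> U"
  shows "difference_tensor D nab X Y p = difference_tensor D nab Y X p"
proof -
  have "D X Y p - D Y X p = lie_bracket M X Y p"
    using levi_civita U X Y p unfolding levi_civita_def torsion_free_def by blast
  then show ?thesis
    using lie_bracket_eq[OF U X Y p] by (simp add: difference_tensor_def algebra_simps)
qed

lemma metric_nonmetricity_diagonal:
  assumes U: "mopen M U" and X: "vector_field M U X" and Y: "vector_field M U Y" and p: "p \<in> U"
  shows "g p (nonmetricity X Y p) (Y p) = 2 * g p (\<gamma>\<^sub>s Y Y p) (X p)"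
proof -
  note tangent = vector_field_tangent[OF _ p] and carrier = carrier_of_mopen[OF U p]
  note difference =
    tangent[OF tensor_field_vector_field[OF tensor_field_difference_levi_civita U X Y]]
  have "g p (nonmetricity X Y p) (Y p)
      = g p (difference_tensor D nab X Y p) (Y p) + g p (\<gamma>\<^sub>s X Y p) (Y p)"
    using difference tangent[OF tensor_field_vector_field[OF tensor_field_\<gamma>\<^sub>s U X Y]] tangent[OF Y]
    by (simp add: nonmetricity_def metric_add_left[OF carrier])
  also have "g p (difference_tensor D nab X Y p) (Y p) = g p (\<gamma>\<^sub>s X Y p) (Y p)"
    using metric_\<gamma>\<^sub>s[OF U X Y Y p] metric_sym[OF carrier tangent[OF Y] difference] by simp
  also have "g p (\<gamma>\<^sub>s X Y p) (Y p) = g p (\<gamma>\<^sub>s Y Y p) (X p)"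
    using metric_\<gamma>\<^sub>s[OF U X Y Y p] metric_\<gamma>\<^sub>s[OF U Y Y X p]
      difference_tensor_symmetric[OF U X Y p] by simp
  finally show ?thesis by simp
qed

lemma trace_nonmetricity:
  assumes trace: "trace_vanishes M g \<gamma>\<^sub>s" and E: "orthonormal_frame M g U E" and p: "p \<in> U"
    and X: "vector_field M U X"
  shows "(\<Sum>k<DIM('e). g p (nonmetricity X (E k) p) (E k p)) = 0"
proof -
  note U = orthonormal_frameD(1)[OF E] and frame_field = orthonormal_frameD(2)[OF E]
  note tangent = vector_field_tangent[OF _ p] and carrier = carrier_of_mopen[OF U p]
  have "(\<Sum>k<DIM('e). g p (nonmetricity X (E k) p) (E k p))
      = 2 * (\<Sum>k<DIM('e). g p (\<gamma>\<^sub>s (E k) (E k) p) (X p))"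
    by (simp add: sum_distrib_left metric_nonmetricity_diagonal[OF U X frame_field p])
  also have
    "(\<Sum>k<DIM('e). g p (\<gamma>\<^sub>s (E k) (E k) p) (X p)) = g p (\<Sum>k<DIM('e). \<gamma>\<^sub>s (E k) (E k) p) (X p)"
    using frame_field X by (intro metric_sum_left[OF carrier, symmetric] tangent
        tensor_field_vector_field[OF tensor_field_\<gamma>\<^sub>s U]) auto
  also have "(\<Sum>k<DIM('e). \<gamma>\<^sub>s (E k) (E k) p) = 0"
    using trace E p by (auto simp: trace_vanishes_def frame_trace_def fun_eq_iff)
  finally show ?thesis
    unfolding metric_zero_left[OF carrier tangent[OF X]] by simp
qed

text \<open>The Chern curvature of \<open>(X\<^sup>h, Y\<^sup>v)\<close>, up to signs and a factor \<open>1 / 2\<close>.\<close>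

definition mixed_curvature ::
    "('m \<Rightarrow> 'i \<Rightarrow> 'e) \<Rightarrow> ('m \<Rightarrow> 'i \<Rightarrow> 'e) \<Rightarrow> ('m \<Rightarrow> 'i \<Rightarrow> 'e) \<Rightarrow> 'm \<Rightarrow> 'i \<Rightarrow> 'e" where
  "mixed_curvature X Y Z = nonmetricity (nab X Y) Z
     - (mean_connection X (nonmetricity Y Z) - nonmetricity Y (mean_connection X Z))"

lemma vector_field_mixed_curvature:
  assumes U: "mopen M U" and "vector_field M U X" "vector_field M U Y" "vector_field M U Z"
  shows "vector_field M U (mixed_curvature X Y Z)"
  unfolding mixed_curvature_def
  by (intro vector_field_diff[OF U] vector_field_nonmetricity[OF U]
      vector_field_mean_connection[OF U] connection_vector_field[OF U] assms)

lemma trace_mixed_curvature: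
  assumes trace: "trace_vanishes M g \<gamma>\<^sub>s" and E: "orthonormal_frame M g U E" and p: "p \<in> U"
    and X: "vector_field M U X" and Y: "vector_field M U Y"
  shows "(\<Sum>k<DIM('e). g p (mixed_curvature X Y (E k) p) (E k p)) = 0"
proof -
  note U = orthonormal_frameD(1)[OF E] and frame_field = orthonormal_frameD(2)[OF E]
  note tangent = vector_field_tangent[OF _ p] and carrier = carrier_of_mopen[OF U p]
  note nonmetricity_field = vector_field_nonmetricity[OF U]
    and mean_field = vector_field_mean_connection[OF U]
  have split: "g p (mixed_curvature X Y (E k) p) (E k p)
      = g p (nonmetricity (nab X Y) (E k) p) (E k p)
        - g p (mean_connection X (nonmetricity Y (E k)) p
            - nonmetricity Y (mean_connection X (E k)) p)
            (E k p)" if "k < DIM('e)" for k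
  proof -
    have "mixed_curvature X Y (E k) p = nonmetricity (nab X Y) (E k) p
        - (mean_connection X (nonmetricity Y (E k)) p - nonmetricity Y (mean_connection X (E k)) p)"
      by (simp add: mixed_curvature_def)
    then show ?thesis
      by (simp only:) (intro metric_diff_left[OF carrier] tangent_diff tangent nonmetricity_field
          mean_field
          connection_vector_field[OF U] X Y frame_field that)
  qed
  have "(\<Sum>k<DIM('e). g p (mean_connection X (nonmetricity Y (E k)) p
          - nonmetricity Y (mean_connection X (E k)) p) (E k p))
      = dir_deriv M X (\<lambda>q. \<Sum>k<DIM('e). g q (nonmetricity Y (E k) q) (E k q)) p"
    by (rule trace_connection_commutator[OF metric_connection_mean_connection E p X
        nonmetricity_field[OF Y]
          tensor_field_tensorial_right[OF tensor_field_nonmetricity U p Y]])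
  also have "\<dots> = dir_deriv M X (\<lambda>q. 0) p"
    by (rule dir_deriv_cong[OF U p]) (use trace_nonmetricity[OF trace E _ Y] in auto)
  finally show ?thesis
    using trace_nonmetricity[OF trace E p connection_vector_field[OF U X Y]]
    by (simp add: split sum_subtractf dir_deriv_const[OF U p] del: minus_apply)
qed

end

section \<open>The Chern connection of the canonical Hermitian structure\<close>

locale chern_bundle = affine_riemann_adjoint M nab D \<gamma>\<^sub>s g
  for M :: "('i, 'm, 'e::euclidean_space) atlas" and nab D \<gamma>\<^sub>s g +
  fixes J\<^sub>1 :: "'m \<times> ('i \<Rightarrow> 'e) \<Rightarrow> ('i \<Rightarrow> 'e \<times> 'e) \<Rightarrow> 'i \<Rightarrow> 'e \<times> 'e"
    and g\<^sub>1 :: "'m \<times> ('i \<Rightarrow> 'e) \<Rightarrow> ('i \<Rightarrow> 'e \<times> 'e) \<Rightarrow> ('i \<Rightarrow> 'e \<times> 'e) \<Rightarrow> real"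
    and C :: "('m \<times> ('i \<Rightarrow> 'e) \<Rightarrow> 'i \<Rightarrow> 'e \<times> 'e) \<Rightarrow> ('m \<times> ('i \<Rightarrow> 'e) \<Rightarrow> 'i \<Rightarrow> 'e \<times> 'e) \<Rightarrow>
      'm \<times> ('i \<Rightarrow> 'e) \<Rightarrow> 'i \<Rightarrow> 'e \<times> 'e"
  assumes hermitian: "canonical_hermitian M nab g J\<^sub>1 g\<^sub>1"
    and chern: "chern_connection (tangent_bundle M) J\<^sub>1 g\<^sub>1 C"
begin

sublocale TB: metric_atlas TM g\<^sub>1
proof
  fix \<xi> u v w and a b :: real
  assume "\<xi> \<in> carrier_of TM" "u \<in> tangent_space TM \<xi>" "v \<in> tangent_space TM \<xi>"
    "w \<in> tangent_space TM \<xi>"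
  then show "g\<^sub>1 \<xi> (a \<cdot> u + b \<cdot> v) w = a * g\<^sub>1 \<xi> u w + b * g\<^sub>1 \<xi> v w"
    using hermitian unfolding canonical_hermitian_def by blast
next
  fix \<xi> u v assume "\<xi> \<in> carrier_of TM" "u \<in> tangent_space TM \<xi>" "v \<in> tangent_space TM \<xi>"
  then show "g\<^sub>1 \<xi> u v = g\<^sub>1 \<xi> v u"
    using hermitian unfolding canonical_hermitian_def by blast
qed

sublocale C: atlas_connection TM C
  by standard (use chern in \<open>simp add: chern_connection_def\<close>)

abbreviation \<omega> :: "'m \<times> ('i \<Rightarrow> 'e) \<Rightarrow> ('i \<Rightarrow> 'e \<times> 'e) \<Rightarrow> ('i \<Rightarrow> 'e \<times> 'e) \<Rightarrow> real" where
  "\<omega> \<equiv> fundamental_form J\<^sub>1 g\<^sub>1"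

lemma J_linear:
  "\<xi> \<in> carrier_of TM \<Longrightarrow> u \<in> tangent_space TM \<xi> \<Longrightarrow> v \<in> tangent_space TM \<xi> \<Longrightarrow>
   J\<^sub>1 \<xi> (a \<cdot> u + b \<cdot> v) = a \<cdot> J\<^sub>1 \<xi> u + b \<cdot> J\<^sub>1 \<xi> v"
  using hermitian unfolding canonical_hermitian_def by blast

lemma J_zero: "\<xi> \<in> carrier_of TM \<Longrightarrow> J\<^sub>1 \<xi> 0 = 0"
  using J_linear[of \<xi> 0 0 0 0] by simp

lemma J_sum:
  assumes \<xi>: "\<xi> \<in> carrier_of TM" and u: "\<And>k. k \<in> K \<Longrightarrow> u k \<in> tangent_space TM \<xi>"
  shows "J\<^sub>1 \<xi> (\<Sum>k\<in>K. c k \<cdot> u k) = (\<Sum>k\<in>K. c k \<cdot> J\<^sub>1 \<xi> (u k))"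
  using u
proof (induction K rule: infinite_finite_induct)
  case (insert k K)
  have "J\<^sub>1 \<xi> (c k \<cdot> u k + 1 \<cdot> (\<Sum>k\<in>K. c k \<cdot> u k)) = c k \<cdot> J\<^sub>1 \<xi> (u k) + 1 \<cdot> J\<^sub>1 \<xi> (\<Sum>k\<in>K. c k \<cdot> u k)"
    using insert by (intro J_linear \<xi> TB.tangent_sum TB.tangent_scale) auto
  then show ?case
    using insert by (simp del: sum_fun_apply plus_fun_apply vscale_apply)
qed (simp_all add: J_zero[OF \<xi>])

context
  fixes p v
  assumes p: "p \<in> carrier_of M" and v: "v \<in> tangent_space M p"
begin

lemma carrier_bundle_Pair: "(p, v) \<in> carrier_of TM"
  using p v by (simp add: carrier_bundle)

lemma
  assumes u: "u \<in> tangent_space M p"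
  shows J_lift_at:
      "J\<^sub>1 (p, v) (lift_at h (p, v) u) = lift_at (\<not> h) (p, v) (if h then u else - u)"
    and metric_lift_at: "w \<in> tangent_space M p \<Longrightarrow>
      g\<^sub>1 (p, v) (lift_at h (p, v) u) (lift_at h' (p, v) w) = (if h = h' then g p u w else 0)"
proof -
  obtain i where i: "i \<in> charts_at M p" using carrier_chart[OF p] by blast
  then have V: "mopen M (cdom M i)" "p \<in> cdom M i"
    and coordinate_field: "vector_field M (cdom M i) (const_field M i a)" for a
    by (auto simp: charts_at_iff mopen_cdom vector_field_const_field_cdom)
  have const: "const_field M i (u i) p = u" if "u \<in> tangent_space M p" for u
    using tangent_eq_const_field[OF that i] by simp
  note hermitian_lift = hermitian[
      unfolded canonical_hermitian_def hlift_eq_lift_at vlift_eq_lift_at,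
      THEN conjunct2, rule_format, OF _ carrier_bundle_Pair, unfolded fst_conv]
  have *: "J\<^sub>1 (p, v) (lift_at True (p, v) u) = lift_at False (p, v) u \<and>
      J\<^sub>1 (p, v) (lift_at False (p, v) u) = - lift_at True (p, v) u \<and>
      g\<^sub>1 (p, v) (lift_at True (p, v) u) (lift_at True (p, v) w) = g p u w \<and>
      g\<^sub>1 (p, v) (lift_at False (p, v) u) (lift_at False (p, v) w) = g p u w \<and>
      g\<^sub>1 (p, v) (lift_at True (p, v) u) (lift_at False (p, v) w) = 0"
    if "u \<in> tangent_space M p" "w \<in> tangent_space M p" for u w
    using hermitian_lift[OF conjI[OF V(1) conjI[OF coordinate_field coordinate_field]] V(2),
        of "u i" "w i"] const that by simp
  show "J\<^sub>1 (p, v) (lift_at h (p, v) u) = lift_at (\<not> h) (p, v) (if h then u else - u)"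
    using *[OF u u] by (simp add: lift_at_uminus)
  assume w: "w \<in> tangent_space M p"
  show "g\<^sub>1 (p, v) (lift_at h (p, v) u) (lift_at h' (p, v) w) = (if h = h' then g p u w else 0)"
    using *[OF u w] *[OF w u] TB.metric_sym[OF carrier_bundle_Pair lift_at_tangent[OF u v]
        lift_at_tangent[OF w v]] by (cases h; cases h') simp_all
qed

lemma form_lift_at:
  "u \<in> tangent_space M p \<Longrightarrow> w \<in> tangent_space M p \<Longrightarrow>
   \<omega> (p, v) (lift_at h (p, v) u) (lift_at h' (p, v) w)
    = (if h = h' then 0 else if h then g p u w else - g p u w)"
  by (auto simp: fundamental_form_def J_lift_at metric_lift_at metric_uminus_left[OF p])

lemma J_tangent:
  assumes "w \<in> tangent_space TM (p, v)"
  shows "J\<^sub>1 (p, v) w \<in> tangent_space TM (p, v)"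
proof -
  obtain u where u: "\<And>h. u h \<in> tangent_space M p" "w = (\<Sum>h\<in>UNIV. lift_at h (p, v) (u h))"
    using lift_at_decompose[OF assms p v] by blast
  have "J\<^sub>1 (p, v) w = (\<Sum>h\<in>UNIV. J\<^sub>1 (p, v) (lift_at h (p, v) (u h)))"
    using J_sum[OF carrier_bundle_Pair, of UNIV "\<lambda>h. lift_at h (p, v) (u h)" "\<lambda>_. 1"] u v
    by (simp add: lift_at_tangent del: sum_fun_apply)
  then show ?thesis
    using u v by (simp add: J_lift_at lift_at_tangent TB.tangent_sum del: sum_fun_apply)
qed

lemma lift_at_nondegenerate:
  assumes w: "w \<in> tangent_space TM (p, v)" "w' \<in> tangent_space TM (p, v)"
    and eq: "\<And>h u. u \<in> tangent_space M p \<Longrightarrow>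
      g\<^sub>1 (p, v) w (lift_at h (p, v) u) = g\<^sub>1 (p, v) w' (lift_at h (p, v) u)"
  shows "w = w'"
proof -
  have "w - w' \<in> tangent_space TM (p, v)" using w by simp
  then obtain u where u: "\<And>h. u h \<in> tangent_space M p"
    and diff: "w - w' = (\<Sum>h\<in>UNIV. lift_at h (p, v) (u h))"
    using lift_at_decompose[OF _ p v] by blast
  note tangent = lift_at_tangent[OF u v]
  have "u h = 0" for h
  proof (rule ccontr)
    assume "u h \<noteq> 0"
    have "g p (u h) (u h)
        = (\<Sum>h'\<in>UNIV. g\<^sub>1 (p, v) (lift_at h' (p, v) (u h')) (lift_at h (p, v) (u h)))"
      using u by (simp add: metric_lift_at)
    also have "\<dots> = g\<^sub>1 (p, v) (w - w') (lift_at h (p, v) (u h))"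
      unfolding diff by (rule TB.metric_sum_left[OF carrier_bundle_Pair tangent tangent, symmetric])
    also have "\<dots> = 0"
      using eq[OF u] w tangent
      by (simp add: TB.metric_diff_left[OF carrier_bundle_Pair] del: minus_apply)
    finally show False
      using metric_pos[OF p u \<open>u h \<noteq> 0\<close>] by simp
  qed
  then have "w - w' = 0"
    unfolding diff by (simp only: lift_at_zero sum.neutral_const)
  then show ?thesis by (simp only: right_minus_eq)
qed

end

definition chern_coefficient ::
    "bool \<Rightarrow> bool \<Rightarrow> ('m \<Rightarrow> 'i \<Rightarrow> 'e) \<Rightarrow> ('m \<Rightarrow> 'i \<Rightarrow> 'e) \<Rightarrow> 'm \<Rightarrow> 'i \<Rightarrow> 'e" where
  "chern_coefficient a b X Y = (if a then mean_connection X Y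
     else (\<lambda>p. (if b then 1 / 2 else - 1 / 2) \<cdot> nonmetricity X Y p))"

lemma J_lift:
  "U \<subseteq> carrier_of M \<Longrightarrow> vector_field M U X \<Longrightarrow> \<xi> \<in> bundle_over M U \<Longrightarrow>
   J\<^sub>1 \<xi> (lift h X \<xi>) = lift (\<not> h) (if h then X else - X) \<xi>"
  by (cases \<xi>) (auto simp: lift_eq_lift_at[of _ _ "(_, _)"] J_lift_at vector_field_tangent)

context
  fixes U p v
  assumes U: "mopen M U" "p \<in> U" and v: "v \<in> tangent_space M p"
begin

private lemma carrier: "q \<in> U \<Longrightarrow> q \<in> carrier_of M"
  by (rule carrier_of_mopen[OF U(1)])

private lemma bundle_over: "mopen TM (bundle_over M U)" "(p, v) \<in> bundle_over M U"
  using U v by (simp_all add: mopen_bundle_over)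

lemma dir_deriv_metric_lift:
  assumes X: "vector_field M U X" and Y: "vector_field M U Y" and Z: "vector_field M U Z"
  shows "dir_deriv TM (lift a X) (\<lambda>\<xi>. g\<^sub>1 \<xi> (lift b Y \<xi>) (lift c Z \<xi>)) (p, v)
    = (if a \<and> b = c then dir_deriv M X (\<lambda>q. g q (Y q) (Z q)) p else 0)"
proof -
  let ?f = "\<lambda>q. if b = c then g q (Y q) (Z q) else 0"
  have "dir_deriv TM (lift a X) (\<lambda>\<xi>. g\<^sub>1 \<xi> (lift b Y \<xi>) (lift c Z \<xi>)) (p, v)
      = (if a then dir_deriv M X ?f p else 0)"
  proof (rule dir_deriv_lift[where X = X, OF U v vector_field_tangent[OF X U(2)]])
    show "smooth_fun M U ?f"
      using metric_smooth[OF U(1) Y Z] smooth_fun_const[OF U(1)] by (cases "b = c") simp_all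
    show "g\<^sub>1 (q, w) (lift b Y (q, w)) (lift c Z (q, w)) = ?f q"
      if "q \<in> U" "w \<in> tangent_space M q" for q w
      using that Y Z by (simp add: lift_eq_lift_at metric_lift_at carrier vector_field_tangent)
  qed
  then show ?thesis by (simp add: dir_deriv_const[OF U])
qed

lemma dir_deriv_form_lift:
  assumes X: "vector_field M U X" and Y: "vector_field M U Y" and Z: "vector_field M U Z"
  shows "dir_deriv TM (lift a X) (\<lambda>\<xi>. \<omega> \<xi> (lift b Y \<xi>) (lift c Z \<xi>)) (p, v)
    = (if a \<and> b \<noteq> c then (if b then 1 else - 1) * dir_deriv M X (\<lambda>q. g q (Y q) (Z q)) p else 0)"
proof -
  let ?f = "\<lambda>q. if b = c then 0 else if b then g q (Y q) (Z q) else - g q (Y q) (Z q)"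
  note smooth = metric_smooth[OF U(1) Y Z]
  have "dir_deriv TM (lift a X) (\<lambda>\<xi>. \<omega> \<xi> (lift b Y \<xi>) (lift c Z \<xi>)) (p, v)
      = (if a then dir_deriv M X ?f p else 0)"
  proof (rule dir_deriv_lift[where X = X, OF U v vector_field_tangent[OF X U(2)]])
    show "smooth_fun M U ?f"
      using smooth smooth_fun_const[OF U(1)] smooth_fun_uminus[OF U(1) smooth]
      by (cases b; cases c) simp_all
    show "\<omega> (q, w) (lift b Y (q, w)) (lift c Z (q, w)) = ?f q"
      if "q \<in> U" "w \<in> tangent_space M q" for q w
      using that Y Z by (simp add: lift_eq_lift_at form_lift_at carrier vector_field_tangent)
  qed
  then show ?thesis
    using dir_deriv_uminus[where X = X, OF U smooth vector_field_tangent[OF X U(2)]]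
    by (simp add: dir_deriv_const[OF U])
qed

private abbreviation nonmet where "nonmet X Y Z \<equiv> g p (nonmetricity X Y p) (Z p)"
private abbreviation nabla where "nabla X Y Z \<equiv> g p (nab X Y p) (Z p)"

private lemma nab_tangent:
  "vector_field M U X \<Longrightarrow> vector_field M U Y \<Longrightarrow> nab X Y p \<in> tangent_space M p"
  by (rule vector_field_tangent[OF connection_vector_field[OF U(1)] U(2)])

private lemma dir_deriv_metric:
  assumes "vector_field M U X" "vector_field M U Y" "vector_field M U Z"
  shows "dir_deriv M X (\<lambda>q. g q (Y q) (Z q)) p = nonmet X Y Z + nabla X Y Z + nabla X Z Y"
  using metric_nonmetricity[OF U(1) assms U(2)]
    metric_sym[OF carrier[OF U(2)] vector_field_tangent[OF assms(2) U(2)]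
        nab_tangent[OF assms(1,3)]]
  by simp

private abbreviation bracket where
  "bracket a b X Y Z \<equiv> (if a then nabla X Y Z else 0) - (if b then nabla Y X Z else 0)"

private lemma metric_bracket_lift:
  assumes X: "vector_field M U X" and Y: "vector_field M U Y" and Z: "vector_field M U Z"
  shows "g\<^sub>1 (p, v) (lie_bracket TM (lift a X) (lift b Y) (p, v)) (lift c Z (p, v))
      = (if (a \<and> b) = c then bracket a b X Y Z else 0)" (is ?metric)
    and "\<omega> (p, v) (lie_bracket TM (lift a X) (lift b Y) (p, v)) (lift c Z (p, v))
      = (if (a \<and> b) = c then 0 else (if a \<and> b then 1 else - 1) * bracket a b X Y Z)" (is ?form)
proof -
  note tangent = vector_field_tangent[OF Z U(2)] nab_tangent[OF X Y] nab_tangent[OF Y X]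
  have zero: "g p 0 (Z p) = 0" by (rule metric_zero_left[OF carrier[OF U(2)] tangent(1)])
  have bracket_tangent:
    "(if a then nab X Y p else 0) - (if b then nab Y X p else 0) \<in> tangent_space M p"
    using tangent by (simp del: minus_apply)
  have metric_bracket:
    "g p ((if a then nab X Y p else 0) - (if b then nab Y X p else 0)) (Z p) = bracket a b X Y Z"
    using tangent zero by (subst metric_diff_left[OF carrier[OF U(2)]]) simp_all
  show ?metric ?form
    unfolding lie_bracket_lift[OF U X Y v] lift_eq_lift_at[of c] fst_conv
      metric_lift_at[OF carrier[OF U(2)] v bracket_tangent tangent(1)]
      form_lift_at[OF carrier[OF U(2)] v bracket_tangent tangent(1)] metric_bracket
    by simp_all
qed

lemma ext_deriv_form_lift:
  assumes X: "vector_field M U X" and Y: "vector_field M U Y" and Z: "vector_field M U Z"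
  shows "ext_deriv TM \<omega> (lift a X) (lift b Y) (lift c Z) (p, v)
    = (if a \<and> b \<and> \<not> c then nonmet X Y Z - nonmet Y X Z
       else if a \<and> \<not> b \<and> c then nonmet Z X Y - nonmet X Z Y
       else if \<not> a \<and> b \<and> c then nonmet Y Z X - nonmet Z Y X else 0)"
  unfolding ext_deriv_def dir_deriv_form_lift[OF X Y Z] dir_deriv_form_lift[OF Y Z X]
    dir_deriv_form_lift[OF Z X Y] metric_bracket_lift(2)[OF X Y Z] metric_bracket_lift(2)[OF Y Z X]
    metric_bracket_lift(2)[OF Z X Y] dir_deriv_metric[OF X Y Z] dir_deriv_metric[OF Y Z X]
    dir_deriv_metric[OF Z X Y]
  using nonmetricity_symmetric[OF U(1) X Y Z U(2)] nonmetricity_symmetric[OF U(1) Y Z X U(2)]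
    nonmetricity_symmetric[OF U(1) Z X Y U(2)]
  by (cases a; cases b; cases c) simp_all

lemma ext_deriv_form_J_lift:
  assumes X: "vector_field M U X" and Y: "vector_field M U Y" and Z: "vector_field M U Z"
  shows "ext_deriv TM \<omega> (\<lambda>\<xi>. J\<^sub>1 \<xi> (lift a X \<xi>)) (lift b Y) (lift c Z) (p, v)
    = (if a \<and> b \<and> c then nonmet Y Z X - nonmet Z Y X
       else if \<not> a \<and> b \<and> \<not> c then nonmet Y X Z - nonmet X Y Z
       else if \<not> a \<and> \<not> b \<and> c then nonmet X Z Y - nonmet Z X Y else 0)"
proof -
  let ?X = "if a then X else - X"
  have X': "vector_field M U ?X"
    using X vector_field_uminus[OF U(1) X] by simp
  have uminus: "nonmet (- X) Y Z = - nonmet X Y Z" "nonmet Y (- X) Z = - nonmet Y X Z"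
    if "vector_field M U Y" "vector_field M U Z" for Y Z
    using tensorial_uminus[OF tensor_field_tensorial_left[OF tensor_field_nonmetricity U that(1)]
        U(1) X]
      tensorial_uminus[OF tensor_field_tensorial_right[OF tensor_field_nonmetricity U that(1)]
        U(1) X]
      metric_uminus_left[OF carrier[OF U(2)] vector_field_tangent[OF
          vector_field_nonmetricity[OF U(1)] U(2)] vector_field_tangent[OF that(2) U(2)]] X that
    by simp_all
  have "ext_deriv TM \<omega> (\<lambda>\<xi>. J\<^sub>1 \<xi> (lift a X \<xi>)) (lift b Y) (lift c Z) (p, v)
      = ext_deriv TM \<omega> (lift (\<not> a) ?X) (lift b Y) (lift c Z) (p, v)"
    by (rule TB.ext_deriv_cong[OF bundle_over]) (rule J_lift[OF mopen_carrier[OF U(1)] X])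
  then show ?thesis
    unfolding ext_deriv_form_lift[OF X' Y Z] using uminus[OF Y Z] uminus[OF Z Y]
    by (cases a; cases b; cases c) simp_all
qed

lemma chern_lift_component:
  assumes X: "vector_field M U X" and Y: "vector_field M U Y" and Z: "vector_field M U Z"
  shows "g\<^sub>1 (p, v) (C (lift a X) (lift b Y) (p, v)) (lift c Z (p, v))
    = (if c = (a = b) then g p (chern_coefficient a b X Y p) (Z p) else 0)"
proof -
  note lift = vector_field_lift[OF U(1)]
  obtain LC where LC: "levi_civita TM g\<^sub>1 LC" and C_eq: "\<And>X Y Z.
      vector_field TM (bundle_over M U) X \<Longrightarrow> vector_field TM (bundle_over M U) Y \<Longrightarrow>
      vector_field TM (bundle_over M U) Z \<Longrightarrow>
      g\<^sub>1 (p, v) (C X Y (p, v)) (Z (p, v)) = g\<^sub>1 (p, v) (LC X Y (p, v)) (Z (p, v))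
        - 1 / 2 * ext_deriv TM \<omega> (\<lambda>\<xi>. J\<^sub>1 \<xi> (X \<xi>)) Y Z (p, v)"
    using chern bundle_over unfolding chern_connection_def by blast
  have S: "g p (r \<cdot> nonmetricity X Y p) (Z p) = r * nonmet X Y Z" for r
    using vector_field_nonmetricity[OF U(1) X Y] Z U(2)
    by (intro metric_scale_left[OF carrier[OF U(2)]] vector_field_tangent)
  have "2 * g\<^sub>1 (p, v) (C (lift a X) (lift b Y) (p, v)) (lift c Z (p, v))
      = 2 * g\<^sub>1 (p, v) (LC (lift a X) (lift b Y) (p, v)) (lift c Z (p, v))
        - ext_deriv TM \<omega> (\<lambda>\<xi>. J\<^sub>1 \<xi> (lift a X \<xi>)) (lift b Y) (lift c Z) (p, v)"
    by (simp add: C_eq lift X Y Z)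
  also have "\<dots> = (if c = (a = b) then
      if a then 2 * nabla X Y Z + nonmet X Y Z else if b then nonmet X Y Z else - nonmet X Y Z
      else 0)"
    unfolding TB.koszul[OF LC bundle_over lift[OF X] lift[OF Y] lift[OF Z]]
      ext_deriv_form_J_lift[OF X Y Z] dir_deriv_metric_lift[OF X Y Z]
      dir_deriv_metric_lift[OF Y X Z]
      dir_deriv_metric_lift[OF Z X Y] metric_bracket_lift(1)[OF X Y Z]
      metric_bracket_lift(1)[OF X Z Y] metric_bracket_lift(1)[OF Y Z X]
      dir_deriv_metric[OF X Y Z] dir_deriv_metric[OF Y X Z] dir_deriv_metric[OF Z X Y]
    using nonmetricity_symmetric[OF U(1) X Y Z U(2)] nonmetricity_symmetric[OF U(1) Y Z X U(2)]
      nonmetricity_symmetric[OF U(1) Z X Y U(2)]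
    by (cases a; cases b; cases c) simp_all
  finally show ?thesis
    using metric_mean_connection[OF U(1) X Y Z U(2)]
    by (cases a; cases b; cases c) (simp_all add: chern_coefficient_def S del: vscale_apply)
qed

end

lemma vector_field_chern_coefficient:
  assumes "mopen M U" "vector_field M U X" "vector_field M U Y"
  shows "vector_field M U (chern_coefficient a b X Y)"
  using assms by (simp add: chern_coefficient_def vector_field_mean_connection
      vector_field_nonmetricity vector_field_scale smooth_fun_const del: vscale_apply)

proposition chern_lift:
  assumes U: "mopen M U" and X: "vector_field M U X" and Y: "vector_field M U Y"
    and \<xi>: "\<xi> \<in> bundle_over M U"
  shows "C (lift a X) (lift b Y) \<xi> = lift (a = b) (chern_coefficient a b X Y) \<xi>"
proof -
  obtain p v where pv: "\<xi> = (p, v)" and p: "p \<in> U" and v: "v \<in> tangent_space M p"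
    using \<xi> by (cases \<xi>) auto
  have carrier: "p \<in> carrier_of M" by (rule carrier_of_mopen[OF U p])
  obtain i where i: "i \<in> charts_at M p" using carrier_chart[OF carrier] by blast
  define V where "V = U \<inter> cdom M i"
  have V: "mopen M V" "p \<in> V" "V \<subseteq> U" "V \<subseteq> cdom M i"
    using U p i by (auto simp: V_def charts_at_iff mopen_Int mopen_cdom)
  have coeff: "chern_coefficient a b X Y p \<in> tangent_space M p"
    by (rule vector_field_tangent[OF vector_field_chern_coefficient[OF U X Y] p])
  have "C (lift a X) (lift b Y) (p, v) = lift_at (a = b) (p, v) (chern_coefficient a b X Y p)"
  proof (rule lift_at_nondegenerate[OF carrier v])
    show "C (lift a X) (lift b Y) (p, v) \<in> tangent_space TM (p, v)"
      by (rule TB.vector_field_tangent[OF C.connection_vector_field[OF mopen_bundle_over[OF U]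
              vector_field_lift[OF U X] vector_field_lift[OF U Y]]]) (use p v in simp)
    show "lift_at (a = b) (p, v) (chern_coefficient a b X Y p) \<in> tangent_space TM (p, v)"
      by (rule lift_at_tangent[OF coeff v])
    fix h u assume u: "u \<in> tangent_space M p"
    let ?Z = "const_field M i (u i)"
    have "vector_field M V ?Z"
      using V i by (intro vector_field_const_field) (auto simp: charts_at_iff)
    then have "g\<^sub>1 (p, v) (C (lift a X) (lift b Y) (p, v)) (lift h ?Z (p, v))
        = (if h = (a = b) then g p (chern_coefficient a b X Y p) (?Z p) else 0)"
      by (intro chern_lift_component[OF V(1,2) v] vector_field_subset[OF X V(3)]
          vector_field_subset[OF Y V(3)])
    then show "g\<^sub>1 (p, v) (C (lift a X) (lift b Y) (p, v)) (lift_at h (p, v) u)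
        = g\<^sub>1 (p, v) (lift_at (a = b) (p, v) (chern_coefficient a b X Y p)) (lift_at h (p, v) u)"
      using tangent_eq_const_field[OF u i] coeff u
      by (auto simp: lift_eq_lift_at[of _ _ "(p, v)"] metric_lift_at[OF carrier v])
  qed
  then show ?thesis by (simp add: pv lift_eq_lift_at[of _ _ "(p, v)"])
qed

section \<open>The Ricci form\<close>

context
  fixes U p v
  assumes U: "mopen M U" "p \<in> U" and v: "v \<in> tangent_space M p"
begin

private lemma chern_lift_Pair:
  "vector_field M U X \<Longrightarrow> vector_field M U Y \<Longrightarrow>
   C (lift a X) (lift b Y) (p, v) = lift_at (a = b) (p, v) (chern_coefficient a b X Y p)"
  using chern_lift[OF U(1), of X Y "(p, v)" a b] U(2) v
  by (simp add: lift_eq_lift_at[of _ _ "(p, v)"])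

private lemma chern_chern_lift:
  assumes X: "vector_field M U X" and Y: "vector_field M U Y" and Z: "vector_field M U Z"
  shows "C (lift a X) (C (lift b Y) (lift c Z)) (p, v)
    = lift_at (a = (b = c)) (p, v) (chern_coefficient a (b = c) X (chern_coefficient b c Y Z) p)"
proof -
  note coeff = vector_field_chern_coefficient[OF U(1) Y Z]
  have "C (lift a X) (C (lift b Y) (lift c Z)) (p, v)
      = C (lift a X) (lift (b = c) (chern_coefficient b c Y Z)) (p, v)"
    using U v by (intro C.connection_connection_cong[OF mopen_bundle_over[OF U(1)]]
        vector_field_lift X Y Z coeff chern_lift[OF U(1) Y Z]) simp_all
  then show ?thesis
    by (simp only: chern_lift_Pair[OF X coeff])
qed

context
  fixes X Y Z
  assumes X: "vector_field M U X" and Y: "vector_field M U Y" and Z: "vector_field M U Z"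
begin

private lemma chern_lie_bracket_lift:
  assumes W: "W = (if a then nab X Y else 0) - (if b then nab Y X else 0)"
  shows "C (lie_bracket TM (lift a X) (lift b Y)) (lift c Z) (p, v)
    = lift_at ((a = b) = c) (p, v) (chern_coefficient (a \<and> b) c W Z p)"
proof -
  have W_field: "vector_field M U W"
    unfolding W using connection_vector_field[OF U(1)] X Y vector_field_zero[OF U(1)]
    by (intro vector_field_diff[OF U(1)]) auto
  note bundle_open = mopen_bundle_over[OF U(1)] and lift = vector_field_lift[OF U(1)]
  note bracket = TB.vector_field_lie_bracket[OF bundle_open lift[OF X] lift[OF Y]]
  have "C (lie_bracket TM (lift a X) (lift b Y)) (lift c Z) (p, v)
      = C (lift (a \<and> b) W) (lift c Z) (p, v)"
  proof (rule C.connection_cong[OF bundle_open bracket lift[OF W_field] lift[OF Z] lift[OF Z]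
        _ refl])
    fix \<xi> assume "\<xi> \<in> bundle_over M U"
    then obtain q w where \<xi>: "\<xi> = (q, w)" "q \<in> U" "w \<in> tangent_space M q" by (cases \<xi>) auto
    have "W q = (if a then nab X Y q else 0) - (if b then nab Y X q else 0)"
      by (simp add: W)
    then show "lie_bracket TM (lift a X) (lift b Y) \<xi> = lift (a \<and> b) W \<xi>"
      by (simp only: \<xi> lie_bracket_lift[OF U(1) \<xi>(2) X Y \<xi>(3)] lift_eq_lift_at[of _ _ "(q, w)"]
          fst_conv)
  qed (use U v in simp)
  also have "\<dots> = lift_at ((a = b) = c) (p, v) (chern_coefficient (a \<and> b) c W Z p)"
  proof (cases "a \<or> b")
    case True
    then have "((a \<and> b) = c) = ((a = b) = c)" by auto
    then show ?thesis by (simp add: chern_lift_Pair[OF W_field Z])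
  next
    case False
    then have "W = 0" by (simp add: W)
    then have "chern_coefficient (a \<and> b) c W Z p = 0"
      using tensorial_zero[OF tensor_field_tensorial_left[OF tensor_field_nonmetricity U Z] U(1)]
        False
      by (simp add: chern_coefficient_def)
    then show ?thesis by (simp only: chern_lift_Pair[OF W_field Z] lift_at_zero)
  qed
  finally show ?thesis .
qed

lemma curvature_lift:
  "curvature TM C (lift a X) (lift b Y) (lift c Z) (p, v) = lift_at ((a = b) = c) (p, v)
    (chern_coefficient (a \<and> b) c ((if a then nab X Y else 0) - (if b then nab Y X else 0)) Z p
      - chern_coefficient a (b = c) X (chern_coefficient b c Y Z) p
      + chern_coefficient b (a = c) Y (chern_coefficient a c X Z) p)"
proof -
  have "(a = (b = c)) = ((a = b) = c)" "(b = (a = c)) = ((a = b) = c)" by auto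
  moreover have "curvature TM C (lift a X) (lift b Y) (lift c Z) (p, v)
      = C (lie_bracket TM (lift a X) (lift b Y)) (lift c Z) (p, v)
        - C (lift a X) (C (lift b Y) (lift c Z)) (p, v)
        + C (lift b Y) (C (lift a X) (lift c Z)) (p, v)"
    by (simp add: curvature_def)
  ultimately show ?thesis
    unfolding chern_lie_bracket_lift[OF refl] chern_chern_lift[OF X Y Z] chern_chern_lift[OF Y X Z]
    by (simp only: lift_at_add lift_at_diff)
qed

lemma curvature_lift_same:
  "\<exists>u\<in>tangent_space M p. curvature TM C (lift a X) (lift a Y) (lift c Z) (p, v)
    = lift_at c (p, v) u"
  unfolding curvature_lift simp_thms
  by (rule bexI, rule refl, intro tangent_add tangent_diff vector_field_diff[OF U(1)]
      vector_field_tangent[OF vector_field_chern_coefficient[OF U(1)] U(2)])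
    (use X Y Z connection_vector_field[OF U(1)] vector_field_zero[OF U(1)]
      vector_field_chern_coefficient[OF U(1)] in simp_all)

lemma curvature_lift_mixed:
  "curvature TM C (lift True X) (lift False Y) (lift c Z) (p, v)
    = lift_at (\<not> c) (p, v) ((if c then 1 / 2 else - 1 / 2) \<cdot> mixed_curvature X Y Z p)"
  unfolding curvature_lift
  using mean.connection_scale_const_right[OF U(1) X vector_field_nonmetricity[OF U(1) Y Z] U(2)]
  by (simp add: chern_coefficient_def mixed_curvature_def vscale_add_right vscale_diff_right
      algebra_simps)

end

end

context
  fixes U E p v
  assumes E: "orthonormal_frame M g U E" and p: "p \<in> U" and v: "v \<in> tangent_space M p"
begin

private abbreviation component where
  "component a b X Y k c \<equiv> g\<^sub>1 (p, v) (curvature TM C (lift a X) (lift b Y) (lift c (E k)) (p, v))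
     (J\<^sub>1 (p, v) (lift_at c (p, v) (E k p)))"

private lemmas base_open = orthonormal_frameD(1)[OF E]

private lemma base_carrier: "p \<in> carrier_of M"
  by (rule carrier_of_mopen[OF base_open p])

private lemma frame: "k < DIM('e) \<Longrightarrow> vector_field M U (E k)"
  "k < DIM('e) \<Longrightarrow> E k p \<in> tangent_space M p"
  using orthonormal_frameD(2)[OF E] vector_field_tangent[OF _ p] by blast+

private lemma curvature_component_same:
  assumes k: "k < DIM('e)" and X: "vector_field M U X" and Y: "vector_field M U Y"
  shows "component a a X Y k c = 0"
proof -
  obtain u where "u \<in> tangent_space M p"
    "curvature TM C (lift a X) (lift a Y) (lift c (E k)) (p, v) = lift_at c (p, v) u"
    using curvature_lift_same[OF base_open p v X Y frame(1)[OF k]] by blast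
  then show ?thesis
    using frame(2)[OF k]
    by (simp add: J_lift_at[OF base_carrier v] metric_lift_at[OF base_carrier v])
qed

private lemma curvature_component_mixed:
  assumes k: "k < DIM('e)" and X: "vector_field M U X" and Y: "vector_field M U Y"
  shows "2 * component True False X Y k c = g p (mixed_curvature X Y (E k) p) (E k p)"
proof -
  have "mixed_curvature X Y (E k) p \<in> tangent_space M p"
    by (rule vector_field_tangent[OF
          vector_field_mixed_curvature[OF base_open X Y frame(1)[OF k]] p])
  then show ?thesis
    unfolding curvature_lift_mixed[OF base_open p v X Y frame(1)[OF k]] using frame(2)[OF k]
    by (simp add: J_lift_at[OF base_carrier v] metric_lift_at[OF base_carrier v]
        metric_scale_left[OF base_carrier]
        metric_uminus_right[OF base_carrier])
qed

private lemma curvature_component_swap: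
  assumes k: "k < DIM('e)" and X: "vector_field M U X" and Y: "vector_field M U Y"
  shows "component b a Y X k c = - component a b X Y k c"
proof -
  note bundle_open = mopen_bundle_over[OF base_open] and lift = vector_field_lift[OF base_open]
  have \<xi>: "(p, v) \<in> bundle_over M U" using p v by simp
  have "curvature TM C (lift b Y) (lift a X) (lift c (E k)) (p, v)
      = - curvature TM C (lift a X) (lift b Y) (lift c (E k)) (p, v)"
    by (rule C.curvature_swap[OF bundle_open \<xi> lift[OF X] lift[OF Y] lift[OF frame(1)[OF k]]])
  moreover have
    "curvature TM C (lift a X) (lift b Y) (lift c (E k)) (p, v) \<in> tangent_space TM (p, v)"
    by (rule TB.vector_field_tangent[OF C.vector_field_curvature[OF bundle_open lift[OF X]
        lift[OF Y]
            lift[OF frame(1)[OF k]]] \<xi>])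
  ultimately show ?thesis
    using TB.metric_uminus_left[OF carrier_bundle_Pair[OF base_carrier v] _
        J_tangent[OF base_carrier v lift_at_tangent[OF frame(2)[OF k] v]]] by simp
qed

lemma trace_curvature_lift:
  assumes trace: "trace_vanishes M g \<gamma>\<^sub>s" and X: "vector_field M U X" and Y: "vector_field M U Y"
  shows "(\<Sum>k<DIM('e). \<Sum>c\<in>UNIV. component a b X Y k c) = 0"
proof -
  have mixed: "(\<Sum>k<DIM('e). \<Sum>c\<in>UNIV. component True False X Y k c) = 0"
    if X: "vector_field M U X" and Y: "vector_field M U Y" for X Y
  proof -
    have "(\<Sum>c\<in>UNIV. component True False X Y k c) = g p (mixed_curvature X Y (E k) p) (E k p)"
      if "k < DIM('e)" for k
      using curvature_component_mixed[OF that X Y, of True]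
        curvature_component_mixed[OF that X Y, of False]
      by (simp add: UNIV_bool)
    then show ?thesis
      using trace_mixed_curvature[OF trace E p X Y] by simp
  qed
  consider "a = b" | "a" "\<not> b" | "\<not> a" "b" by blast
  then show ?thesis
  proof cases
    case 1
    then show ?thesis using curvature_component_same[OF _ X Y] by simp
  next
    case 2
    then show ?thesis using mixed[OF X Y] by simp
  next
    case 3
    then show ?thesis
      using mixed[OF Y X] by (simp add: curvature_component_swap[OF _ Y X] sum_negf)
  qed
qed

end

lemma orthonormal_at_lift:
  assumes p: "p \<in> carrier_of M" and v: "v \<in> tangent_space M p" and e: "orthonormal_at p K e"
  shows "TB.orthonormal_at (p, v) (K \<times> UNIV) (\<lambda>(k, c). lift_at c (p, v) (e k))"
  using e v
  by (auto simp: orthonormal_at_def TB.orthonormal_at_def metric_lift_at[OF p v] lift_at_tangent)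

context
  fixes U \<xi> i
  assumes U: "mopen TM U" "\<xi> \<in> U" "U \<subseteq> cdom TM i" and i: "i \<in> idx M"
begin

lemma vector_field_lift_decompose:
  assumes W: "vector_field TM U W"
  obtains W' where "\<And>a. vector_field M (cdom M i) (W' a)" "W \<xi> = (\<Sum>a\<in>UNIV. lift a (W' a) \<xi>)"
proof -
  obtain p v where \<xi>: "\<xi> = (p, v)" "p \<in> cdom M i" "v \<in> tangent_space M p"
    using U by (cases \<xi>) auto
  then have p: "i \<in> charts_at M p" "p \<in> carrier_of M"
    using i by (auto simp: charts_at_iff carrier_of_def)
  obtain u where u: "\<And>a. u a \<in> tangent_space M p"
    and W_eq: "W (p, v) = (\<Sum>a\<in>UNIV. lift_at a (p, v) (u a))"
    by (rule lift_at_decompose[OF TB.vector_field_tangent[OF W U(2)[unfolded \<xi>(1)]] p(2) \<xi>(3)])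
      (rule that)
  have "lift_at a (p, v) (u a) = lift a (const_field M i (u a i)) (p, v)" for a
    using tangent_eq_const_field[OF u p(1), of a] by (simp add: lift_eq_lift_at[of _ _ "(p, v)"])
  then have "W \<xi> = (\<Sum>a\<in>UNIV. lift a (const_field M i (u a i)) \<xi>)"
    using W_eq \<xi>(1) by simp
  with vector_field_const_field_cdom[OF i] show thesis by (rule that)
qed

lemma curvature_lift_decompose:
  assumes X: "vector_field TM U X" and Y: "vector_field TM U Y"
  obtains X' Y' where "\<And>a. vector_field M (cdom M i) (X' a)" "\<And>a. vector_field M (cdom M i) (Y' a)"
    "\<And>Z. vector_field TM U Z \<Longrightarrow> curvature TM C X Y Z \<xi>
      = (\<Sum>a\<in>UNIV. \<Sum>b\<in>UNIV. curvature TM C (lift a (X' a)) (lift b (Y' b)) Z \<xi>)"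
proof -
  obtain X' where X': "\<And>a. vector_field M (cdom M i) (X' a)" "X \<xi> = (\<Sum>a\<in>UNIV. lift a (X' a) \<xi>)"
    by (rule vector_field_lift_decompose[OF X]) (rule that)
  obtain Y' where Y': "\<And>a. vector_field M (cdom M i) (Y' a)" "Y \<xi> = (\<Sum>a\<in>UNIV. lift a (Y' a) \<xi>)"
    by (rule vector_field_lift_decompose[OF Y]) (rule that)
  note lift = vector_field_lift_cdom[OF i U(3)]
  have "curvature TM C X Y Z \<xi>
      = (\<Sum>a\<in>UNIV. \<Sum>b\<in>UNIV. curvature TM C (lift a (X' a)) (lift b (Y' b)) Z \<xi>)"
    if Z: "vector_field TM U Z" for Z
  proof -
    have "curvature TM C X Y Z \<xi> = (\<Sum>a\<in>UNIV. curvature TM C (lift a (X' a)) Y Z \<xi>)"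
      using TB.tensorial_lincomb_at[OF C.curvature_tensorial_first[OF U(1,2) Y Z] U(1) _ U(3) X,
          where Z = "\<lambda>a. lift a (X' a)" and c = "\<lambda>_. 1" and K = UNIV] i X' lift
      by (simp del: sum_fun_apply)
    also have "\<dots> = (\<Sum>a\<in>UNIV. \<Sum>b\<in>UNIV. curvature TM C (lift a (X' a)) (lift b (Y' b)) Z \<xi>)"
      using TB.tensorial_lincomb_at[OF C.curvature_tensorial_second[OF U(1,2) lift[OF X'(1)] Z]
          U(1) _ U(3) Y, where Z = "\<lambda>a. lift a (Y' a)" and c = "\<lambda>_. 1" and K = UNIV] i Y' lift
      by (intro sum.cong refl) (simp del: sum_fun_apply)
    finally show ?thesis .
  qed
  with X'(1) Y'(1) show thesis by (rule that)
qed

end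

context
  fixes U i E p v
  assumes U: "mopen TM U" "(p, v) \<in> U" "U \<subseteq> cdom TM i" and i: "i \<in> idx M"
    and E: "orthonormal_frame M g (cdom M i) E"
begin

private lemma base_point: "p \<in> cdom M i" "p \<in> carrier_of M" "v \<in> tangent_space M p"
  using subsetD[OF U(3,2)] i by (auto simp: carrier_of_def)

private lemma vector_field_lift_frame: "k < DIM('e) \<Longrightarrow> vector_field TM U (lift c (E k))"
  by (intro vector_field_lift_cdom[OF i U(3)] orthonormal_frameD(2)[OF E])

lemma trace_curvature_lift_frame:
  assumes trace: "trace_vanishes M g \<gamma>\<^sub>s" and X: "vector_field TM U X" and Y: "vector_field TM U Y"
  shows "(\<Sum>k<DIM('e). \<Sum>c\<in>UNIV. g\<^sub>1 (p, v) (curvature TM C X Y (lift c (E k)) (p, v))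
    (J\<^sub>1 (p, v) (lift c (E k) (p, v)))) = 0"
proof -
  obtain X' Y' where X': "\<And>a. vector_field M (cdom M i) (X' a)"
    and Y': "\<And>a. vector_field M (cdom M i) (Y' a)"
    and decompose: "\<And>Z. vector_field TM U Z \<Longrightarrow> curvature TM C X Y Z (p, v)
      = (\<Sum>a\<in>UNIV. \<Sum>b\<in>UNIV. curvature TM C (lift a (X' a)) (lift b (Y' b)) Z (p, v))"
    by (rule curvature_lift_decompose[OF U i X Y]) (rule that)
  let ?K = "\<lambda>a b k c. g\<^sub>1 (p, v)
    (curvature TM C (lift a (X' a)) (lift b (Y' b)) (lift c (E k)) (p, v))
    (J\<^sub>1 (p, v) (lift c (E k) (p, v)))"
  have "g\<^sub>1 (p, v) (curvature TM C X Y (lift c (E k)) (p, v)) (J\<^sub>1 (p, v) (lift c (E k) (p, v)))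
      = (\<Sum>a\<in>UNIV. \<Sum>b\<in>UNIV. ?K a b k c)" if k: "k < DIM('e)" for k c
  proof -
    note L = vector_field_lift_frame[OF k, of c]
    have "curvature TM C (lift a (X' a)) (lift b (Y' b)) (lift c (E k)) (p, v)
        \<in> tangent_space TM (p, v)" for a b
      by (rule TB.vector_field_tangent[OF C.vector_field_curvature[OF U(1)
              vector_field_lift_cdom[OF i U(3) X'] vector_field_lift_cdom[OF i U(3) Y'] L] U(2)])
    then show ?thesis
      unfolding decompose[OF L]
      using J_tangent[OF base_point(2,3) TB.vector_field_tangent[OF L U(2)]]
      by (simp add: TB.metric_sum_left[OF carrier_bundle_Pair[OF base_point(2,3)]] TB.tangent_sum
          del: sum_fun_apply)
  qed
  moreover have "(\<Sum>k<DIM('e). \<Sum>c\<in>UNIV. ?K a b k c) = 0" for a b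
    using trace_curvature_lift[OF E base_point(1,3) trace X' Y']
    by (simp only: lift_eq_lift_at[of _ "E _" "(p, v)"] fst_conv)
  ultimately show ?thesis
    by (simp add: UNIV_bool sum.distrib)
qed

lemma trace_curvature_frame_change:
  assumes X: "vector_field TM U X" and Y: "vector_field TM U Y"
    and H: "orthonormal_frame TM g\<^sub>1 U H"
  shows "(\<Sum>k<DIM('e \<times> 'e). g\<^sub>1 (p, v) (curvature TM C X Y (H k) (p, v)) (J\<^sub>1 (p, v) (H k (p, v))))
    = (\<Sum>k<DIM('e). \<Sum>c\<in>UNIV. g\<^sub>1 (p, v) (curvature TM C X Y (lift c (E k)) (p, v))
        (J\<^sub>1 (p, v) (lift c (E k) (p, v))))"
proof -
  let ?L = "\<lambda>kc. lift (snd kc) (E (fst kc))" and ?I = "{..<DIM('e)} \<times> (UNIV :: bool set)"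
  let ?R = "\<lambda>Z. curvature TM C X Y Z (p, v)"
  have "(\<Sum>k<DIM('e \<times> 'e). g\<^sub>1 (p, v) (?R (H k)) (J\<^sub>1 (p, v) (H k (p, v))))
      = (\<Sum>kc\<in>?I. g\<^sub>1 (p, v) (?R (?L kc)) (J\<^sub>1 (p, v) (?L kc (p, v))))"
  proof (rule TB.tensorial_trace_eq[OF U _ C.curvature_tensorial_third[OF U(1,2) X Y]])
    show "?R Z \<in> tangent_space TM (p, v)" if "vector_field TM U Z" for Z
      by (rule TB.vector_field_tangent[OF C.vector_field_curvature[OF U(1) X Y that] U(2)])
    show "J\<^sub>1 (p, v) w \<in> tangent_space TM (p, v)" if "w \<in> tangent_space TM (p, v)" for w
      by (rule J_tangent[OF base_point(2,3) that])
    show "J\<^sub>1 (p, v) (\<Sum>kc\<in>?I. d kc \<cdot> ?L kc (p, v)) = (\<Sum>kc\<in>?I. d kc \<cdot> J\<^sub>1 (p, v) (?L kc (p, v)))"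
      for d
      using TB.vector_field_tangent[OF vector_field_lift_frame U(2)]
      by (intro J_sum carrier_bundle_Pair base_point) auto
    show "TB.orthonormal_at (p, v) ?I (\<lambda>kc. ?L kc (p, v))"
      using orthonormal_at_lift[OF base_point(2,3) orthonormal_frame_at[OF E base_point(1)]]
      by (simp add: lift_eq_lift_at[of _ _ "(p, v)"] case_prod_unfold)
    show "TB.orthonormal_at (p, v) {..<DIM('e \<times> 'e)} (\<lambda>k. H k (p, v))"
      by (rule TB.orthonormal_frame_at[OF H U(2)])
  qed (use i vector_field_lift_frame TB.orthonormal_frameD(2)[OF H] in auto)
  then show ?thesis
    by (simp add: sum.cartesian_product case_prod_unfold)
qed

end

theorem chern_ricci_form_vanishes:
  assumes trace: "trace_vanishes M g \<gamma>\<^sub>s"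
  shows "ricci_form_vanishes TM J\<^sub>1 g\<^sub>1 C"
  unfolding ricci_form_vanishes_def
proof (intro allI impI ballI; elim conjE)
  fix U H X Y \<xi> assume H: "orthonormal_frame TM g\<^sub>1 U H" and \<xi>: "\<xi> \<in> U"
    and X: "vector_field TM U X" and Y: "vector_field TM U Y"
  obtain p v where pv: "\<xi> = (p, v)" and p: "p \<in> carrier_of M" and v: "v \<in> tangent_space M p"
    using TB.mopen_carrier[OF TB.orthonormal_frameD(1)[OF H]] \<xi>
    by (cases \<xi>) (auto simp: carrier_bundle)
  obtain i where i: "i \<in> idx M" "p \<in> cdom M i"
    using carrier_chart[OF p] by (auto simp: charts_at_iff)
  obtain E where E: "orthonormal_frame M g (cdom M i) E"
    using exists_orthonormal_frame[OF i(1)] by blast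
  define V where "V = U \<inter> cdom TM i"
  have V: "mopen TM V" "(p, v) \<in> V" "V \<subseteq> cdom TM i" "V \<subseteq> U"
    using TB.orthonormal_frameD(1)[OF H] TB.mopen_cdom[of i] \<xi> i v
    by (auto simp: V_def pv intro: TB.mopen_Int)
  have "orthonormal_frame TM g\<^sub>1 V H"
    using H V(1,4) TB.vector_field_subset unfolding orthonormal_frame_def by blast
  then show "ricci_form TM J\<^sub>1 g\<^sub>1 C H X Y \<xi> = 0"
    using trace_curvature_lift_frame[OF V(1-3) i(1) E trace]
      trace_curvature_frame_change[OF V(1-3) i(1) E]
      TB.vector_field_subset[OF X V(4)] TB.vector_field_subset[OF Y V(4)]
    by (simp add: ricci_form_def pv)
qed

end

theorem proposition5p5:
  fixes M :: "('i, 'm, 'e::euclidean_space) atlas"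
    and nab D \<gamma>\<^sub>s :: "('m \<Rightarrow> 'i \<Rightarrow> 'e) \<Rightarrow> ('m \<Rightarrow> 'i \<Rightarrow> 'e) \<Rightarrow> 'm \<Rightarrow> 'i \<Rightarrow> 'e"
    and g :: "'m \<Rightarrow> ('i \<Rightarrow> 'e) \<Rightarrow> ('i \<Rightarrow> 'e) \<Rightarrow> real"
  assumes "affine_riemann M nab g"
    and "levi_civita M g D"
    and "adjoint_tensor M g (difference_tensor D nab) \<gamma>\<^sub>s"
    and "trace_vanishes M g \<gamma>\<^sub>s"
  shows "(\<forall>X. vector_field M (carrier_of M) X \<longrightarrow> trace_vanishes M g (cov_deriv D X \<gamma>\<^sub>s)) \<and>
    (\<forall>J\<^sub>1 g\<^sub>1 C. canonical_hermitian M nab g J\<^sub>1 g\<^sub>1 \<longrightarrow>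
       chern_connection (tangent_bundle M) J\<^sub>1 g\<^sub>1 C \<longrightarrow>
       ricci_form_vanishes (tangent_bundle M) J\<^sub>1 g\<^sub>1 C)"
proof (intro conjI allI impI)
  interpret affine_riemann_adjoint M nab D \<gamma>\<^sub>s g
    using assms(1-3) by unfold_locales
  show "trace_vanishes M g (cov_deriv D X \<gamma>\<^sub>s)" if "vector_field M (carrier_of M) X" for X
    by (rule trace_cov_deriv_vanishes[OF assms(4) that])
  fix J\<^sub>1 g\<^sub>1 C
  assume "canonical_hermitian M nab g J\<^sub>1 g\<^sub>1" "chern_connection (tangent_bundle M) J\<^sub>1 g\<^sub>1 C"
  then interpret chern_bundle M nab D \<gamma>\<^sub>s g J\<^sub>1 g\<^sub>1 C
    by unfold_locales
  show "ricci_form_vanishes (tangent_bundle M) J\<^sub>1 g\<^sub>1 C"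
    by (rule chern_ricci_form_vanishes[OF assms(4)])
qed

end
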